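(* Let $X$ be a locally compact noncompact manifold. Assume the Continuum Hypothesis ($\mathrm{CH}$). Then there is a homeomorphism of $\beta X\setminus X$ which is not trivial.
   Context: $\beta X$ denotes the Čech–Stone compactification of $X$ and $\beta X\setminus X$ its remainder. A homeomorphism $\phi$ of $\beta X\setminus X$ is called trivial if there are compact sets $K_1,K_2\subseteq X$ and a homeomorphism $f\colon X\setminus K_1\to X\setminus K_2$ such that $\phi=f^*\restriction(\beta X\setminus X)$, where $f^*\colon \beta X\setminus K_1\to\beta X\setminus K_2$ is the unique continuous extension of $f$ (using $\beta(X\setminus K_i)=\beta X\setminus K_i$). *)

theory Defs
  imports "HOL-Analysis.Analysis"
begin

text \<open>Manifolds are Hausdorff, second countable and without boundary; connectedness is not assumed.\<close>

definition topological_manifold :: "nat \<Rightarrow> 'a topology \<Rightarrow> bool" where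
  "topological_manifold n X \<longleftrightarrow>
     Hausdorff_space X \<and> second_countable X \<and>
     (\<forall>x\<in>topspace X. \<exists>U V. openin X U \<and> x \<in> U \<and> openin (Euclidean_space n) V \<and>
        subtopology X U homeomorphic_space subtopology (Euclidean_space n) V)"

text \<open>The Continuum Hypothesis in the form $2^{\aleph_0} = \aleph_1$.\<close>

definition continuum_hypothesis :: bool where
  "continuum_hypothesis \<longleftrightarrow>
     (card_of (UNIV :: nat set set), cardSuc (card_of (UNIV :: nat set))) \<in> ordIso"

text \<open>The Cech-Stone compactification of a Tychonoff space, constructed in the usual way as the
  closure of the image of the space under the evaluation embedding into the cube
  $[0,1]^{C(X,[0,1])}$. As functions are total, those in $C(X,[0,1])$ are normalised to be
  \<open>undefined\<close> outside the space, so that each one is counted once.\<close>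

definition unit_funs :: "'a topology \<Rightarrow> ('a \<Rightarrow> real) set" where
  "unit_funs X = {g \<in> extensional (topspace X). continuous_map X (top_of_set {0..1}) g}"

definition cs_embed :: "'a topology \<Rightarrow> 'a \<Rightarrow> (('a \<Rightarrow> real) \<Rightarrow> real)" where
  "cs_embed X x = (\<lambda>g\<in>unit_funs X. g x)"

definition cs_compactification :: "'a topology \<Rightarrow> (('a \<Rightarrow> real) \<Rightarrow> real) topology" where
  "cs_compactification X =
     (let cube = product_topology (\<lambda>_. top_of_set {0..1}) (unit_funs X)
      in subtopology cube (cube closure_of (cs_embed X ` topspace X)))"

text \<open>For \<open>K \<subseteq> topspace X\<close>, the subspace $\beta X \setminus K$ of $\beta X$.\<close>

definition cs_minus :: "'a topology \<Rightarrow> 'a set \<Rightarrow> (('a \<Rightarrow> real) \<Rightarrow> real) topology" where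
  "cs_minus X K =
     subtopology (cs_compactification X) (topspace (cs_compactification X) - cs_embed X ` K)"

definition cs_remainder :: "'a topology \<Rightarrow> (('a \<Rightarrow> real) \<Rightarrow> real) topology" where
  "cs_remainder X = cs_minus X (topspace X)"

text \<open>\<open>F\<close> below is the extension $f^*$ of \<open>f\<close>; it is unique because $X \setminus K_1$ is dense in
  the Hausdorff space $\beta X \setminus K_1$. A homeomorphism \<open>f\<close> with no continuous extension
  into $\beta X \setminus K_2$ (for instance inversion on a punctured Euclidean space, which sends
  the remainder to the puncture) does not witness triviality.\<close>

definition trivial_remainder_homeo ::
  "'a topology \<Rightarrow> ((('a \<Rightarrow> real) \<Rightarrow> real) \<Rightarrow> (('a \<Rightarrow> real) \<Rightarrow> real)) \<Rightarrow> bool" where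
  "trivial_remainder_homeo X \<phi> \<longleftrightarrow>
     (\<exists>K\<^sub>1 K\<^sub>2 f F. compactin X K\<^sub>1 \<and> compactin X K\<^sub>2 \<and>
        homeomorphic_map (subtopology X (topspace X - K\<^sub>1)) (subtopology X (topspace X - K\<^sub>2)) f \<and>
        continuous_map (cs_minus X K\<^sub>1) (cs_minus X K\<^sub>2) F \<and>
        (\<forall>x\<in>topspace X - K\<^sub>1. F (cs_embed X x) = cs_embed X (f x)) \<and>
        (\<forall>p\<in>topspace (cs_remainder X). \<phi> p = F p))"

end

theory Submission
  imports Defs
begin

text \<open>Call two functions in $C(X,[0,1])$ equal at infinity if their difference vanishes at
  infinity; points of the remainder do not distinguish such functions. A condition is a countable
  set $D \subseteq C(X,[0,1])$ with a homeomorphism $\phi$ of $X$ from a suitable group; it is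
  strengthened by enlarging $D$ and replacing $\phi$ by some $\phi'$ with $h \circ \phi'$ and
  $h \circ \phi$ equal at infinity for all $h$ in the old $D$ (and likewise for the inverses).
  A chain of conditions whose sets $D$ cover $C(X,[0,1])$ defines a homeomorphism of the remainder
  by $p \mapsto (h \mapsto p(h \circ \phi))$.

  The group must allow descending sequences of conditions to be amalgamated, and must contain, for
  every countable $D$, an element fixing all of $D$ at infinity but moving points outside every
  compact set. Composing with such an element lets a condition be strengthened in two ways that no
  single map on $X$ can follow, so one of them defeats a given candidate for a trivial map. Such a
  candidate is determined by its values on a dense sequence, so under CH there are only $\aleph_1$
  tasks and a chain of length $\omega_1$ fulfils them all.

  In positive dimension the group consists of the homeomorphisms that preserve each member of a
  locally finite sequence of disjoint open sets and fix everything else: these can be recombined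
  blockwise. In dimension 0 the space is countable and discrete, the group is the full symmetric
  group, and amalgamation is a back-and-forth argument.\<close>

section \<open>Chains through continuum many dense sets\<close>

text \<open>The promises of a condition form a system of equations
  \<open>d \<circ> \<phi> = b\<close> at infinity in one unknown \<phi>, and amalgamation is
  countable saturation: a countable system is solvable in the group once its finite parts are.
  Promises about inverses fit in, since \<open>h \<circ> \<psi>' = h \<circ> \<psi>\<close> at
  infinity is the equation for \<phi>' with \<open>d = h \<circ> \<psi>\<close> and
  \<open>b = h\<close>. For arbitrary homeomorphisms of a manifold, approximate solutions used on
  different pieces of the space need not fit together along the boundaries of the pieces; this is
  why the pieces are fixed in advance and kept invariant. In dimension 0 an open set may be a single
  point, in which nothing can be moved, so approximate solutions are matched point by point instead.
  In both cases the solution used at a place (a block or a point) belongs to a level at which it is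
  good there, and only finitely many places have a level below any given bound, so the errors tend
  to 0.\<close>

lemma countable_underS_continuum:
  assumes continuum_hypothesis
  shows "countable (underS (card_of (UNIV :: nat set set)) c)"
proof -
  have "(card_of (underS (card_of (UNIV :: nat set set)) c), card_of (UNIV :: nat set set)) \<in> ordLess"
    by (rule card_of_underS[OF card_of_Card_order]) (simp add: Field_card_of)
  then have "(card_of (underS (card_of (UNIV :: nat set set)) c), cardSuc (card_of (UNIV :: nat set))) \<in> ordLess"
    using assms ordLess_ordIso_trans unfolding continuum_hypothesis_def by blast
  then have "(card_of (underS (card_of (UNIV :: nat set set)) c), card_of (UNIV :: nat set)) \<in> ordLeq"
    by (simp add: cardSuc_ordLeq_ordLess card_of_Card_order)
  then obtain f :: "nat set \<Rightarrow> nat" where "inj_on f (underS (card_of (UNIV :: nat set set)) c)"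
    by (auto simp flip: card_of_ordLeq)
  then show ?thesis
    by (rule countableI)
qed

text \<open>A countable chain may have any countable order type, whereas \<open>closed\<close>
  speaks of descending sequences. The running minimum of an enumeration is such a sequence, and its
  n-th term lies below the n-th member.\<close>

lemma countable_chain_lower_bound:
  fixes le :: "'p \<Rightarrow> 'p \<Rightarrow> bool"
  assumes "P \<noteq> {}"
    and trans: "\<And>p q r. \<lbrakk>p \<in> P; q \<in> P; r \<in> P; le p q; le q r\<rbrakk> \<Longrightarrow> le p r"
    and refl: "\<And>p. p \<in> P \<Longrightarrow> le p p"
    and closed: "\<And>s :: nat \<Rightarrow> 'p. \<lbrakk>\<And>n. s n \<in> P; \<And>m n. m \<le> n \<Longrightarrow> le (s n) (s m)\<rbrakk>
                   \<Longrightarrow> \<exists>p\<in>P. \<forall>n. le p (s n)"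
    and S: "countable S" "S \<subseteq> P" and chain: "\<And>p q. \<lbrakk>p \<in> S; q \<in> S\<rbrakk> \<Longrightarrow> le p q \<or> le q p"
  shows "\<exists>p\<in>P. \<forall>q\<in>S. le p q"
proof (cases "S = {}")
  case True
  with \<open>P \<noteq> {}\<close> show ?thesis by auto
next
  case False
  define e where "e = from_nat_into S"
  have e: "range e = S"
    using False S by (simp add: e_def range_from_nat_into)
  define s where "s = rec_nat (e 0) (\<lambda>n p. if le (e (Suc n)) p then e (Suc n) else p)"
  have s0: "s 0 = e 0" and sSuc: "s (Suc n) = (if le (e (Suc n)) (s n) then e (Suc n) else s n)" for n
    by (auto simp: s_def)
  have sS: "s n \<in> S" for n
    by (induction n) (use e s0 sSuc in auto)
  then have sP: "s n \<in> P" for n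
    using S by blast
  have step: "le (s (Suc n)) (s n)" for n
    using sSuc refl sP by simp
  have desc: "le (s n) (s m)" if "m \<le> n" for m n
    using that
  proof (induction rule: dec_induct)
    case base
    then show ?case using refl sP by simp
  next
    case (step k)
    then show ?case using \<open>\<And>n. le (s (Suc n)) (s n)\<close> trans sP by blast
  qed
  have below: "le (s n) (e n)" for n
  proof (cases n)
    case 0
    then show ?thesis using s0 refl sP by metis
  next
    case (Suc k)
    have "e (Suc k) \<in> S" using e by auto
    then show ?thesis
      using Suc sSuc[of k] chain[OF sS[of k], of "e (Suc k)"] refl S by auto
  qed
  obtain p where p: "p \<in> P" "\<And>n. le p (s n)"
    using closed[of s] sP desc by blast
  have "le p q" if "q \<in> S" for q
  proof -
    obtain n where "q = e n" using e \<open>q \<in> S\<close> by auto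
    then show ?thesis using trans p below sP that S by blast
  qed
  with p show ?thesis by blast
qed

text \<open>Under CH a well-order of type \<open>card_of UNIV\<close> on the reals has countable initial segments, so
  a countably closed order has chains through continuum many dense conditions.\<close>

lemma generic_chain:
  fixes le :: "'p \<Rightarrow> 'p \<Rightarrow> bool" and E :: "nat set \<Rightarrow> 'p \<Rightarrow> bool"
  assumes CH: continuum_hypothesis
    and "P \<noteq> {}"
    and trans: "\<And>p q r. \<lbrakk>p \<in> P; q \<in> P; r \<in> P; le p q; le q r\<rbrakk> \<Longrightarrow> le p r"
    and refl: "\<And>p. p \<in> P \<Longrightarrow> le p p"
    and closed: "\<And>s :: nat \<Rightarrow> 'p. \<lbrakk>\<And>n. s n \<in> P; \<And>m n. m \<le> n \<Longrightarrow> le (s n) (s m)\<rbrakk>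
                   \<Longrightarrow> \<exists>p\<in>P. \<forall>n. le p (s n)"
    and dense: "\<And>c p. p \<in> P \<Longrightarrow> \<exists>q\<in>P. le q p \<and> E c q"
  shows "\<exists>g. (\<forall>c. g c \<in> P \<and> E c (g c)) \<and> (\<forall>c d. le (g c) (g d) \<or> le (g d) (g c))"
proof -
  define r where "r = card_of (UNIV :: nat set set)"
  have wo: "Well_order r"
    unfolding r_def by (rule card_of_Well_order)
  have fld: "Field r = UNIV"
    by (simp add: r_def Field_card_of)
  have wf: "wf (r - Id)"
    using wo by (simp add: well_order_on_def)
  have tot: "(c, d) \<in> r - Id \<or> (d, c) \<in> r - Id \<or> c = d" for c d
    using wo fld unfolding well_order_on_def linear_order_on_def total_on_def by auto
  have tr: "(a, c) \<in> r - Id" if "(a, b) \<in> r - Id" "(b, c) \<in> r - Id" for a b c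
    using wo that unfolding well_order_on_def linear_order_on_def partial_order_on_def
      preorder_on_def trans_def antisym_def by blast
  \<comment> \<open>The value at \<open>c\<close> is constrained only by the values at strictly
    earlier indices, so replacing \<open>f\<close> by its cut below \<open>c\<close> changes nothing
    and well-founded recursion applies.\<close>
  define ok where "ok f c q \<longleftrightarrow> q \<in> P \<and> E c q \<and> (\<forall>d. (d, c) \<in> r - Id \<longrightarrow> le q (f d))" for f c q
  define g where "g = wfrec (r - Id) (\<lambda>f c. SOME q. ok f c q)"
  have g_eq: "g c = (SOME q. ok g c q)" for c
  proof -
    have "g c = (SOME q. ok (cut g (r - Id) c) c q)"
      unfolding g_def by (subst wfrec[OF wf]) simp
    also have "ok (cut g (r - Id) c) c = ok g c"
      by (auto simp: ok_def cut_apply fun_eq_iff)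
    finally show ?thesis .
  qed
  have ok_g: "ok g c (g c)" for c
  proof (induction c rule: wf_induct_rule[OF wf])
    case (1 c)
    have "\<exists>p\<in>P. \<forall>q \<in> g ` underS r c. le p q"
    proof (rule countable_chain_lower_bound[OF \<open>P \<noteq> {}\<close> trans refl closed])
      show "countable (g ` underS r c)"
        using countable_underS_continuum[OF CH] by (simp add: r_def)
      show "g ` underS r c \<subseteq> P"
        using 1 by (auto simp: ok_def underS_def)
      fix p q assume "p \<in> g ` underS r c" "q \<in> g ` underS r c"
      then obtain a b where "a \<in> underS r c" "b \<in> underS r c" "p = g a" "q = g b" by auto
      with 1 tot[of a b] refl show "le p q \<or> le q p"
        by (auto simp: ok_def underS_def)
    qed auto
    then obtain p where p: "p \<in> P" "\<And>d. (d, c) \<in> r - Id \<Longrightarrow> le p (g d)"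
      by (auto simp: underS_def)
    obtain q where q: "q \<in> P" "le q p" "E c q"
      using dense[OF \<open>p \<in> P\<close>] by blast
    have "ok g c q"
      unfolding ok_def
    proof (intro conjI allI impI)
      fix d assume d: "(d, c) \<in> r - Id"
      then have "g d \<in> P" using 1 by (auto simp: ok_def)
      then show "le q (g d)"
        using trans q p d by blast
    qed (use q in auto)
    then show ?case
      unfolding g_eq[of c] by (rule someI)
  qed
  show ?thesis
  proof (intro exI conjI allI)
    fix c d
    show "g c \<in> P" "E c (g c)" using ok_g by (auto simp: ok_def)
    show "le (g c) (g d) \<or> le (g d) (g c)"
      using tot[of c d] ok_g refl by (auto simp: ok_def)
  qed
qed

section \<open>Equality at infinity and the remainder\<close>

definition eq_at_infinity :: "'a topology \<Rightarrow> ('a \<Rightarrow> real) \<Rightarrow> ('a \<Rightarrow> real) \<Rightarrow> bool" where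
  "eq_at_infinity X u v \<longleftrightarrow>
     (\<forall>\<epsilon>>0. \<exists>K. compactin X K \<and> (\<forall>x\<in>topspace X - K. \<bar>u x - v x\<bar> < \<epsilon>))"

text \<open>Cut off to the space because the coordinates of the cube are the extensional functions
  in \<open>unit_funs\<close>; the bare composition need not be one of them.\<close>

definition pullback :: "'a topology \<Rightarrow> ('a \<Rightarrow> 'a) \<Rightarrow> ('a \<Rightarrow> real) \<Rightarrow> 'a \<Rightarrow> real" where
  "pullback X \<phi> h = (\<lambda>x\<in>topspace X. h (\<phi> x))"

definition cs_cube :: "'a topology \<Rightarrow> (('a \<Rightarrow> real) \<Rightarrow> real) topology" where
  "cs_cube X = product_topology (\<lambda>_. top_of_set {0..1}) (unit_funs X)"

lemma eq_at_infinity_cong: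
  assumes "\<And>x. x \<in> topspace X \<Longrightarrow> u x = u' x" "\<And>x. x \<in> topspace X \<Longrightarrow> v x = v' x"
  shows "eq_at_infinity X u v \<longleftrightarrow> eq_at_infinity X u' v'"
  using assms unfolding eq_at_infinity_def by simp

lemma eq_at_infinity_refl: "(\<And>x. x \<in> topspace X \<Longrightarrow> u x = v x) \<Longrightarrow> eq_at_infinity X u v"
  unfolding eq_at_infinity_def by (auto intro!: exI[of _ "{}"])

lemma eq_at_infinity_sym: "eq_at_infinity X u v \<Longrightarrow> eq_at_infinity X v u"
  unfolding eq_at_infinity_def by (simp add: abs_minus_commute)

lemma eq_at_infinity_trans:
  assumes "eq_at_infinity X u v" "eq_at_infinity X v w"
  shows "eq_at_infinity X u w"
  unfolding eq_at_infinity_def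
proof (intro allI impI)
  fix \<epsilon> :: real assume "\<epsilon> > 0"
  then obtain K L where "compactin X K" "\<And>x. x \<in> topspace X - K \<Longrightarrow> \<bar>u x - v x\<bar> < \<epsilon>/2"
    and "compactin X L" "\<And>x. x \<in> topspace X - L \<Longrightarrow> \<bar>v x - w x\<bar> < \<epsilon>/2"
    using assms unfolding eq_at_infinity_def by (metis half_gt_zero)
  moreover have "\<bar>u x - w x\<bar> < \<epsilon>" if "\<bar>u x - v x\<bar> < \<epsilon>/2" "\<bar>v x - w x\<bar> < \<epsilon>/2" for x
    using that by linarith
  ultimately show "\<exists>K. compactin X K \<and> (\<forall>x\<in>topspace X - K. \<bar>u x - w x\<bar> < \<epsilon>)"
    by (intro exI[of _ "K \<union> L"]) (auto intro: compactin_Un)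
qed

text \<open>The exceptional compact set of the composites is the image of \<open>K\<close> under
  \<psi>; for a merely continuous \<phi> the preimage of \<open>K\<close> might not be
  compact.\<close>

lemma eq_at_infinity_compose:
  assumes hom: "homeomorphic_maps X X \<phi> \<psi>" and "eq_at_infinity X u v"
  shows "eq_at_infinity X (\<lambda>x. u (\<phi> x)) (\<lambda>x. v (\<phi> x))"
  unfolding eq_at_infinity_def
proof (intro allI impI)
  fix \<epsilon> :: real assume "\<epsilon> > 0"
  then obtain K where K: "compactin X K" "\<And>x. x \<in> topspace X - K \<Longrightarrow> \<bar>u x - v x\<bar> < \<epsilon>"
    using assms unfolding eq_at_infinity_def by metis
  have "compactin X (\<psi> ` K)"
    using K hom image_compactin unfolding homeomorphic_maps_def by metis
  moreover have "\<phi> x \<in> topspace X - K" if "x \<in> topspace X - \<psi> ` K" for x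
    using that hom unfolding homeomorphic_maps_def continuous_map_def by (auto simp: image_iff)
  ultimately show "\<exists>K. compactin X K \<and> (\<forall>x\<in>topspace X - K. \<bar>u (\<phi> x) - v (\<phi> x)\<bar> < \<epsilon>)"
    using K by (intro exI[of _ "\<psi> ` K"]) auto
qed

lemma pullback_apply [simp]: "x \<in> topspace X \<Longrightarrow> pullback X \<phi> h x = h (\<phi> x)"
  by (simp add: pullback_def)

lemma pullback_in_unit_funs:
  assumes "continuous_map X X \<phi>" "h \<in> unit_funs X"
  shows "pullback X \<phi> h \<in> unit_funs X"
proof -
  have "continuous_map X (top_of_set {0..1}) (h \<circ> \<phi>)"
    using assms by (auto simp: unit_funs_def intro: continuous_map_compose)
  then have "continuous_map X (top_of_set {0..1}) (pullback X \<phi> h)"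
    by (rule continuous_map_eq) simp
  then show ?thesis
    by (simp add: unit_funs_def pullback_def)
qed

lemma unit_funs_bounds:
  assumes "h \<in> unit_funs X" "x \<in> topspace X"
  shows "0 \<le> h x" "h x \<le> 1"
  using assms unfolding unit_funs_def continuous_map_def by auto

lemma unit_funs_continuous: "h \<in> unit_funs X \<Longrightarrow> continuous_map X euclideanreal h"
  by (auto simp: unit_funs_def continuous_map_in_subtopology)

lemma restrict_in_unit_funs:
  assumes "continuous_map X (top_of_set {0..1}) h"
  shows "restrict h (topspace X) \<in> unit_funs X"
  using assms by (auto simp: unit_funs_def intro: continuous_map_eq)

section \<open>The cube, the embedding and the remainder in coordinates\<close>

lemma topspace_cs_cube: "topspace (cs_cube X) = unit_funs X \<rightarrow>\<^sub>E {0..1}"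
  by (simp add: cs_cube_def)

lemma continuous_map_cs_cube_coordinate:
  "h \<in> unit_funs X \<Longrightarrow> continuous_map (cs_cube X) euclideanreal (\<lambda>p. p h)"
  using continuous_map_product_projection[of h "unit_funs X" "\<lambda>_. top_of_set {0..1::real}"]
  by (simp add: cs_cube_def continuous_map_in_subtopology)

lemma compact_space_cs_cube: "compact_space (cs_cube X)"
  unfolding cs_cube_def
  by (auto simp: compact_space_product_topology compact_space_subtopology)

lemma Hausdorff_space_cs_cube: "Hausdorff_space (cs_cube X)"
  by (simp add: cs_cube_def Hausdorff_space_product_topology Hausdorff_space_subtopology)

lemma continuous_map_cs_embed: "continuous_map X (cs_cube X) (cs_embed X)"
  unfolding cs_cube_def continuous_map_componentwise
  by (auto simp: cs_embed_def unit_funs_def)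

lemma cs_embed_apply [simp]: "h \<in> unit_funs X \<Longrightarrow> cs_embed X x h = h x"
  by (simp add: cs_embed_def)

lemma cs_minus_eq:
  "cs_minus X K = subtopology (cs_cube X)
     (cs_cube X closure_of (cs_embed X ` topspace X) - cs_embed X ` K)"
  unfolding cs_minus_def cs_compactification_def Let_def
  unfolding cs_cube_def[symmetric] subtopology_subtopology topspace_subtopology
  by (rule arg_cong[of _ _ "subtopology (cs_cube X)"])
     (use closure_of_subset_topspace in fastforce)

lemma topspace_cs_minus:
  "topspace (cs_minus X K) = cs_cube X closure_of (cs_embed X ` topspace X) - cs_embed X ` K"
  unfolding cs_minus_eq topspace_subtopology using closure_of_subset_topspace by fastforce

lemma topspace_cs_remainder:
  "topspace (cs_remainder X) =
     cs_cube X closure_of (cs_embed X ` topspace X) - cs_embed X ` topspace X"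
  by (simp add: cs_remainder_def topspace_cs_minus)

lemma cs_remainder_subset_cube: "topspace (cs_remainder X) \<subseteq> topspace (cs_cube X)"
  unfolding topspace_cs_remainder using closure_of_subset_topspace by fast

lemma continuous_map_cs_minus_coordinate:
  "h \<in> unit_funs X \<Longrightarrow> continuous_map (cs_minus X K) euclideanreal (\<lambda>p. p h)"
  unfolding cs_minus_eq by (intro continuous_map_from_subtopology continuous_map_cs_cube_coordinate)

text \<open>Compact sets have closed images in the Hausdorff cube, so taking the closure adds no
  points.\<close>

lemma remainder_notin_closure_compact:
  assumes "p \<in> topspace (cs_remainder X)" "compactin X K"
  shows "p \<notin> cs_cube X closure_of (cs_embed X ` K)"
proof -
  have "closedin (cs_cube X) (cs_embed X ` K)"
    using image_compactin[OF assms(2) continuous_map_cs_embed] Hausdorff_space_cs_cube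
    by (rule compactin_imp_closedin[rotated])
  then have "cs_cube X closure_of (cs_embed X ` K) = cs_embed X ` K"
    by (simp add: closure_of_closedin)
  with assms show ?thesis
    using compactin_subset_topspace by (fastforce simp: topspace_cs_remainder)
qed

text \<open>Suppose there is a gap. Points near \<open>p\<close> have coordinates further apart than
  half the gap and avoid the image of \<open>K\<close>; some of them are embedded, and an embedded
  point outside \<open>K\<close> has its two coordinates closer than that.\<close>

lemma remainder_coordinates_eq:
  assumes p: "p \<in> topspace (cs_remainder X)" and uv: "u \<in> unit_funs X" "v \<in> unit_funs X"
    and eq: "eq_at_infinity X u v"
  shows "p u = p v"
proof (rule ccontr)
  assume "p u \<noteq> p v"
  then obtain K where K: "compactin X K" "\<And>x. x \<in> topspace X - K \<Longrightarrow> \<bar>u x - v x\<bar> < \<bar>p u - p v\<bar> / 2"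
    using eq unfolding eq_at_infinity_def by (meson half_gt_zero right_minus_eq zero_less_abs_iff)
  define O1 where "O1 = topspace (cs_cube X) - cs_cube X closure_of (cs_embed X ` K)"
  define O2 where "O2 = {q \<in> topspace (cs_cube X). \<bar>q u - q v\<bar> \<in> {\<bar>p u - p v\<bar> / 2<..}}"
  have "continuous_map (cs_cube X) euclideanreal (\<lambda>q. \<bar>q u - q v\<bar>)"
    by (intro continuous_intros continuous_map_cs_cube_coordinate uv)
  then have "openin (cs_cube X) O2"
    unfolding O2_def by (rule openin_continuous_map_preimage) auto
  moreover have "openin (cs_cube X) O1"
    by (auto simp: O1_def)
  ultimately have "openin (cs_cube X) (O1 \<inter> O2)" by blast
  moreover have "p \<in> O1 \<inter> O2"
    using remainder_notin_closure_compact[OF p K(1)] \<open>p u \<noteq> p v\<close> p cs_remainder_subset_cube[of X]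
    by (auto simp: O1_def O2_def)
  moreover have "p \<in> cs_cube X closure_of (cs_embed X ` topspace X)"
    using p by (simp add: topspace_cs_remainder)
  ultimately have "\<exists>y. y \<in> cs_embed X ` topspace X \<and> y \<in> O1 \<inter> O2"
    unfolding in_closure_of by meson
  then obtain x where x: "x \<in> topspace X" "cs_embed X x \<in> O1 \<inter> O2"
    by blast
  have "x \<notin> K"
  proof
    assume "x \<in> K"
    then have "cs_embed X x \<in> cs_cube X closure_of (cs_embed X ` K)"
      using x(2) closure_of_subset_Int[of "cs_cube X" "cs_embed X ` K"] by (auto simp: O1_def)
    with x(2) show False by (simp add: O1_def)
  qed
  then have "\<bar>u x - v x\<bar> < \<bar>p u - p v\<bar> / 2"
    using K(2) x(1) by blast
  moreover have "\<bar>u x - v x\<bar> > \<bar>p u - p v\<bar> / 2"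
    using x(2) uv by (simp add: O2_def)
  ultimately show False by simp
qed

section \<open>Locally compact second countable Hausdorff spaces\<close>

locale lcsc_Hausdorff_space =
  fixes X :: "'a topology"
  assumes Hausdorff: "Hausdorff_space X"
    and second_countable: "second_countable X"
    and locally_compact: "locally_compact_space X"
begin

lemma regular: "regular_space X"
  using locally_compact Hausdorff by (rule locally_compact_Hausdorff_imp_regular_space)

lemma normal: "normal_space X"
  using regular second_countable
  by (intro regular_Lindelof_imp_normal_space second_countable_imp_Lindelof_space)

lemma countable_base:
  obtains \<B> where "countable \<B>" "\<And>V. V \<in> \<B> \<Longrightarrow> openin X V"
    "\<And>U x. \<lbrakk>openin X U; x \<in> U\<rbrakk> \<Longrightarrow> \<exists>V \<in> \<B>. x \<in> V \<and> V \<subseteq> U"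
proof -
  obtain \<B> where \<B>: "countable \<B>" "\<forall>V\<in>\<B>. openin X V"
    "\<forall>U x. openin X U \<and> x \<in> U \<longrightarrow> (\<exists>V\<in>\<B>. x \<in> V \<and> V \<subseteq> U)"
    using second_countable unfolding second_countable_def by (elim exE conjE)
  show ?thesis
    using \<B>(1) bspec[OF \<B>(2)] \<B>(3)[rule_format, OF conjI] by (rule that)
qed

lemma compact_neighbourhood:
  assumes "x \<in> topspace X"
  obtains U K where "openin X U" "compactin X K" "x \<in> U" "U \<subseteq> K"
  using locally_compact assms unfolding locally_compact_space_def by blast

lemma unit_fun_separating:
  assumes "closedin X S" "closedin X T" "disjnt S T"
  obtains h where "h \<in> unit_funs X" "\<And>x. x \<in> S \<Longrightarrow> h x = 0" "\<And>x. x \<in> T \<Longrightarrow> h x = 1"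
proof -
  obtain f where f: "continuous_map X (top_of_set {0..1::real}) f" "f ` S \<subseteq> {0}" "f ` T \<subseteq> {1}"
    by (rule Urysohn_lemma[OF normal assms, of 0 1]) simp
  show ?thesis
  proof
    show "restrict f (topspace X) \<in> unit_funs X"
      using f(1) by (rule restrict_in_unit_funs)
    show "restrict f (topspace X) x = 0" if "x \<in> S" for x
      using f(2) closedin_subset[OF assms(1)] that by auto
    show "restrict f (topspace X) x = 1" if "x \<in> T" for x
      using f(3) closedin_subset[OF assms(2)] that by auto
  qed
qed

text \<open>Such a function equals 0 at infinity and is 1 at \<open>x\<close>, so its coordinate
  tells the embedded point from all points of the remainder.\<close>

lemma unit_fun_bump:
  assumes "x \<in> topspace X"
  obtains h K where "h \<in> unit_funs X" "h x = 1" "compactin X K"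
    "\<And>y. y \<in> topspace X - K \<Longrightarrow> h y = 0"
proof -
  obtain U K where UK: "openin X U" "compactin X K" "x \<in> U" "U \<subseteq> K"
    using assms by (rule compact_neighbourhood)
  have sing: "closedin X {x}"
    using assms Hausdorff by (simp add: closedin_Hausdorff_singleton)
  have compl: "closedin X (topspace X - U)"
    using UK by blast
  have disj: "disjnt (topspace X - U) {x}"
    using UK by (auto simp: disjnt_def)
  obtain h where h: "h \<in> unit_funs X" "\<And>y. y \<in> topspace X - U \<Longrightarrow> h y = 0"
      "\<And>y. y \<in> {x} \<Longrightarrow> h y = 1"
    by (rule unit_fun_separating[OF compl sing disj]) (rule that)
  show ?thesis
  proof (rule that[of h K])
    show "h y = 0" if "y \<in> topspace X - K" for y
      using that h(2) UK(4) by blast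
  qed (use h UK in auto)
qed

text \<open>The sequence is cofinal among the compact sets, not merely covering: finitely many
  relatively compact basic sets cover \<open>K\<close>, and the largest of their indices serves as
  \<open>k\<close>.\<close>

lemma compactin_exhaustion:
  obtains C where "\<And>k :: nat. compactin X (C k)" "\<And>k l. k \<le> l \<Longrightarrow> C k \<subseteq> C l"
    "\<And>K. compactin X K \<Longrightarrow> \<exists>k. K \<subseteq> C k"
proof -
  obtain \<B> where \<B>: "countable \<B>" "\<And>V. V \<in> \<B> \<Longrightarrow> openin X V"
    and base: "\<And>U x. \<lbrakk>openin X U; x \<in> U\<rbrakk> \<Longrightarrow> \<exists>V \<in> \<B>. x \<in> V \<and> V \<subseteq> U"
    by (rule countable_base) (rule that)
  \<comment> \<open>The empty set makes the family nonempty, so that \<open>from_nat_into\<close>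
    enumerates exactly its members.\<close>
  define \<C> where "\<C> = insert {} {V \<in> \<B>. compactin X (X closure_of V)}"
  have "countable \<C>" "\<C> \<noteq> {}"
    using \<B> by (auto simp: \<C>_def)
  then have e: "range (from_nat_into \<C>) = \<C>"
    by (rule range_from_nat_into[rotated])
  define C where "C k = (\<Union>j\<le>k. X closure_of (from_nat_into \<C> j))" for k
  have opn: "openin X V" and cpt: "compactin X (X closure_of V)" if "V \<in> \<C>" for V
    using that \<B> by (auto simp: \<C>_def)
  show ?thesis
  proof
    show "compactin X (C k)" for k
      unfolding C_def by (intro compactin_Union) (use cpt e in auto)
    show "C k \<subseteq> C l" if "k \<le> l" for k l
      using that by (auto simp: C_def intro: order_trans)
    fix K assume K: "compactin X K"
    have "K \<subseteq> \<Union>\<C>"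
    proof
      fix x assume "x \<in> K"
      then have "x \<in> topspace X" using K compactin_subset_topspace by blast
      then obtain U where U: "openin X U" "compactin X (X closure_of U)" "x \<in> U"
        using locally_compact Hausdorff locally_compact_space_compact_closure_of[of X] by blast
      then obtain V where "V \<in> \<B>" "x \<in> V" "V \<subseteq> U"
        using base[of U x] by blast
      then have "compactin X (X closure_of V)"
        using closed_compactin[OF U(2) closure_of_mono closedin_closure_of] by blast
      then have "V \<in> \<C>"
        using \<open>V \<in> \<B>\<close> by (simp add: \<C>_def)
      with \<open>x \<in> V\<close> show "x \<in> \<Union>\<C>" by blast
    qed
    then obtain \<F> where \<F>: "finite \<F>" "\<F> \<subseteq> \<C>" "K \<subseteq> \<Union>\<F>"
      using compactinD[OF K, of \<C>] opn by blast
    then obtain J where J: "finite J" "\<F> = from_nat_into \<C> ` J"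
      using finite_subset_image[of \<F> "from_nat_into \<C>" UNIV] e by auto
    then obtain k where k: "\<And>j. j \<in> J \<Longrightarrow> j \<le> k"
      using finite_nat_set_iff_bounded_le by auto
    have "V \<subseteq> C k" if V: "V \<in> \<F>" for V
    proof -
      obtain j where "j \<in> J" "V = from_nat_into \<C> j" using J V by auto
      moreover have "V \<subseteq> X closure_of V"
        using closure_of_subset[OF openin_subset[OF opn]] V \<F>(2) by blast
      ultimately show ?thesis using k by (auto simp: C_def)
    qed
    with \<F> show "\<exists>k. K \<subseteq> C k" by blast
  qed
qed

text \<open>Such a family is locally finite: a compact neighbourhood of a point off the image
  contains only finitely many terms, and deleting these leaves a neighbourhood of the point.\<close>

lemma closedin_escaping_image:
  assumes "\<And>i. i \<in> I \<Longrightarrow> a i \<in> topspace X"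
    and esc: "\<And>K. compactin X K \<Longrightarrow> finite {i \<in> I. a i \<in> K}"
  shows "closedin X (a ` I)"
proof -
  have "\<exists>T. openin X T \<and> x \<in> T \<and> T \<subseteq> topspace X - a ` I" if x: "x \<in> topspace X - a ` I" for x
  proof -
    obtain U K where UK: "openin X U" "compactin X K" "x \<in> U" "U \<subseteq> K"
      using x by (elim DiffE) (rule compact_neighbourhood)
    define T where "T = U - a ` {i \<in> I. a i \<in> K}"
    have "finite (a ` {i \<in> I. a i \<in> K})"
      using esc[OF UK(2)] by simp
    moreover have "a ` {i \<in> I. a i \<in> K} \<subseteq> topspace X"
      using assms(1) by blast
    ultimately have "closedin X (a ` {i \<in> I. a i \<in> K})"
      using Hausdorff by (intro compactin_imp_closedin finite_imp_compactin)
    then have "openin X T"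
      unfolding T_def by (rule openin_diff[OF UK(1)])
    moreover have "x \<in> T"
      using UK(3) x by (auto simp: T_def)
    moreover have "T \<subseteq> topspace X - a ` I"
      using UK(4) openin_subset[OF UK(1)] by (auto simp: T_def)
    ultimately show ?thesis by blast
  qed
  then have "openin X (topspace X - a ` I)"
    by (intro iffD2[OF openin_subopen] ballI)
  moreover have "a ` I \<subseteq> topspace X"
    using assms(1) by blast
  ultimately show ?thesis
    by (simp add: closedin_def)
qed

text \<open>Compactness of the cube yields \<open>p\<close>: otherwise finitely many open sets, each
  containing the points of finitely many indices, would cover everything and \<open>I\<close> would
  be finite.\<close>

lemma escaping_accumulates_in_remainder:
  fixes a :: "nat \<Rightarrow> 'a"
  assumes "infinite I" and aX: "\<And>i. i \<in> I \<Longrightarrow> a i \<in> topspace X"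
    and esc: "\<And>K. compactin X K \<Longrightarrow> finite {i \<in> I. a i \<in> K}"
  obtains p where "p \<in> topspace (cs_remainder X)"
    "\<And>W. \<lbrakk>openin (cs_cube X) W; p \<in> W\<rbrakk> \<Longrightarrow> infinite {i \<in> I. cs_embed X (a i) \<in> W}"
proof -
  have eI: "cs_embed X (a i) \<in> topspace (cs_cube X)" if "i \<in> I" for i
    using continuous_map_cs_embed[of X] aX[OF that] by (auto simp: continuous_map_def)
  have "\<exists>p \<in> topspace (cs_cube X). \<forall>W. openin (cs_cube X) W \<and> p \<in> W \<longrightarrow>
          infinite {i \<in> I. cs_embed X (a i) \<in> W}"
  proof (rule ccontr)
    assume "\<not> ?thesis"
    then have "\<exists>W. openin (cs_cube X) W \<and> p \<in> W \<and> finite {i \<in> I. cs_embed X (a i) \<in> W}"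
      if "p \<in> topspace (cs_cube X)" for p
      using that by blast
    then have "topspace (cs_cube X) \<subseteq>
        \<Union>{W. openin (cs_cube X) W \<and> finite {i \<in> I. cs_embed X (a i) \<in> W}}"
      by (intro subsetI) (simp add: conj_ac)
    then have "\<exists>\<F>. finite \<F> \<and> \<F> \<subseteq> {W. openin (cs_cube X) W \<and>
        finite {i \<in> I. cs_embed X (a i) \<in> W}} \<and> topspace (cs_cube X) \<subseteq> \<Union>\<F>"
      by (intro compactinD[OF compact_space_cs_cube[of X, unfolded compact_space_def]]) simp_all
    then obtain \<F> where "finite \<F>" and sub: "\<F> \<subseteq> {W. openin (cs_cube X) W \<and>
        finite {i \<in> I. cs_embed X (a i) \<in> W}}" and cov: "topspace (cs_cube X) \<subseteq> \<Union>\<F>"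
      by (elim exE conjE)
    have fin: "finite {i \<in> I. cs_embed X (a i) \<in> W}" if "W \<in> \<F>" for W
      using subsetD[OF sub that] by simp
    have "I \<subseteq> (\<Union>W\<in>\<F>. {i \<in> I. cs_embed X (a i) \<in> W})"
      using cov eI by blast
    moreover have "finite (\<Union>W\<in>\<F>. {i \<in> I. cs_embed X (a i) \<in> W})"
      using \<open>finite \<F>\<close> fin by (rule finite_UN_I)
    ultimately show False
      using \<open>infinite I\<close> finite_subset by blast
  qed
  then obtain p where p: "p \<in> topspace (cs_cube X)"
    and acc: "\<And>W. \<lbrakk>openin (cs_cube X) W; p \<in> W\<rbrakk> \<Longrightarrow> infinite {i \<in> I. cs_embed X (a i) \<in> W}"
    by blast
  have "p \<in> cs_cube X closure_of (cs_embed X ` topspace X)"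
    unfolding in_closure_of
  proof (intro conjI p allI impI)
    fix W assume "p \<in> W \<and> openin (cs_cube X) W"
    then have "infinite {i \<in> I. cs_embed X (a i) \<in> W}"
      using acc by simp
    then have "{i \<in> I. cs_embed X (a i) \<in> W} \<noteq> {}"
      by (rule infinite_imp_nonempty)
    then show "\<exists>y. y \<in> cs_embed X ` topspace X \<and> y \<in> W"
      using aX by blast
  qed
  \<comment> \<open>Near an embedded point the bump coordinate is positive, which would place
    infinitely many terms in the compact support of the bump.\<close>
  moreover have "p \<notin> cs_embed X ` topspace X"
  proof
    assume "p \<in> cs_embed X ` topspace X"
    then obtain x where x: "x \<in> topspace X" "p = cs_embed X x" by blast
    obtain h K where h: "h \<in> unit_funs X" "h x = 1" "compactin X K"
      "\<And>y. y \<in> topspace X - K \<Longrightarrow> h y = 0"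
      by (rule unit_fun_bump[OF x(1)]) (rule that)
    define W where "W = {q \<in> topspace (cs_cube X). q h \<in> {0<..}}"
    have "openin (cs_cube X) W"
      unfolding W_def using continuous_map_cs_cube_coordinate[OF h(1)]
      by (rule openin_continuous_map_preimage) auto
    moreover have "p \<in> W"
      using p x h by (simp add: W_def)
    ultimately have "infinite {i \<in> I. cs_embed X (a i) \<in> W}"
      by (rule acc)
    moreover have "a i \<in> K" if "i \<in> I" "cs_embed X (a i) \<in> W" for i
      using that h(1) h(4)[of "a i"] aX[of i] by (auto simp: W_def)
    then have "{i \<in> I. cs_embed X (a i) \<in> W} \<subseteq> {i \<in> I. a i \<in> K}"
      by blast
    ultimately show False
      using esc[OF h(3)] finite_subset by blast
  qed
  ultimately have "p \<in> topspace (cs_remainder X)"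
    by (simp add: topspace_cs_remainder)
  then show ?thesis
    using acc by (rule that)
qed

end

section \<open>Homeomorphisms of the remainder from coherent families\<close>

text \<open>A basic neighbourhood in a product restricts finitely many coordinates; this lets one
  index of the chain serve them all.\<close>

lemma finite_subset_chain_member:
  assumes "finite F" "\<And>h. h \<in> F \<Longrightarrow> \<exists>c. h \<in> D c"
    and chain: "\<And>c d. D c \<subseteq> D d \<or> D d \<subseteq> D c"
  shows "\<exists>c. F \<subseteq> D c"
  using assms(1,2)
proof (induction F rule: finite_induct)
  case (insert h F)
  then obtain c d where "F \<subseteq> D c" "h \<in> D d" by (metis insertCI)
  then show ?case
    using chain[of c d] by blast
qed auto

context lcsc_Hausdorff_space
begin

text \<open>A basic neighbourhood of the image of \<open>p\<close> involves finitely many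
  \<open>h\<close>, all in one \<open>D c\<close>. It pulls back along \<open>\<phi> c\<close> to a
  neighbourhood of \<open>p\<close>, which contains an embedded \<open>x\<close>; then the embedded
  point \<open>\<phi> c x\<close> lies in the original neighbourhood.\<close>

lemma coherent_family_map:
  fixes D :: "'c \<Rightarrow> ('a \<Rightarrow> real) set" and \<phi> \<psi> :: "'c \<Rightarrow> 'a \<Rightarrow> 'a"
  assumes hom: "\<And>c. homeomorphic_maps X X (\<phi> c) (\<psi> c)"
    and D: "\<And>c. D c \<subseteq> unit_funs X"
    and cover: "\<And>h. h \<in> unit_funs X \<Longrightarrow> \<exists>c. h \<in> D c"
    and chain: "\<And>c d. D c \<subseteq> D d \<or> D d \<subseteq> D c"
    and coherent: "\<And>c d h. \<lbrakk>h \<in> D c; h \<in> D d\<rbrakk>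
                     \<Longrightarrow> eq_at_infinity X (\<lambda>x. h (\<phi> c x)) (\<lambda>x. h (\<phi> d x))"
  shows "\<exists>\<Phi>. continuous_map (cs_remainder X) (cs_remainder X) \<Phi> \<and>
           (\<forall>c. \<forall>h\<in>D c. \<forall>p\<in>topspace (cs_remainder X). \<Phi> p h = p (pullback X (\<phi> c) h))"
proof -
  have cont: "continuous_map X X (\<phi> c)" "continuous_map X X (\<psi> c)" for c
    using hom[of c] by (auto simp: homeomorphic_maps_def)
  have pb: "pullback X (\<phi> c) h \<in> unit_funs X" if "h \<in> unit_funs X" for c h
    using cont(1) that by (rule pullback_in_unit_funs)
  \<comment> \<open>Every index whose set contains \<open>h\<close> gives the same coordinate, by
    coherence and \<open>remainder_coordinates_eq\<close>; \<open>ix\<close> selects one.\<close>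
  obtain ix where ix: "\<And>h. h \<in> unit_funs X \<Longrightarrow> h \<in> D (ix h)"
    using cover by metis
  define \<Phi> where "\<Phi> = (\<lambda>p. \<lambda>h\<in>unit_funs X. p (pullback X (\<phi> (ix h)) h) :: real)"
  have \<Phi>: "\<Phi> p h = p (pullback X (\<phi> c) h)"
    if h: "h \<in> D c" and p: "p \<in> topspace (cs_remainder X)" for c h p
  proof -
    have hU: "h \<in> unit_funs X" using D h by blast
    have "p (pullback X (\<phi> (ix h)) h) = p (pullback X (\<phi> c) h)"
    proof (rule remainder_coordinates_eq[OF p pb[OF hU] pb[OF hU]])
      show "eq_at_infinity X (pullback X (\<phi> (ix h)) h) (pullback X (\<phi> c) h)"
        using coherent[OF ix[OF hU] h] by (simp cong: eq_at_infinity_cong)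
    qed
    then show ?thesis using hU by (simp add: \<Phi>_def)
  qed
  have in_rem: "\<Phi> p \<in> topspace (cs_remainder X)" if p: "p \<in> topspace (cs_remainder X)" for p
  proof -
    have pcube: "p \<in> topspace (cs_cube X)" and pcl: "p \<in> cs_cube X closure_of (cs_embed X ` topspace X)"
      using p cs_remainder_subset_cube[of X] by (auto simp: topspace_cs_remainder)
    have bd: "p h \<in> {0..1}" if "h \<in> unit_funs X" for h
      using pcube that by (auto simp: topspace_cs_cube)
    have "\<Phi> p \<in> topspace (cs_cube X)"
      using bd[OF pb] by (auto simp: topspace_cs_cube \<Phi>_def)
    moreover have "\<exists>y. y \<in> cs_embed X ` topspace X \<and> y \<in> T"
      if T: "\<Phi> p \<in> T" "openin (cs_cube X) T" for T
    proof -
      obtain U where U: "finite {h \<in> unit_funs X. U h \<noteq> topspace (top_of_set {0..1::real})}"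
          "\<And>h. h \<in> unit_funs X \<Longrightarrow> openin (top_of_set {0..1::real}) (U h)"
          "\<Phi> p \<in> Pi\<^sub>E (unit_funs X) U" "Pi\<^sub>E (unit_funs X) U \<subseteq> T"
        using bspec[OF T(2)[unfolded cs_cube_def openin_product_topology_alt] T(1)]
        by (elim exE conjE) (rule that, simp_all)
      define F where "F = {h \<in> unit_funs X. U h \<noteq> topspace (top_of_set {0..1::real})}"
      have finF: "finite F"
        using U(1) by (simp add: F_def)
      have "\<exists>c. F \<subseteq> D c"
      proof (rule finite_subset_chain_member[OF finF _ chain])
        show "\<exists>c. h \<in> D c" if "h \<in> F" for h
          using that by (intro cover) (simp add: F_def)
      qed
      then obtain c where c: "F \<subseteq> D c" by blast
      define W where "W = topspace (cs_cube X) \<inter>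
        (\<Inter>h\<in>F. {q \<in> topspace (cs_cube X). q (pullback X (\<phi> c) h) \<in> U h})"
      have "openin (cs_cube X) {q \<in> topspace (cs_cube X). q (pullback X (\<phi> c) h) \<in> U h}"
        if "h \<in> F" for h
      proof -
        have hU: "h \<in> unit_funs X" using that by (simp add: F_def)
        have "continuous_map (cs_cube X) (top_of_set {0..1}) (\<lambda>q. q (pullback X (\<phi> c) h))"
          unfolding cs_cube_def by (rule continuous_map_product_projection) (rule pb[OF hU])
        then show ?thesis
          using U(2)[OF hU] by (rule openin_continuous_map_preimage)
      qed
      then have "openin (cs_cube X) W"
        unfolding W_def using finF
        by (cases "F = {}") (auto intro!: openin_Int openin_Inter)
      moreover have "p \<in> W"
      proof -
        have "p (pullback X (\<phi> c) h) \<in> U h" if "h \<in> F" for h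
        proof -
          have "\<Phi> p h \<in> U h" using U(3) that by (auto simp: F_def)
          then show ?thesis using \<Phi>[of h c p] c that p by auto
        qed
        with pcube show ?thesis by (auto simp: W_def)
      qed
      ultimately obtain y where y: "y \<in> cs_embed X ` topspace X" "y \<in> W"
        using pcl unfolding in_closure_of by meson
      then obtain x where x: "x \<in> topspace X" "y = cs_embed X x" by blast
      have \<phi>x: "\<phi> c x \<in> topspace X"
        using cont(1)[of c] x by (auto simp: continuous_map_def)
      have "cs_embed X (\<phi> c x) \<in> Pi\<^sub>E (unit_funs X) U"
      proof (rule PiE_I)
        fix h assume h: "h \<in> unit_funs X"
        show "cs_embed X (\<phi> c x) h \<in> U h"
        proof (cases "h \<in> F")
          case True
          then show ?thesis using y x h pb[OF h] by (auto simp: W_def)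
        next
          case False
          then show ?thesis using h \<phi>x unit_funs_bounds[of h X "\<phi> c x"] by (auto simp: F_def)
        qed
      qed (simp add: cs_embed_def)
      with U(4) \<phi>x show ?thesis by blast
    qed
    ultimately have "\<Phi> p \<in> cs_cube X closure_of (cs_embed X ` topspace X)"
      unfolding in_closure_of by blast
    \<comment> \<open>A bump \<open>h\<close> equals 0 at infinity, and this survives composition
      with the homeomorphism \<open>\<phi> c\<close>. Hence the \<open>h\<close>-coordinate of the
      image is 0, whereas at the supposed embedded point it is 1.\<close>
    moreover have "\<Phi> p \<notin> cs_embed X ` topspace X"
    proof
      assume "\<Phi> p \<in> cs_embed X ` topspace X"
      then obtain x where x: "x \<in> topspace X" "\<Phi> p = cs_embed X x" by blast
      obtain h K where h: "h \<in> unit_funs X" "h x = 1" "compactin X K"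
        "\<And>y. y \<in> topspace X - K \<Longrightarrow> h y = 0"
        by (rule unit_fun_bump[OF x(1)]) (rule that)
      obtain c where c: "h \<in> D c" using cover h(1) by blast
      define z where "z = (\<lambda>x\<in>topspace X. 0::real)"
      have z: "z \<in> unit_funs X" "pullback X (\<phi> c) z \<in> unit_funs X"
      proof -
        show "z \<in> unit_funs X"
          unfolding z_def by (rule restrict_in_unit_funs) auto
        then show "pullback X (\<phi> c) z \<in> unit_funs X" by (rule pb)
      qed
      have hz: "eq_at_infinity X h z"
        unfolding eq_at_infinity_def using h(3,4) by (auto simp: z_def)
      have "p (pullback X (\<phi> c) h) = p (pullback X (\<phi> c) z)"
      proof (rule remainder_coordinates_eq[OF p pb[OF h(1)] z(2)])
        show "eq_at_infinity X (pullback X (\<phi> c) h) (pullback X (\<phi> c) z)"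
          using eq_at_infinity_compose[OF hom hz, of c] by (simp cong: eq_at_infinity_cong)
      qed
      also have "pullback X (\<phi> c) z = z"
        using cont(1)[of c] by (auto simp: z_def pullback_def continuous_map_def Pi_iff fun_eq_iff)
      also have "p z = 0"
      proof (rule ccontr)
        assume nz: "p z \<noteq> 0"
        define W where "W = {q \<in> topspace (cs_cube X). q z \<in> - {0}}"
        have "openin (cs_cube X) W"
          unfolding W_def by (rule openin_continuous_map_preimage[OF continuous_map_cs_cube_coordinate[OF z(1)]]) auto
        moreover have "p \<in> W" using nz pcube by (simp add: W_def)
        ultimately obtain y where "y \<in> cs_embed X ` topspace X" "y \<in> W"
          using pcl unfolding in_closure_of by meson
        with z show False by (auto simp: W_def z_def)
      qed
      finally have "\<Phi> p h = 0" using \<Phi>[OF c p] by simp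
      with x h show False by simp
    qed
    ultimately show ?thesis by (simp add: topspace_cs_remainder)
  qed
  have "continuous_map (cs_remainder X) (cs_cube X) \<Phi>"
    unfolding cs_cube_def continuous_map_componentwise
  proof (intro conjI ballI)
    show "\<Phi> ` topspace (cs_remainder X) \<subseteq> extensional (unit_funs X)"
      by (auto simp: \<Phi>_def)
    fix h assume h: "h \<in> unit_funs X"
    have "continuous_map (cs_remainder X) (top_of_set {0..1}) (\<lambda>p. p (pullback X (\<phi> (ix h)) h))"
      unfolding cs_remainder_def cs_minus_eq cs_cube_def
      by (intro continuous_map_from_subtopology continuous_map_product_projection pb h)
    then show "continuous_map (cs_remainder X) (top_of_set {0..1}) (\<lambda>p. \<Phi> p h)"
      by (rule continuous_map_eq) (simp add: \<Phi>_def h)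
  qed
  then have "continuous_map (cs_remainder X) (cs_remainder X) \<Phi>"
    using in_rem unfolding cs_remainder_def topspace_cs_minus
    unfolding cs_minus_eq by (auto simp: continuous_map_in_subtopology)
  with \<Phi> show ?thesis by blast
qed

text \<open>\<open>coherent_family_map\<close> applies to both families and gives maps in both
  directions; the work lies in showing that they cancel.\<close>

lemma coherent_family_homeomorphism:
  fixes D :: "'c \<Rightarrow> ('a \<Rightarrow> real) set" and \<phi> \<psi> :: "'c \<Rightarrow> 'a \<Rightarrow> 'a"
  assumes hom: "\<And>c. homeomorphic_maps X X (\<phi> c) (\<psi> c)"
    and D: "\<And>c. D c \<subseteq> unit_funs X"
    and cover: "\<And>h. h \<in> unit_funs X \<Longrightarrow> \<exists>c. h \<in> D c"
    and chain: "\<And>c d. D c \<subseteq> D d \<or> D d \<subseteq> D c"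
    and coherent: "\<And>c d h. \<lbrakk>h \<in> D c; h \<in> D d\<rbrakk>
                     \<Longrightarrow> eq_at_infinity X (\<lambda>x. h (\<phi> c x)) (\<lambda>x. h (\<phi> d x))"
    and coherent': "\<And>c d h. \<lbrakk>h \<in> D c; h \<in> D d\<rbrakk>
                     \<Longrightarrow> eq_at_infinity X (\<lambda>x. h (\<psi> c x)) (\<lambda>x. h (\<psi> d x))"
  shows "\<exists>\<Phi>. homeomorphic_map (cs_remainder X) (cs_remainder X) \<Phi> \<and>
           (\<forall>c. \<forall>h\<in>D c. \<forall>p\<in>topspace (cs_remainder X). \<Phi> p h = p (pullback X (\<phi> c) h))"
proof -
  have hom': "homeomorphic_maps X X (\<psi> c) (\<phi> c)" for c
    using hom by (rule iffD1[OF homeomorphic_maps_sym])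
  \<comment> \<open>Stated for arbitrary families so that it can be applied a second time with the
    two families exchanged.\<close>
  have inverse: "\<Psi> (\<Phi> p) = p"
    if hom: "\<And>c. homeomorphic_maps X X (\<phi> c) (\<psi> c)"
      and coherent': "\<And>c d h. \<lbrakk>h \<in> D c; h \<in> D d\<rbrakk>
                     \<Longrightarrow> eq_at_infinity X (\<lambda>x. h (\<psi> c x)) (\<lambda>x. h (\<psi> d x))"
      and c\<Phi>: "continuous_map (cs_remainder X) (cs_remainder X) \<Phi>"
      and \<Phi>: "\<And>c h p. \<lbrakk>h \<in> D c; p \<in> topspace (cs_remainder X)\<rbrakk> \<Longrightarrow> \<Phi> p h = p (pullback X (\<phi> c) h)"
      and c\<Psi>: "continuous_map (cs_remainder X) (cs_remainder X) \<Psi>"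
      and \<Psi>: "\<And>c h p. \<lbrakk>h \<in> D c; p \<in> topspace (cs_remainder X)\<rbrakk> \<Longrightarrow> \<Psi> p h = p (pullback X (\<psi> c) h)"
      and p: "p \<in> topspace (cs_remainder X)"
    for \<phi> \<psi> :: "'c \<Rightarrow> 'a \<Rightarrow> 'a" and \<Phi> \<Psi> p
  proof -
    have \<Phi>p: "\<Phi> p \<in> topspace (cs_remainder X)"
      using c\<Phi> p by (auto simp: continuous_map_def)
    have "\<Psi> (\<Phi> p) \<in> topspace (cs_remainder X)"
      using c\<Psi> \<Phi>p by (auto simp: continuous_map_def)
    then have cube: "\<Psi> (\<Phi> p) \<in> unit_funs X \<rightarrow>\<^sub>E {0..1}" "p \<in> unit_funs X \<rightarrow>\<^sub>E {0..1}"
      using p cs_remainder_subset_cube[of X] by (auto simp: topspace_cs_cube)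
    show ?thesis
    proof (rule PiE_ext[OF cube])
      fix h assume h: "h \<in> unit_funs X"
      have c\<phi>: "continuous_map X X (\<phi> c)" "continuous_map X X (\<psi> c)"
        and inv: "\<And>x. x \<in> topspace X \<Longrightarrow> \<psi> c (\<phi> c x) = x" for c
        using hom[of c] by (auto simp: homeomorphic_maps_def)
      have \<phi>X: "\<phi> c x \<in> topspace X" if "x \<in> topspace X" for c x
        using c\<phi>(1)[of c] that by (auto simp: continuous_map_def)
      obtain c where c: "h \<in> D c" using cover h by blast
      define k where "k = pullback X (\<psi> c) h"
      have k: "k \<in> unit_funs X"
        unfolding k_def by (rule pullback_in_unit_funs[OF c\<phi>(2) h])
      obtain c' where "k \<in> D c'" using cover k by blast
      \<comment> \<open>\<open>k\<close> arises from \<open>\<psi> c\<close> but need not belong to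
        \<open>D c\<close>. At an index \<open>d\<close> whose set contains both \<open>k\<close>
        and \<open>h\<close>, coherence replaces \<open>\<psi> c\<close> by \<open>\<psi> d\<close>,
        which cancels against \<open>\<phi> d\<close>.\<close>
      then obtain d where d: "k \<in> D d" "h \<in> D d"
        using c chain[of c c'] by blast
      have "\<Psi> (\<Phi> p) h = \<Phi> p k"
        using \<Psi>[OF c \<Phi>p] by (simp add: k_def)
      also have "\<dots> = p (pullback X (\<phi> d) k)"
        using \<Phi>[OF d(1) p] .
      also have "\<dots> = p h"
      proof (rule remainder_coordinates_eq[OF p pullback_in_unit_funs[OF c\<phi>(1) k] h])
        have "eq_at_infinity X (\<lambda>x. h (\<psi> c (\<phi> d x))) (\<lambda>x. h (\<psi> d (\<phi> d x)))"
          by (rule eq_at_infinity_compose[OF hom coherent'[OF c d(2)]])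
        then show "eq_at_infinity X (pullback X (\<phi> d) k) h"
          by (simp add: k_def inv \<phi>X cong: eq_at_infinity_cong)
      qed
      finally show "\<Psi> (\<Phi> p) h = p h" .
    qed
  qed
  have ex: "\<exists>\<Phi>. continuous_map (cs_remainder X) (cs_remainder X) \<Phi> \<and>
      (\<forall>c. \<forall>h\<in>D c. \<forall>p\<in>topspace (cs_remainder X). \<Phi> p h = p (pullback X (\<phi> c) h))"
    using hom D cover chain coherent by (rule coherent_family_map)
  have ex': "\<exists>\<Psi>. continuous_map (cs_remainder X) (cs_remainder X) \<Psi> \<and>
      (\<forall>c. \<forall>h\<in>D c. \<forall>p\<in>topspace (cs_remainder X). \<Psi> p h = p (pullback X (\<psi> c) h))"
    using hom' D cover chain coherent' by (rule coherent_family_map)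
  obtain \<Phi> where \<Phi>: "continuous_map (cs_remainder X) (cs_remainder X) \<Phi>"
    "\<And>c h p. \<lbrakk>h \<in> D c; p \<in> topspace (cs_remainder X)\<rbrakk> \<Longrightarrow> \<Phi> p h = p (pullback X (\<phi> c) h)"
    using ex by blast
  obtain \<Psi> where \<Psi>: "continuous_map (cs_remainder X) (cs_remainder X) \<Psi>"
    "\<And>c h p. \<lbrakk>h \<in> D c; p \<in> topspace (cs_remainder X)\<rbrakk> \<Longrightarrow> \<Psi> p h = p (pullback X (\<psi> c) h)"
    using ex' by blast
  have "\<Psi> (\<Phi> p) = p" if "p \<in> topspace (cs_remainder X)" for p
    using hom coherent' \<Phi> \<Psi> that by (rule inverse)
  moreover have "\<Phi> (\<Psi> p) = p" if "p \<in> topspace (cs_remainder X)" for p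
    using hom' coherent \<Psi> \<Phi> that by (rule inverse)
  ultimately have "homeomorphic_maps (cs_remainder X) (cs_remainder X) \<Phi> \<Psi>"
    unfolding homeomorphic_maps_def using \<Phi>(1) \<Psi>(1) by simp
  with \<Phi>(2) show ?thesis
    using homeomorphic_maps_imp_map by blast
qed

text \<open>An accumulation point of the points \<open>a i\<close> lies in the remainder, and there the two continuous
  functions computing the \<open>h\<close>-coordinates of \<open>\<Phi>\<close> and \<open>F\<close> are at distance 1.\<close>

lemma escaping_values_separate_maps:
  fixes a :: "nat \<Rightarrow> 'a"
  assumes \<Phi>: "\<And>p. p \<in> topspace (cs_remainder X) \<Longrightarrow> \<Phi> p h = p (pullback X \<phi> h)"
    and h: "h \<in> unit_funs X" and \<phi>: "continuous_map X X \<phi>"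
    and K: "compactin X K" and F: "continuous_map (cs_minus X K) (cs_minus X L) F"
    and Ff: "\<And>x. x \<in> topspace X - K \<Longrightarrow> F (cs_embed X x) = cs_embed X (f x)"
    and I: "infinite I" and a: "\<And>i. i \<in> I \<Longrightarrow> a i \<in> topspace X"
    and esc: "\<And>K. compactin X K \<Longrightarrow> finite {i \<in> I. a i \<in> K}"
    and far: "\<And>i. \<lbrakk>i \<in> I; a i \<notin> K\<rbrakk> \<Longrightarrow> \<bar>h (\<phi> (a i)) - h (f (a i))\<bar> = 1"
  shows "\<exists>p\<in>topspace (cs_remainder X). \<Phi> p \<noteq> F p"
proof (rule ccontr)
  assume "\<not> ?thesis"
  then have eq: "\<Phi> p = F p" if "p \<in> topspace (cs_remainder X)" for p
    using that by blast
  obtain p where p: "p \<in> topspace (cs_remainder X)"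
    and acc: "\<And>W. \<lbrakk>openin (cs_cube X) W; p \<in> W\<rbrakk> \<Longrightarrow> infinite {i \<in> I. cs_embed X (a i) \<in> W}"
    using escaping_accumulates_in_remainder[OF I a esc] by blast
  have pK: "p \<in> topspace (cs_minus X K)"
    using p compactin_subset_topspace[OF K] by (auto simp: topspace_cs_remainder topspace_cs_minus)
  have pb: "pullback X \<phi> h \<in> unit_funs X"
    by (rule pullback_in_unit_funs[OF \<phi> h])
  have "continuous_map (cs_minus X K) euclideanreal (\<lambda>q. F q h)"
    using continuous_map_compose[OF F continuous_map_cs_minus_coordinate[OF h]] by (simp add: o_def)
  then have "continuous_map (cs_minus X K) euclideanreal (\<lambda>q. \<bar>F q h - q (pullback X \<phi> h)\<bar>)"
    by (intro continuous_intros continuous_map_cs_minus_coordinate pb)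
  then have "openin (cs_minus X K) {q \<in> topspace (cs_minus X K). \<bar>F q h - q (pullback X \<phi> h)\<bar> \<in> {..<1}}"
    by (rule openin_continuous_map_preimage) auto
  then obtain W where W: "openin (cs_cube X) W"
    "{q \<in> topspace (cs_minus X K). \<bar>F q h - q (pullback X \<phi> h)\<bar> \<in> {..<1}} = W \<inter> topspace (cs_minus X K)"
    unfolding topspace_cs_minus unfolding cs_minus_eq openin_subtopology by blast
  have "p \<in> W"
    using W(2) pK eq[OF p] \<Phi>[OF p] by fastforce
  then have "infinite ({i \<in> I. cs_embed X (a i) \<in> W} - {i \<in> I. a i \<in> K})"
    using acc[OF W(1)] esc[OF K] by (simp add: Diff_infinite_finite)
  then obtain i where i: "i \<in> I" "cs_embed X (a i) \<in> W" "a i \<notin> K"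
    using infinite_imp_nonempty by blast
  have "cs_embed X (a i) \<in> topspace (cs_cube X)"
    using continuous_map_cs_embed[of X] a[OF i(1)] by (auto simp: continuous_map_def)
  \<comment> \<open>This is injectivity of the embedding: a function separating \<open>a i\<close>
    from a point of \<open>K\<close> is itself a coordinate.\<close>
  moreover have "cs_embed X (a i) \<notin> cs_embed X ` K"
  proof
    assume "cs_embed X (a i) \<in> cs_embed X ` K"
    then obtain y where y: "y \<in> K" "cs_embed X (a i) = cs_embed X y" by blast
    have yX: "y \<in> topspace X" using y compactin_subset_topspace[OF K] by blast
    have "disjnt {a i} {y}" using y i by auto
    moreover have "closedin X {a i}" "closedin X {y}"
      using a[OF i(1)] yX Hausdorff by (auto simp: closedin_Hausdorff_singleton)
    ultimately obtain g where g: "g \<in> unit_funs X" "\<And>x. x \<in> {a i} \<Longrightarrow> g x = 0" "\<And>x. x \<in> {y} \<Longrightarrow> g x = 1"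
      using unit_fun_separating[of "{a i}" "{y}"] by blast
    then have "g (a i) = g y" using y(2) by (metis cs_embed_apply)
    with g show False by simp
  qed
  ultimately have "cs_embed X (a i) \<in> topspace (cs_minus X K)"
    using a[OF i(1)] closure_of_subset_Int[of "cs_cube X" "cs_embed X ` topspace X"]
    by (auto simp: topspace_cs_minus)
  then have "cs_embed X (a i) \<in> {q \<in> topspace (cs_minus X K). \<bar>F q h - q (pullback X \<phi> h)\<bar> \<in> {..<1}}"
    using W(2) i by blast
  then have "\<bar>h (f (a i)) - h (\<phi> (a i))\<bar> < 1"
    using Ff[of "a i"] a[OF i(1)] i(3) h pb by simp
  with far[OF i(1,3)] show False by (simp add: abs_minus_commute)
qed

end

section \<open>Separating sequences and counting maps\<close>

text \<open>Greedy choice in a graph with finite degrees: the finitely many chosen vertices rule out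
  only finitely many others. Each choice also exceeds the earlier ones, which makes the chosen set
  infinite.\<close>

lemma infinite_independent_subset:
  fixes R :: "nat \<Rightarrow> nat \<Rightarrow> bool"
  assumes "infinite I" and fin: "\<And>i. i \<in> I \<Longrightarrow> finite {j \<in> I. R i j}"
    and sym: "\<And>i j. R i j \<Longrightarrow> R j i"
  shows "\<exists>J\<subseteq>I. infinite J \<and> (\<forall>i\<in>J. \<forall>j\<in>J. i \<noteq> j \<longrightarrow> \<not> R i j)"
proof -
  define P where "P f n r \<longleftrightarrow> r \<in> I \<and> (\<forall>m<n. f m < r \<and> \<not> R (f m) r)" for f r and n :: nat
  have "\<exists>f. \<forall>n. P f n (f n)"
  proof (rule dependent_wellorder_choice[where P = P])
    fix r n :: nat and f g :: "nat \<Rightarrow> nat" assume "\<And>y. y < n \<Longrightarrow> f y = g y"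
    then show "P f n r = P g n r" by (simp add: P_def)
  next
    fix n :: nat and f :: "nat \<Rightarrow> nat" assume IH: "\<And>y. y < n \<Longrightarrow> P f y (f y)"
    have "finite (\<Union>m<n. {j \<in> I. R (f m) j} \<union> {..f m})"
      using IH fin by (auto simp: P_def)
    then obtain r where "r \<in> I" "r \<notin> (\<Union>m<n. {j \<in> I. R (f m) j} \<union> {..f m})"
      using \<open>infinite I\<close> by (meson finite_subset subsetI)
    then show "\<exists>r. P f n r"
      by (intro exI[of _ r]) (force simp: P_def)
  qed
  then obtain f where f: "\<And>n. P f n (f n)" by blast
  have smono: "strict_mono f"
    using f by (auto simp: P_def strict_mono_def)
  have indep: "\<not> R (f m) (f n)" if "m \<noteq> n" for m n
    using f[of n] f[of m] that sym by (auto simp: P_def nat_neq_iff)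
  show ?thesis
  proof (intro exI conjI ballI impI)
    show "range f \<subseteq> I"
      using f by (auto simp: P_def)
    show "infinite (range f)"
      using strict_mono_imp_inj_on[OF smono] by (rule range_inj_infinite)
    fix i j assume "i \<in> range f" "j \<in> range f" "i \<noteq> j"
    then show "\<not> R i j"
      using indep by (metis imageE)
  qed
qed

context lcsc_Hausdorff_space
begin

text \<open>Either \<open>s\<close> visits some compact \<open>K\<close> infinitely often, and
  \<open>K\<close> is the closed set on which the function vanishes; or \<open>s\<close> escapes
  too, and the only obstruction is a coincidence \<open>a i = s j\<close> with different indices,
  which an independent set of indices avoids.\<close>

lemma unit_fun_separating_sequences:
  fixes a s :: "nat \<Rightarrow> 'a"
  assumes I: "infinite I" and a: "\<And>i. i \<in> I \<Longrightarrow> a i \<in> topspace X"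
    and s: "\<And>i. i \<in> I \<Longrightarrow> s i \<in> topspace X"
    and esc: "\<And>K. compactin X K \<Longrightarrow> finite {i \<in> I. a i \<in> K}"
    and neq: "\<And>i. i \<in> I \<Longrightarrow> a i \<noteq> s i"
  shows "\<exists>h\<in>unit_funs X. \<exists>J\<subseteq>I. infinite J \<and> (\<forall>i\<in>J. h (a i) = 1 \<and> h (s i) = 0)"
proof -
  have esc_sub: "finite {i \<in> J. a i \<in> K}" if "J \<subseteq> I" "compactin X K" for J K
    using esc[OF that(2)] by (rule finite_subset[rotated]) (use that in auto)
  have separate: ?thesis
    if J: "J \<subseteq> I" "infinite J" and S: "closedin X S" "s ` J \<subseteq> S" "disjnt S (a ` J)" for J S
  proof -
    have "closedin X (a ` J)"
      by (rule closedin_escaping_image) (use J a esc_sub in auto)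
    then obtain h where "h \<in> unit_funs X" "\<And>x. x \<in> S \<Longrightarrow> h x = 0" "\<And>x. x \<in> a ` J \<Longrightarrow> h x = 1"
      using unit_fun_separating[OF S(1) _ S(3)] by blast
    then show ?thesis
      using J S by (intro bexI[of _ h] exI[of _ J]) auto
  qed
  show ?thesis
  proof (cases "\<exists>K. compactin X K \<and> infinite {i \<in> I. s i \<in> K}")
    case True
    then obtain K where K: "compactin X K" "infinite {i \<in> I. s i \<in> K}" by blast
    define J where "J = {i \<in> I. s i \<in> K} - {i \<in> I. a i \<in> K}"
    have "infinite J"
      unfolding J_def using K esc[OF K(1)] by (simp add: Diff_infinite_finite)
    then show ?thesis
      by (rule separate[of J K, rotated])
         (use K Hausdorff compactin_imp_closedin in \<open>auto simp: J_def disjnt_iff\<close>)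
  next
    case False
    then have escs: "finite {i \<in> I. s i \<in> K}" if "compactin X K" for K
      using that by blast
    define R where "R i j \<longleftrightarrow> a i = s j \<or> s i = a j" for i j
    have "finite {j \<in> I. R i j}" if i: "i \<in> I" for i
    proof (rule finite_subset)
      show "{j \<in> I. R i j} \<subseteq> {j \<in> I. s j \<in> {a i}} \<union> {j \<in> I. a j \<in> {s i}}"
        by (auto simp: R_def)
      show "finite ({j \<in> I. s j \<in> {a i}} \<union> {j \<in> I. a j \<in> {s i}})"
        using esc[of "{s i}"] escs[of "{a i}"] a[OF i] s[OF i] by auto
    qed
    moreover have "R j i" if "R i j" for i j
      using that by (auto simp: R_def)
    ultimately have "\<exists>J\<subseteq>I. infinite J \<and> (\<forall>i\<in>J. \<forall>j\<in>J. i \<noteq> j \<longrightarrow> \<not> R i j)"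
      by (rule infinite_independent_subset[OF I])
    then obtain J where J: "J \<subseteq> I" "infinite J" "\<And>i j. \<lbrakk>i \<in> J; j \<in> J; i \<noteq> j\<rbrakk> \<Longrightarrow> \<not> R i j"
      by blast
    have "closedin X (s ` J)"
    proof (rule closedin_escaping_image)
      fix K assume "compactin X K"
      then show "finite {i \<in> J. s i \<in> K}"
        by (rule finite_subset[OF _ escs, rotated]) (use J in auto)
    qed (use J s in auto)
    moreover have "s i \<noteq> a j" if "i \<in> J" "j \<in> J" for i j
      using that J neq[of i] by (cases "i = j") (auto simp: R_def)
    then have "disjnt (s ` J) (a ` J)"
      by (auto simp: disjnt_iff)
    ultimately show ?thesis
      using separate[of J "s ` J"] J by blast
  qed
qed

section \<open>Coding functions and sequences by sets of natural numbers\<close>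

lemma dense_sequence:
  assumes "topspace X \<noteq> {}"
  obtains q :: "nat \<Rightarrow> 'a" where "range q \<subseteq> topspace X" "X closure_of (range q) = topspace X"
proof -
  obtain C where C: "countable C" "C \<subseteq> topspace X" "X closure_of C = topspace X"
    using second_countable_imp_separable_space[OF second_countable]
    unfolding separable_space_def by blast
  then have "C \<noteq> {}" using assms by (metis closure_of_empty)
  then have "range (from_nat_into C) = C"
    using C by (simp add: range_from_nat_into)
  with C show ?thesis using that[of "from_nat_into C"] by simp
qed

text \<open>By continuity a function is determined by its values on a dense sequence, and these by
  their rational cuts; this is the injective code \<open>c\<close>. A surjection from
  \<open>nat set\<close> is the form in which \<open>generic_chain\<close> indexes its
  tasks.\<close>

lemma unit_funs_surjection:
  assumes "topspace X \<noteq> {}"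
  obtains e :: "nat set \<Rightarrow> 'a \<Rightarrow> real" where "range e = unit_funs X"
proof -
  obtain q :: "nat \<Rightarrow> 'a" where q: "range q \<subseteq> topspace X" "X closure_of (range q) = topspace X"
    using dense_sequence[OF assms] by blast
  define c where "c h = to_nat ` {(k, r :: rat). h (q k) < of_rat r}" for h :: "'a \<Rightarrow> real"
  have "inj_on c (unit_funs X)"
  proof (rule inj_onI)
    fix g h assume gh: "g \<in> unit_funs X" "h \<in> unit_funs X" "c g = c h"
    have "{(k, r :: rat). g (q k) < of_rat r} = {(k, r). h (q k) < of_rat r}"
      using gh(3) unfolding c_def by (simp add: inj_image_eq_iff)
    then have iff: "g (q k) < of_rat r \<longleftrightarrow> h (q k) < of_rat r" for k r
      by (auto simp: set_eq_iff)
    have "g (q k) = h (q k)" for k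
    proof (rule ccontr)
      assume "g (q k) \<noteq> h (q k)"
      then consider "g (q k) < h (q k)" | "h (q k) < g (q k)" by linarith
      then show False
      proof cases
        case 1
        then obtain r where "g (q k) < of_rat r" "of_rat r < h (q k)" using of_rat_dense by blast
        then show False using iff[of k r] by simp
      next
        case 2
        then obtain r where "h (q k) < of_rat r" "of_rat r < g (q k)" using of_rat_dense by blast
        then show False using iff[of k r] by simp
      qed
    qed
    then have "g x = h x" if "x \<in> topspace X" for x
      using forall_in_closure_of_eq[OF _ Hausdorff_space_euclidean unit_funs_continuous[OF gh(1)]
          unit_funs_continuous[OF gh(2)], of x "range q"] q(2) that by auto
    with gh show "g = h"
      by (auto simp: unit_funs_def intro: extensionalityI)
  qed
  moreover have "unit_funs X \<noteq> {}"
    using restrict_in_unit_funs[of X "\<lambda>_. 0"] by fastforce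
  ultimately show ?thesis
    using inj_on_iff_surj[of "unit_funs X" "UNIV :: nat set set"] that by auto
qed

text \<open>A point of a Hausdorff space is determined by the basic sets that contain it, so a
  sequence of points is coded by a set of pairs of naturals.\<close>

lemma sequences_surjection:
  assumes "topspace X \<noteq> {}"
  obtains e :: "nat set \<Rightarrow> nat \<Rightarrow> 'a" where "range e = (UNIV \<rightarrow> topspace X)"
proof -
  obtain \<B> where \<B>: "countable \<B>" "\<And>V. V \<in> \<B> \<Longrightarrow> openin X V"
    and base: "\<And>U x. \<lbrakk>openin X U; x \<in> U\<rbrakk> \<Longrightarrow> \<exists>V \<in> \<B>. x \<in> V \<and> V \<subseteq> U"
    by (rule countable_base) (rule that)
  define c where "c s = to_nat ` {(k, n). s k \<in> from_nat_into \<B> n}" for s :: "nat \<Rightarrow> 'a"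
  have "inj_on c (UNIV \<rightarrow> topspace X)"
  proof (intro inj_onI ext)
    fix s t k assume st: "s \<in> UNIV \<rightarrow> topspace X" "t \<in> UNIV \<rightarrow> topspace X" "c s = c t"
    have "{(k, n). s k \<in> from_nat_into \<B> n} = {(k, n). t k \<in> from_nat_into \<B> n}"
      using st(3) unfolding c_def by (simp add: inj_image_eq_iff)
    then have iff: "s k \<in> from_nat_into \<B> n \<longleftrightarrow> t k \<in> from_nat_into \<B> n" for k n
      by (auto simp: set_eq_iff)
    show "s k = t k"
    proof (rule ccontr)
      assume "s k \<noteq> t k"
      then obtain U where "openin X U" "s k \<in> U" "t k \<notin> U"
        using Hausdorff st unfolding Hausdorff_space_def disjnt_iff by (metis PiE UNIV_I)
      then obtain V where V: "V \<in> \<B>" "s k \<in> V" "V \<subseteq> U"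
        using base by blast
      then obtain n where "V = from_nat_into \<B> n"
        using \<B>(1) from_nat_into_surj by metis
      with V iff[of k n] \<open>t k \<notin> U\<close> show False by blast
    qed
  qed
  moreover have "(UNIV \<rightarrow> topspace X :: (nat \<Rightarrow> 'a) set) \<noteq> {}"
    using assms by (simp add: Pi_eq_empty)
  ultimately show ?thesis
    using inj_on_iff_surj[of "UNIV \<rightarrow> topspace X :: (nat \<Rightarrow> 'a) set" "UNIV :: nat set set"] that
    by auto
qed

end

section \<open>The forcing construction\<close>

text \<open>\<open>P\<close> is a system of equations \<open>d \<circ> \<phi> = b\<close> at
  infinity in the unknown \<phi>, and \<open>saturated\<close> is a compactness principle for
  countable systems. Members of \<open>H\<close> carry their inverses along because they are
  functions on the whole type, invertible on the space only.\<close>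

locale saturated_homeo_group = lcsc_Hausdorff_space X for X :: "'a topology" +
  fixes H :: "(('a \<Rightarrow> 'a) \<times> ('a \<Rightarrow> 'a)) set"
  assumes homeo: "(\<phi>, \<psi>) \<in> H \<Longrightarrow> homeomorphic_maps X X \<phi> \<psi>"
    and id_mem: "(id, id) \<in> H"
    and compose_mem: "\<lbrakk>(\<phi>, \<psi>) \<in> H; (\<rho>, \<sigma>) \<in> H\<rbrakk> \<Longrightarrow> (\<phi> \<circ> \<rho>, \<sigma> \<circ> \<psi>) \<in> H"
    and saturated:
      "\<lbrakk>countable P; P \<subseteq> unit_funs X \<times> unit_funs X;
        \<And>F. \<lbrakk>finite F; F \<subseteq> P\<rbrakk> \<Longrightarrow>
          \<exists>(\<phi>, \<psi>)\<in>H. \<forall>(b, d)\<in>F. eq_at_infinity X (\<lambda>x. d (\<phi> x)) b\<rbrakk>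
       \<Longrightarrow> \<exists>(\<phi>, \<psi>)\<in>H. \<forall>(b, d)\<in>P. eq_at_infinity X (\<lambda>x. d (\<phi> x)) b"
    and small_moves:
      "\<lbrakk>countable D; D \<subseteq> unit_funs X\<rbrakk> \<Longrightarrow>
         \<exists>(\<rho>, \<sigma>)\<in>H. (\<forall>h\<in>D. eq_at_infinity X (\<lambda>x. h (\<rho> x)) h) \<and>
           (\<forall>K. compactin X K \<longrightarrow> (\<exists>x\<in>topspace X - K. \<rho> x \<noteq> x))"
begin

section \<open>Conditions and countable closure\<close>

definition conditions :: "(('a \<Rightarrow> real) set \<times> ('a \<Rightarrow> 'a) \<times> ('a \<Rightarrow> 'a)) set" where
  "conditions = {(D, \<phi>, \<psi>). countable D \<and> D \<subseteq> unit_funs X \<and> (\<phi>, \<psi>) \<in> H}"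

text \<open>A condition \<open>(D, \<phi>, \<psi>)\<close> promises that the homeomorphism of the remainder under
  construction acts on the functions in \<open>D\<close> as \<open>\<phi>\<close> does, and its inverse as \<open>\<psi>\<close> does.\<close>

definition stronger ::
  "('a \<Rightarrow> real) set \<times> ('a \<Rightarrow> 'a) \<times> ('a \<Rightarrow> 'a) \<Rightarrow>
   ('a \<Rightarrow> real) set \<times> ('a \<Rightarrow> 'a) \<times> ('a \<Rightarrow> 'a) \<Rightarrow> bool" where
  "stronger p q \<longleftrightarrow>
     (case p of (D', \<phi>', \<psi>') \<Rightarrow> case q of (D, \<phi>, \<psi>) \<Rightarrow>
        D \<subseteq> D' \<and> (\<forall>h\<in>D. eq_at_infinity X (\<lambda>x. h (\<phi>' x)) (\<lambda>x. h (\<phi> x)) \<and>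
                         eq_at_infinity X (\<lambda>x. h (\<psi>' x)) (\<lambda>x. h (\<psi> x))))"

lemma stronger_refl: "stronger p p"
  by (auto simp: stronger_def eq_at_infinity_refl split: prod.split)

lemma stronger_trans: "\<lbrakk>stronger p q; stronger q r\<rbrakk> \<Longrightarrow> stronger p r"
  unfolding stronger_def by (auto split: prod.splits) (meson eq_at_infinity_trans subsetD)+

text \<open>Agreement of \<psi>' with \<open>\<psi> n\<close> on \<open>h\<close> at infinity is
  rewritten as an equation for \<phi>', namely that \<open>h \<circ> \<psi> n\<close> composed with
  \<phi>' is \<open>h\<close>. A finite part of the resulting system comes from the conditions up to
  some stage \<open>n\<close>, and \<open>\<phi> n\<close> solves it.\<close>

lemma stronger_closed:
  assumes s: "\<And>n :: nat. s n \<in> conditions" and desc: "\<And>m n. m \<le> n \<Longrightarrow> stronger (s n) (s m)"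
  shows "\<exists>p\<in>conditions. \<forall>n. stronger p (s n)"
proof -
  define D where "D n = fst (s n)" for n
  define \<phi> where "\<phi> n = fst (snd (s n))" for n
  define \<psi> where "\<psi> n = snd (snd (s n))" for n
  have s_eq: "s n = (D n, \<phi> n, \<psi> n)" for n
    by (simp add: D_def \<phi>_def \<psi>_def)
  have D: "countable (D n)" "D n \<subseteq> unit_funs X" and H: "(\<phi> n, \<psi> n) \<in> H" for n
    using s[of n] by (auto simp: s_eq conditions_def)
  have hom: "homeomorphic_maps X X (\<phi> n) (\<psi> n)" for n
    using homeo[OF H] .
  have mono: "D m \<subseteq> D n" if "m \<le> n" for m n
    using desc[OF that] by (auto simp: stronger_def s_eq)
  have co: "eq_at_infinity X (\<lambda>x. h (\<phi> n x)) (\<lambda>x. h (\<phi> m x))"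
      "eq_at_infinity X (\<lambda>x. h (\<psi> n x)) (\<lambda>x. h (\<psi> m x))" if "m \<le> n" "h \<in> D m" for m n h
    using desc[OF that(1)] that(2) by (auto simp: stronger_def s_eq)
  define P where "P = (\<Union>n. (\<lambda>h. (pullback X (\<phi> n) h, h)) ` D n \<union> (\<lambda>h. (h, pullback X (\<psi> n) h)) ` D n)"
  have cont: "continuous_map X X (\<phi> n)" "continuous_map X X (\<psi> n)"
    and inv: "\<And>x. x \<in> topspace X \<Longrightarrow> \<psi> n (\<phi> n x) = x" for n
    using hom[of n] by (auto simp: homeomorphic_maps_def)
  have \<phi>X: "\<phi> n x \<in> topspace X" if "x \<in> topspace X" for n x
    using cont(1)[of n] that by (auto simp: continuous_map_def)
  have "\<exists>(\<phi>', \<psi>')\<in>H. \<forall>(b, d)\<in>P. eq_at_infinity X (\<lambda>x. d (\<phi>' x)) b"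
  proof (rule saturated)
    show "countable P"
      unfolding P_def using D by auto
    show "P \<subseteq> unit_funs X \<times> unit_funs X"
      unfolding P_def using D(2) pullback_in_unit_funs[OF cont(1)] pullback_in_unit_funs[OF cont(2)]
      by blast
    fix F assume F: "finite F" "F \<subseteq> P"
    define Q where "Q n = {p. \<exists>m\<le>n. \<exists>h\<in>D m. p = (pullback X (\<phi> m) h, h) \<or> p = (h, pullback X (\<psi> m) h)}" for n
    have Q: "Q m \<subseteq> Q n" if "m \<le> n" for m n
      using that by (auto simp: Q_def intro: order_trans)
    have "\<exists>n. F \<subseteq> Q n"
    proof (rule finite_subset_chain_member[OF F(1)])
      fix p assume "p \<in> F"
      then show "\<exists>n. p \<in> Q n"
        using F(2) unfolding P_def Q_def by blast
    qed (use Q nat_le_linear in blast)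
    then obtain n where n: "F \<subseteq> Q n" by blast
    have "eq_at_infinity X (\<lambda>x. d (\<phi> n x)) b" if "(b, d) \<in> F" for b d
    proof -
      have "(b, d) \<in> Q n" using n that by blast
      then obtain m h where m: "m \<le> n" "h \<in> D m"
        and "(b, d) = (pullback X (\<phi> m) h, h) \<or> (b, d) = (h, pullback X (\<psi> m) h)"
        unfolding Q_def by blast
      then consider "b = pullback X (\<phi> m) h" "d = h" | "b = h" "d = pullback X (\<psi> m) h"
        by auto
      then show ?thesis
      proof cases
        case 1
        then show ?thesis using co(1)[OF m] by (simp cong: eq_at_infinity_cong)
      next
        case 2
        have "eq_at_infinity X (\<lambda>x. h (\<psi> n (\<phi> n x))) (\<lambda>x. h (\<psi> m (\<phi> n x)))"
          using eq_at_infinity_compose[OF hom co(2)[OF m]] .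
        then show ?thesis
          using 2 by - (rule eq_at_infinity_sym, simp add: inv \<phi>X cong: eq_at_infinity_cong)
      qed
    qed
    with H[of n] show "\<exists>(\<phi>', \<psi>')\<in>H. \<forall>(b, d)\<in>F. eq_at_infinity X (\<lambda>x. d (\<phi>' x)) b"
      by (intro bexI[of _ "(\<phi> n, \<psi> n)"]) auto
  qed
  then obtain x where x: "x \<in> H" "\<forall>(b, d)\<in>P. eq_at_infinity X (\<lambda>x'. d (fst x x')) b"
    by (rule bexE) (simp add: case_prod_beta)
  obtain \<phi>' \<psi>' where "x = (\<phi>', \<psi>')"
    by (cases x)
  with x have H': "(\<phi>', \<psi>') \<in> H"
    and P: "\<And>b d. (b, d) \<in> P \<Longrightarrow> eq_at_infinity X (\<lambda>x. d (\<phi>' x)) b"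
    by auto
  have hom': "homeomorphic_maps X X \<psi>' \<phi>'"
    using homeo[OF H'] by (rule iffD1[OF homeomorphic_maps_sym])
  have \<psi>'X: "\<psi>' x \<in> topspace X" "\<phi>' (\<psi>' x) = x" if "x \<in> topspace X" for x
    using hom' that by (auto simp: homeomorphic_maps_def continuous_map_def)
  have "stronger (\<Union>n. D n, \<phi>', \<psi>') (s n)" for n
  proof -
    have "eq_at_infinity X (\<lambda>x. h (\<phi>' x)) (\<lambda>x. h (\<phi> n x)) \<and>
          eq_at_infinity X (\<lambda>x. h (\<psi>' x)) (\<lambda>x. h (\<psi> n x))" if h: "h \<in> D n" for h
    proof
      have "(pullback X (\<phi> n) h, h) \<in> P"
        using h by (auto simp: P_def)
      from P[OF this] show "eq_at_infinity X (\<lambda>x. h (\<phi>' x)) (\<lambda>x. h (\<phi> n x))"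
        by (simp cong: eq_at_infinity_cong)
      have "(h, pullback X (\<psi> n) h) \<in> P"
        using h by (auto simp: P_def)
      \<comment> \<open>Composition with \<psi>' turns the equation back into a statement about the
        inverses.\<close>
      from eq_at_infinity_compose[OF hom' P[OF this]]
      have "eq_at_infinity X (\<lambda>x. h (\<psi> n x)) (\<lambda>x. h (\<psi>' x))"
        by (simp add: \<psi>'X cong: eq_at_infinity_cong)
      then show "eq_at_infinity X (\<lambda>x. h (\<psi>' x)) (\<lambda>x. h (\<psi> n x))"
        by (rule eq_at_infinity_sym)
    qed
    then show ?thesis by (auto simp: stronger_def s_eq)
  qed
  moreover have "(\<Union>n. D n, \<phi>', \<psi>') \<in> conditions"
    using D H' by (auto simp: conditions_def)
  ultimately show ?thesis by blast
qed

section \<open>Evading the candidates for trivial maps\<close>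

text \<open>\<open>s\<close> is meant as the list of values of a candidate map along the dense
  sequence \<open>q\<close>. As \<open>h\<close> is among the promises of \<open>p\<close>, its
  coordinate of the final homeomorphism is already decided by \<open>p\<close>. The gap 1 comes from
  Urysohn functions with values 0 and 1.\<close>

definition evades :: "(nat \<Rightarrow> 'a) \<Rightarrow> (nat \<Rightarrow> 'a) \<Rightarrow> ('a \<Rightarrow> real) set \<times> ('a \<Rightarrow> 'a) \<times> ('a \<Rightarrow> 'a) \<Rightarrow> bool" where
  "evades q s p \<longleftrightarrow> (\<exists>h\<in>fst p. \<exists>I. infinite I \<and> (\<forall>K. compactin X K \<longrightarrow> finite {i \<in> I. q i \<in> K}) \<and>
     (\<forall>i\<in>I. \<bar>h (fst (snd p) (q i)) - h (s i)\<bar> = 1))"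

text \<open>In a Hausdorff space the points moved by \<rho> form an open set, so outside each
  \<open>C k\<close> a moved point can be replaced by a moved term of the dense sequence.\<close>

lemma escaping_moved_points:
  assumes q: "X closure_of (range q) = topspace X" and \<rho>: "continuous_map X X \<rho>"
    and moves: "\<And>K. compactin X K \<Longrightarrow> \<exists>x\<in>topspace X - K. \<rho> x \<noteq> x"
  shows "\<exists>I :: nat set. infinite I \<and> (\<forall>K. compactin X K \<longrightarrow> finite {i \<in> I. q i \<in> K}) \<and> (\<forall>i\<in>I. \<rho> (q i) \<noteq> q i)"
proof -
  obtain C where C: "\<And>k :: nat. compactin X (C k)" "\<And>k l. k \<le> l \<Longrightarrow> C k \<subseteq> C l"
    "\<And>K. compactin X K \<Longrightarrow> \<exists>k. K \<subseteq> C k"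
    by (rule compactin_exhaustion) (rule that)
  have "\<exists>i. q i \<in> topspace X - C k \<and> \<rho> (q i) \<noteq> q i" for k
  proof -
    obtain x where x: "x \<in> topspace X - C k" "\<rho> x \<noteq> x"
      using moves C(1) by blast
    have "closedin X {x \<in> topspace X. \<rho> x = x}"
      using closedin_continuous_maps_eq[OF Hausdorff \<rho> continuous_map_id] by simp
    moreover have "closedin X (C k)"
      using Hausdorff C(1) by (rule compactin_imp_closedin)
    ultimately have "openin X (topspace X - {x \<in> topspace X. \<rho> x = x} - C k)"
      by (intro openin_diff) auto
    moreover have "x \<in> topspace X - {x \<in> topspace X. \<rho> x = x} - C k"
      using x by blast
    moreover have "x \<in> X closure_of (range q)"
      using x q by blast
    ultimately obtain y where "y \<in> range q" "y \<in> topspace X - {x \<in> topspace X. \<rho> x = x} - C k"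
      unfolding in_closure_of by meson
    then show ?thesis by blast
  qed
  then obtain j where j: "\<And>k. q (j k) \<in> topspace X - C k" "\<And>k. \<rho> (q (j k)) \<noteq> q (j k)"
    by metis
  have fin: "finite {i \<in> range j. q i \<in> K}" if "compactin X K" for K
  proof -
    obtain k where k: "K \<subseteq> C k" using C(3)[OF \<open>compactin X K\<close>] by blast
    have "{i \<in> range j. q i \<in> K} \<subseteq> j ` {..<k}"
    proof
      fix i assume "i \<in> {i \<in> range j. q i \<in> K}"
      then obtain l where l: "i = j l" "q (j l) \<in> K" by auto
      then have "\<not> k \<le> l" using k j(1)[of l] C(2)[of k l] by blast
      with l show "i \<in> j ` {..<k}" by auto
    qed
    then show ?thesis by (rule finite_subset) simp
  qed
  \<comment> \<open>A finite set of indices would give a finite, hence compact, set of points inside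
    some \<open>C k\<close>, but \<open>q (j k)\<close> was chosen outside
    \<open>C k\<close>.\<close>
  have "infinite (range j)"
  proof
    assume "finite (range j)"
    then have "compactin X (q ` range j)"
      using j(1) by (intro finite_imp_compactin) auto
    then obtain k where "q ` range j \<subseteq> C k" using C(3) by blast
    then show False using j(1)[of k] by blast
  qed
  then show ?thesis
    using fin j(2) by (intro exI[of _ "range j"]) auto
qed

lemma evading_dense:
  assumes q: "range q \<subseteq> topspace X" "X closure_of (range q) = topspace X"
    and s: "\<And>i. s i \<in> topspace X" and p: "p \<in> conditions"
  shows "\<exists>p'\<in>conditions. stronger p' p \<and> evades q s p'"
proof -
  obtain D \<phi> \<psi> where p_eq: "p = (D, \<phi>, \<psi>)" by (metis prod_cases3)
  have D: "countable D" "D \<subseteq> unit_funs X" and H: "(\<phi>, \<psi>) \<in> H"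
    using p by (auto simp: p_eq conditions_def)
  have hom: "homeomorphic_maps X X \<phi> \<psi>"
    by (rule homeo[OF H])
  have \<phi>: "continuous_map X X \<phi>" using hom by (simp add: homeomorphic_maps_def)
  \<comment> \<open>The pullbacks make \<open>\<phi> \<circ> \<rho>\<close> agree with \<phi> on
    \<open>D\<close> at infinity; \<open>D\<close> itself is there for the inverses, where \<sigma>
    is applied after \<psi>.\<close>
  define D' where "D' = D \<union> pullback X \<phi> ` D"
  have "countable D'" "D' \<subseteq> unit_funs X"
    using D pullback_in_unit_funs[OF \<phi>] by (auto simp: D'_def)
  then obtain \<rho> \<sigma> where R: "(\<rho>, \<sigma>) \<in> H" and \<rho>: "\<And>h. h \<in> D' \<Longrightarrow> eq_at_infinity X (\<lambda>x. h (\<rho> x)) h"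
    and moves: "\<And>K. compactin X K \<Longrightarrow> \<exists>x\<in>topspace X - K. \<rho> x \<noteq> x"
    using small_moves[of D'] by blast
  have hom\<rho>: "homeomorphic_maps X X \<rho> \<sigma>"
    by (rule homeo[OF R])
  have \<rho>X: "\<rho> x \<in> topspace X" "\<sigma> x \<in> topspace X" "\<rho> (\<sigma> x) = x" if "x \<in> topspace X" for x
    using hom\<rho> that by (auto simp: homeomorphic_maps_def continuous_map_def)
  have \<phi>inj: "\<phi> x \<noteq> \<phi> y" if "x \<in> topspace X" "y \<in> topspace X" "x \<noteq> y" for x y
    using hom that unfolding homeomorphic_maps_def by metis
  obtain I where I: "infinite I" "\<And>K. compactin X K \<Longrightarrow> finite {i \<in> I. q i \<in> K}"
    "\<And>i. i \<in> I \<Longrightarrow> \<rho> (q i) \<noteq> q i"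
    using escaping_moved_points[OF q(2) _ moves] hom\<rho> unfolding homeomorphic_maps_def by blast
  have qX: "q i \<in> topspace X" for i using q(1) by blast
  \<comment> \<open>\<phi> is injective and \<rho> moves \<open>q i\<close>, so the two maps take
    different values at \<open>q i\<close> and \<open>s i\<close> equals at most one of them. Hence
    one of the maps differs from \<open>s\<close> at infinitely many of the escaping
    indices.\<close>
  have "\<phi> (q i) \<noteq> s i \<or> (\<phi> \<circ> \<rho>) (q i) \<noteq> s i" if "i \<in> I" for i
    using \<phi>inj[OF qX \<rho>X(1)[OF qX] I(3)[OF that, symmetric]] by auto
  then have "I \<subseteq> {i \<in> I. \<phi> (q i) \<noteq> s i} \<union> {i \<in> I. (\<phi> \<circ> \<rho>) (q i) \<noteq> s i}"
    by blast
  then have "infinite {i \<in> I. \<phi> (q i) \<noteq> s i} \<or> infinite {i \<in> I. (\<phi> \<circ> \<rho>) (q i) \<noteq> s i}"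
    using I(1) finite_subset by blast
  moreover have "stronger (D, \<phi> \<circ> \<rho>, \<sigma> \<circ> \<psi>) p"
  proof -
    have "eq_at_infinity X (\<lambda>x. h ((\<phi> \<circ> \<rho>) x)) (\<lambda>x. h (\<phi> x))" if "h \<in> D" for h
    proof -
      have "pullback X \<phi> h \<in> D'" using that by (simp add: D'_def)
      from \<rho>[OF this] show ?thesis by (simp add: \<rho>X cong: eq_at_infinity_cong)
    qed
    moreover have "eq_at_infinity X (\<lambda>x. h ((\<sigma> \<circ> \<psi>) x)) (\<lambda>x. h (\<psi> x))" if "h \<in> D" for h
    proof -
      have hom': "homeomorphic_maps X X (\<sigma> \<circ> \<psi>) (\<phi> \<circ> \<rho>)"
        using homeo[OF compose_mem[OF H R]] by (rule iffD1[OF homeomorphic_maps_sym])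
      have \<psi>X: "\<psi> x \<in> topspace X" if "x \<in> topspace X" for x
        using hom that by (auto simp: homeomorphic_maps_def continuous_map_def)
      have "h \<in> D'" using that by (simp add: D'_def)
      from eq_at_infinity_compose[OF hom' \<rho>[OF this]]
      have "eq_at_infinity X (\<lambda>x. h (\<psi> x)) (\<lambda>x. h ((\<sigma> \<circ> \<psi>) x))"
        by (simp add: \<rho>X \<psi>X cong: eq_at_infinity_cong)
      then show ?thesis by (rule eq_at_infinity_sym)
    qed
    ultimately show ?thesis by (auto simp: stronger_def p_eq)
  qed
  moreover have "stronger (D, \<phi>, \<psi>) p"
    using stronger_refl by (simp add: p_eq)
  ultimately obtain \<phi>' \<psi>' where H': "(\<phi>', \<psi>') \<in> H" and st: "stronger (D, \<phi>', \<psi>') p"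
    and inf: "infinite {i \<in> I. \<phi>' (q i) \<noteq> s i}"
    using H compose_mem[OF H R] by blast
  have hom': "homeomorphic_maps X X \<phi>' \<psi>'" by (rule homeo[OF H'])
  have \<phi>'X: "\<phi>' x \<in> topspace X" "\<psi>' (\<phi>' x) = x" if "x \<in> topspace X" for x
    using hom' that by (auto simp: homeomorphic_maps_def continuous_map_def)
  define J where "J = {i \<in> I. \<phi>' (q i) \<noteq> s i}"
  \<comment> \<open>The values of \<phi>' at the chosen points escape because \<phi>' is a
    homeomorphism; nothing of the kind is known of the candidate values \<open>s i\<close>.\<close>
  have "\<exists>h\<in>unit_funs X. \<exists>L\<subseteq>J. infinite L \<and> (\<forall>i\<in>L. h (\<phi>' (q i)) = 1 \<and> h (s i) = 0)"
  proof (rule unit_fun_separating_sequences)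
    fix K assume "compactin X K"
    then have "compactin X (\<psi>' ` K)"
      using hom' image_compactin unfolding homeomorphic_maps_def by blast
    moreover have "{i \<in> J. \<phi>' (q i) \<in> K} \<subseteq> {i \<in> I. q i \<in> \<psi>' ` K}"
    proof
      fix i assume "i \<in> {i \<in> J. \<phi>' (q i) \<in> K}"
      then show "i \<in> {i \<in> I. q i \<in> \<psi>' ` K}"
        using \<phi>'X(2)[OF qX, of i] imageI[of "\<phi>' (q i)" K \<psi>'] by (simp add: J_def)
    qed
    ultimately show "finite {i \<in> J. \<phi>' (q i) \<in> K}"
      using I(2) finite_subset by blast
  qed (use inf \<phi>'X qX s in \<open>auto simp: J_def\<close>)
  then obtain h L where h: "h \<in> unit_funs X" "L \<subseteq> J" "infinite L"
    "\<And>i. i \<in> L \<Longrightarrow> h (\<phi>' (q i)) = 1 \<and> h (s i) = 0"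
    by blast
  have fin: "finite {i \<in> L. q i \<in> K}" if "compactin X K" for K
    using I(2)[OF that] by (rule finite_subset[rotated]) (use h(2) in \<open>auto simp: J_def\<close>)
  have "evades q s (insert h D, \<phi>', \<psi>')"
    unfolding evades_def using h fin by (intro bexI[of _ h] exI[of _ L]) auto
  moreover have "(insert h D, \<phi>', \<psi>') \<in> conditions"
    using D h(1) H' by (simp add: conditions_def)
  moreover have "stronger (insert h D, \<phi>', \<psi>') p"
    using st by (auto simp: stronger_def p_eq)
  ultimately show ?thesis by blast
qed

theorem nontrivial_homeomorphism_exists:
  assumes CH: continuum_hypothesis and noncompact: "\<not> compact_space X"
  shows "\<exists>\<Phi>. homeomorphic_map (cs_remainder X) (cs_remainder X) \<Phi> \<and> \<not> trivial_remainder_homeo X \<Phi>"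
proof -
  have ne: "topspace X \<noteq> {}"
    using noncompact compactin_empty[of X] unfolding compact_space_def by metis
  obtain q :: "nat \<Rightarrow> 'a" where q: "range q \<subseteq> topspace X" "X closure_of (range q) = topspace X"
    by (rule dense_sequence[OF ne])
  obtain fn :: "nat set \<Rightarrow> 'a \<Rightarrow> real" where fn: "range fn = unit_funs X"
    by (rule unit_funs_surjection[OF ne])
  obtain sq :: "nat set \<Rightarrow> nat \<Rightarrow> 'a" where sq: "range sq = (UNIV \<rightarrow> topspace X)"
    by (rule sequences_surjection[OF ne])
  have sqX: "sq c i \<in> topspace X" for c i
    using sq rangeI[of sq c] by auto
  \<comment> \<open>One index \<open>c\<close> carries two tasks, admitting the function
    \<open>fn c\<close> and evading the sequence \<open>sq c\<close>; by surjectivity every function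
    and every sequence has its turn.\<close>
  have "\<exists>g. (\<forall>c. g c \<in> conditions \<and> (fn c \<in> fst (g c) \<and> evades q (sq c) (g c))) \<and>
          (\<forall>c d. stronger (g c) (g d) \<or> stronger (g d) (g c))"
  proof (rule generic_chain[OF CH])
    have "({}, id, id) \<in> conditions"
      using id_mem by (simp add: conditions_def)
    then show "conditions \<noteq> {}" by blast
    show "\<exists>p'\<in>conditions. stronger p' p \<and> (fn c \<in> fst p' \<and> evades q (sq c) p')"
      if p: "p \<in> conditions" for c p
    proof -
      obtain p' where p': "p' \<in> conditions" "stronger p' p" "evades q (sq c) p'"
        using evading_dense[OF q _ p, of "sq c"] sqX by blast
      define r where "r = (insert (fn c) (fst p'), snd p')"
      have "fn c \<in> unit_funs X" using fn by blast
      then have "r \<in> conditions"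
        using p'(1) by (auto simp: r_def conditions_def)
      moreover have "stronger r p'"
        by (auto simp: r_def stronger_def eq_at_infinity_refl split: prod.split)
      then have "stronger r p" using p'(2) by (rule stronger_trans)
      moreover have "evades q (sq c) r"
        using p'(3) by (auto simp: r_def evades_def)
      ultimately show ?thesis
        by (intro bexI[of _ r]) (auto simp: r_def)
    qed
    show "\<exists>p\<in>conditions. \<forall>n. stronger p (s n)"
      if "\<And>n. s n \<in> conditions" "\<And>m n. m \<le> n \<Longrightarrow> stronger (s n) (s m)" for s :: "nat \<Rightarrow> _"
      using that by (rule stronger_closed)
  qed (auto intro: stronger_refl stronger_trans)
  then obtain g where g: "\<And>c. g c \<in> conditions" "\<And>c. fn c \<in> fst (g c)"
    "\<And>c. evades q (sq c) (g c)" and chain: "\<And>c d. stronger (g c) (g d) \<or> stronger (g d) (g c)"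
    by blast
  define D where "D c = fst (g c)" for c
  define \<phi> where "\<phi> c = fst (snd (g c))" for c
  define \<psi> where "\<psi> c = snd (snd (g c))" for c
  have g_eq: "g c = (D c, \<phi> c, \<psi> c)" for c
    by (simp add: D_def \<phi>_def \<psi>_def)
  have D: "D c \<subseteq> unit_funs X" and H: "(\<phi> c, \<psi> c) \<in> H" for c
    using g(1)[of c] by (auto simp: g_eq conditions_def)
  have hom: "homeomorphic_maps X X (\<phi> c) (\<psi> c)" for c
    by (rule homeo[OF H])
  have "\<exists>\<Phi>. homeomorphic_map (cs_remainder X) (cs_remainder X) \<Phi> \<and>
          (\<forall>c. \<forall>h\<in>D c. \<forall>p\<in>topspace (cs_remainder X). \<Phi> p h = p (pullback X (\<phi> c) h))"
  proof (rule coherent_family_homeomorphism[OF hom D])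
    show "\<exists>c. h \<in> D c" if "h \<in> unit_funs X" for h
      using that g(2) unfolding fn[symmetric] D_def by blast
    show "D c \<subseteq> D d \<or> D d \<subseteq> D c" for c d
      using chain[of c d] by (auto simp: stronger_def g_eq)
    show "eq_at_infinity X (\<lambda>x. h (\<phi> c x)) (\<lambda>x. h (\<phi> d x))"
      "eq_at_infinity X (\<lambda>x. h (\<psi> c x)) (\<lambda>x. h (\<psi> d x))" if "h \<in> D c" "h \<in> D d" for c d h
      using chain[of c d] that
      by (auto simp: stronger_def g_eq) (rule eq_at_infinity_sym, simp)+
  qed
  then obtain \<Phi> where \<Phi>: "homeomorphic_map (cs_remainder X) (cs_remainder X) \<Phi>"
    "\<And>c h p. \<lbrakk>h \<in> D c; p \<in> topspace (cs_remainder X)\<rbrakk> \<Longrightarrow> \<Phi> p h = p (pullback X (\<phi> c) h)"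
    by blast
  have "\<not> trivial_remainder_homeo X \<Phi>"
  proof
    assume "trivial_remainder_homeo X \<Phi>"
    then obtain K L f F where KL: "compactin X K" "compactin X L"
      and f: "homeomorphic_map (subtopology X (topspace X - K)) (subtopology X (topspace X - L)) f"
      and F: "continuous_map (cs_minus X K) (cs_minus X L) F"
      and Ff: "\<And>x. x \<in> topspace X - K \<Longrightarrow> F (cs_embed X x) = cs_embed X (f x)"
      and \<Phi>F: "\<And>p. p \<in> topspace (cs_remainder X) \<Longrightarrow> \<Phi> p = F p"
      unfolding trivial_remainder_homeo_def by blast
    have fX: "f x \<in> topspace X" if "x \<in> topspace X - K" for x
      using homeomorphic_imp_continuous_map[OF f] that by (auto simp: continuous_map_def)
    have qX: "q i \<in> topspace X" for i using q(1) by blast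
    \<comment> \<open>The candidate is given only outside \<open>K\<close>. The default
      \<open>q i\<close> keeps the sequence in the space, and the comparison is made only at points
      outside \<open>K\<close>.\<close>
    have "(\<lambda>i. if q i \<in> K then q i else f (q i)) \<in> range sq"
      unfolding sq using qX fX by auto
    then obtain c where c: "(\<lambda>i. if q i \<in> K then q i else f (q i)) = sq c"
      by (rule rangeE)
    obtain h I where h: "h \<in> D c" and I: "infinite I" "\<And>K. compactin X K \<Longrightarrow> finite {i \<in> I. q i \<in> K}"
      "\<And>i. i \<in> I \<Longrightarrow> \<bar>h (\<phi> c (q i)) - h (sq c i)\<bar> = 1"
      using g(3)[of c] unfolding evades_def D_def \<phi>_def by blast
    have far: "\<bar>h (\<phi> c (q i)) - h (f (q i))\<bar> = 1" if "i \<in> I" "q i \<notin> K" for i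
      using I(3)[OF that(1)] that(2) by (simp flip: c)
    have "\<exists>p\<in>topspace (cs_remainder X). \<Phi> p \<noteq> F p"
    proof (rule escaping_values_separate_maps[where \<phi> = "\<phi> c" and f = f and a = q])
      show "\<Phi> p h = p (pullback X (\<phi> c) h)" if "p \<in> topspace (cs_remainder X)" for p
        using \<Phi>(2)[OF h that] .
      show "h \<in> unit_funs X"
        using D h by blast
      show "continuous_map X X (\<phi> c)"
        using hom[of c] by (simp add: homeomorphic_maps_def)
    qed (fact KL(1) F Ff I(1) | rule qX | erule I(2) | erule (1) far)+
    with \<Phi>F show False by blast
  qed
  with \<Phi>(1) show ?thesis by blast
qed

end

section \<open>Dimension zero\<close>

text \<open>A finite partial matching can always be extended in either direction: a point has
  infinitely many admissible partners, and only finitely many are taken.\<close>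

lemma back_and_forth_bijection:
  fixes R :: "'a \<Rightarrow> 'a \<Rightarrow> bool"
  assumes S: "countable S" "infinite S"
    and forth: "\<And>x. x \<in> S \<Longrightarrow> infinite {y \<in> S. R x y}"
    and backw: "\<And>y. y \<in> S \<Longrightarrow> infinite {x \<in> S. R x y}"
  shows "\<exists>f. bij_betw f S S \<and> (\<forall>x\<in>S. R x (f x))"
proof -
  define e where "e = from_nat_into S"
  have e: "range e = S"
    using S unfolding e_def by (intro range_from_nat_into) auto
  define P where "P M \<longleftrightarrow> finite M \<and> M \<subseteq> S \<times> S \<and> (\<forall>(x, y)\<in>M. R x y) \<and>
    (\<forall>(x, y)\<in>M. \<forall>(x', y')\<in>M. x = x' \<longleftrightarrow> y = y')" for M
  have addx: "\<exists>M'. P M' \<and> M \<subseteq> M' \<and> x \<in> Domain M'" if M: "P M" and x: "x \<in> S" for M x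
  proof (cases "x \<in> Domain M")
    case False
    have "finite (Range M)" using M by (simp add: P_def finite_Range)
    then obtain y where "y \<in> S" "R x y" "y \<notin> Range M"
      using forth[OF x] by (metis (no_types, lifting) finite_subset mem_Collect_eq subsetI)
    then have "P (insert (x, y) M)"
      using M x False unfolding P_def by (auto simp: Domain_iff Range_iff)
    then show ?thesis by blast
  qed (use M in blast)
  have addy: "\<exists>M'. P M' \<and> M \<subseteq> M' \<and> y \<in> Range M'" if M: "P M" and y: "y \<in> S" for M y
  proof (cases "y \<in> Range M")
    case False
    have "finite (Domain M)" using M by (simp add: P_def finite_Domain)
    then obtain x where "x \<in> S" "R x y" "x \<notin> Domain M"
      using backw[OF y] by (metis (no_types, lifting) finite_subset mem_Collect_eq subsetI)
    then have "P (insert (x, y) M)"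
      using M y False unfolding P_def by (auto simp: Domain_iff Range_iff)
    then show ?thesis by blast
  qed (use M in blast)
  have add: "\<exists>M'. (P M' \<and> e n \<in> Domain M' \<and> e n \<in> Range M') \<and> M \<subseteq> M'" if M: "P M" for M n
  proof -
    have "e n \<in> S" using e by blast
    obtain M1 where M1: "P M1" "M \<subseteq> M1" "e n \<in> Domain M1"
      using addx[OF M \<open>e n \<in> S\<close>] by blast
    obtain M2 where "P M2" "M1 \<subseteq> M2" "e n \<in> Range M2"
      using addy[OF M1(1) \<open>e n \<in> S\<close>] by blast
    with M1 show ?thesis by blast
  qed
  have "P {}" by (simp add: P_def)
  have "\<exists>M. \<forall>n. (P (M n) \<and> e n \<in> Domain (M n) \<and> e n \<in> Range (M n)) \<and> M n \<subseteq> M (Suc n)"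
  proof (rule dependent_nat_choice)
    show "\<exists>M. P M \<and> e 0 \<in> Domain M \<and> e 0 \<in> Range M"
      using add[OF \<open>P {}\<close>, of 0] by blast
    show "\<exists>M'. (P M' \<and> e (Suc n) \<in> Domain M' \<and> e (Suc n) \<in> Range M') \<and> M \<subseteq> M'"
      if "P M \<and> e n \<in> Domain M \<and> e n \<in> Range M" for M n
      using add that by blast
  qed
  then obtain M where M: "\<And>n. P (M n)" "\<And>n. e n \<in> Domain (M n)" "\<And>n. e n \<in> Range (M n)"
    "\<And>n. M n \<subseteq> M (Suc n)" by blast
  have mono: "M m \<subseteq> M n" if "m \<le> n" for m n
    using M(4) that by (rule lift_Suc_mono_le)
  define G where "G = (\<Union>n. M n)"
  have GS: "x \<in> S" "y \<in> S" "R x y" if "(x, y) \<in> G" for x y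
    using that M(1) unfolding G_def P_def by blast+
  have uniq: "x = x' \<longleftrightarrow> y = y'" if xy: "(x, y) \<in> G" "(x', y') \<in> G" for x y x' y'
  proof -
    obtain m n where "(x, y) \<in> M m" "(x', y') \<in> M n" using xy by (auto simp: G_def)
    then have "(x, y) \<in> M (max m n)" "(x', y') \<in> M (max m n)"
      using mono[of m "max m n"] mono[of n "max m n"] by auto
    then show ?thesis using M(1)[of "max m n"] unfolding P_def by blast
  qed
  have "\<exists>y. (x, y) \<in> G" if x: "x \<in> S" for x
  proof -
    obtain n where "x = e n" using x e by blast
    then show ?thesis using M(2)[of n] by (auto simp: G_def)
  qed
  then obtain f where f: "\<And>x. x \<in> S \<Longrightarrow> (x, f x) \<in> G" by metis
  have "y \<in> f ` S" if y: "y \<in> S" for y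
  proof -
    obtain n where "y = e n" using y e by blast
    then obtain x where x: "(x, y) \<in> G" using M(3)[of n] by (auto simp: G_def)
    then have "f x = y" using uniq[OF f[OF GS(1)[OF x]] x] by blast
    then show ?thesis using GS(1)[OF x] by blast
  qed
  moreover have "inj_on f S"
    using uniq f by (intro inj_onI) blast
  ultimately have "bij_betw f S S"
    using f GS(2) by (auto simp: bij_betw_def)
  then show ?thesis using f GS(3) by blast
qed

text \<open>Infinitely many bad points would contain infinitely many with nearly equal \<open>b\<close>-values, by
  pigeonhole on a grid; the images of these under a good \<open>\<pi>\<close> approximate any one of them.\<close>

lemma finite_many_without_approximants:
  fixes b d :: "nat \<Rightarrow> 'a \<Rightarrow> real"
  assumes bound: "\<And>j x. x \<in> S \<Longrightarrow> b j x \<in> {0..1}"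
    and approx: "\<And>k \<epsilon>. \<epsilon> > 0 \<Longrightarrow>
      \<exists>\<pi>. bij_betw \<pi> S S \<and> (\<forall>j<k. finite {x \<in> S. \<not> \<bar>d j (\<pi> x) - b j x\<bar> < \<epsilon>})"
  shows "finite {x \<in> S. finite {y \<in> S. \<forall>j<k. \<bar>d j y - b j x\<bar> < 1 / real (Suc k)}}"
proof (rule ccontr)
  define A where "A = {x \<in> S. finite {y \<in> S. \<forall>j<k. \<bar>d j y - b j x\<bar> < 1 / real (Suc k)}}"
  \<comment> \<open>A grid of mesh \<open>1 / N\<close> and an approximation within
    \<open>1 / N\<close> together cost \<open>1 / real (Suc k)\<close>.\<close>
  define N where "N = 2 * real (Suc k)"
  have N: "N > 0" "1 / N + 1 / N = 1 / real (Suc k)" by (simp_all add: N_def field_simps)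
  assume "infinite {x \<in> S. finite {y \<in> S. \<forall>j<k. \<bar>d j y - b j x\<bar> < 1 / real (Suc k)}}"
  then have "infinite A" by (simp add: A_def)
  define v where "v x = (\<lambda>j\<in>{..<k}. \<lfloor>N * b j x\<rfloor>)" for x
  have "v ` A \<subseteq> {..<k} \<rightarrow>\<^sub>E {0..\<lfloor>N\<rfloor>}"
  proof
    fix w assume "w \<in> v ` A"
    then obtain x where "x \<in> S" "w = v x" by (auto simp: A_def)
    moreover have "0 \<le> \<lfloor>N * b j x\<rfloor> \<and> \<lfloor>N * b j x\<rfloor> \<le> \<lfloor>N\<rfloor>" for j
      using bound[OF \<open>x \<in> S\<close>, of j] N(1) by (auto intro!: floor_mono mult_left_le)
    ultimately show "w \<in> {..<k} \<rightarrow>\<^sub>E {0..\<lfloor>N\<rfloor>}"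
      by (auto simp: v_def)
  qed
  moreover have "finite ({..<k} \<rightarrow>\<^sub>E {0..\<lfloor>N\<rfloor>})"
    by (intro finite_PiE) auto
  ultimately have "finite (v ` A)"
    by (rule finite_subset)
  then obtain a where a: "a \<in> A" "infinite {x \<in> A. v x = v a}"
    using pigeonhole_infinite[OF \<open>infinite A\<close>] by blast
  have close: "\<bar>b j x - b j a\<bar> < 1 / N" if "v x = v a" "j < k" for x j
  proof -
    have "\<lfloor>N * b j x\<rfloor> = \<lfloor>N * b j a\<rfloor>"
      using fun_cong[OF that(1), of j] that(2) by (simp add: v_def)
    then have "\<bar>N * b j x - N * b j a\<bar> < 1" by linarith
    then have "N * \<bar>b j x - b j a\<bar> < 1"
      using N(1) by (simp add: abs_mult flip: right_diff_distrib)
    then show ?thesis using N(1) by (simp add: field_simps)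
  qed
  obtain \<pi> where \<pi>: "bij_betw \<pi> S S" "\<And>j. j < k \<Longrightarrow> finite {x \<in> S. \<not> \<bar>d j (\<pi> x) - b j x\<bar> < 1 / N}"
    using approx[of "1 / N" k] N(1) by auto
  define B where "B = {x \<in> A. v x = v a} - (\<Union>j<k. {x \<in> S. \<not> \<bar>d j (\<pi> x) - b j x\<bar> < 1 / N})"
  have "infinite B"
    unfolding B_def using a(2) \<pi>(2) by (intro Diff_infinite_finite) auto
  moreover have "inj_on \<pi> B"
    using \<pi>(1) by (auto simp: bij_betw_def B_def A_def intro: inj_on_subset)
  ultimately have "infinite (\<pi> ` B)"
    by (simp add: finite_image_iff)
  moreover have "\<pi> ` B \<subseteq> {y \<in> S. \<forall>j<k. \<bar>d j y - b j a\<bar> < 1 / real (Suc k)}"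
  proof
    fix y assume "y \<in> \<pi> ` B"
    then obtain x where x: "x \<in> B" "y = \<pi> x" by blast
    then have "x \<in> S" "v x = v a" by (auto simp: B_def A_def)
    moreover have "\<bar>d j y - b j a\<bar> < 1 / real (Suc k)" if "j < k" for j
    proof -
      have "\<bar>d j y - b j x\<bar> < 1 / N"
        using x that \<open>x \<in> S\<close> by (auto simp: B_def)
      with close[OF \<open>v x = v a\<close> that] N(2) show ?thesis by linarith
    qed
    ultimately show "y \<in> {y \<in> S. \<forall>j<k. \<bar>d j y - b j a\<bar> < 1 / real (Suc k)}"
      using \<pi>(1) x by (auto simp: bij_betw_def)
  qed
  ultimately have "infinite {y \<in> S. \<forall>j<k. \<bar>d j y - b j a\<bar> < 1 / real (Suc k)}"
    using finite_subset by blast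
  with a(1) show False by (simp add: A_def)
qed

text \<open>\<open>l x\<close> is the largest level at which \<open>x\<close> is good among those
  not exceeding its index in an enumeration; the index bound makes the maximum exist. If
  \<open>l x < k\<close>, then the index of \<open>x\<close> is below \<open>k\<close> or
  \<open>x\<close> is one of the finitely many points failing level \<open>k\<close>.\<close>

lemma slow_level:
  fixes Q :: "nat \<Rightarrow> 'a \<Rightarrow> bool"
  assumes "countable S" and fin: "\<And>k. finite {x \<in> S. \<not> Q k x}"
    and Q0: "\<And>x. x \<in> S \<Longrightarrow> Q 0 x"
  shows "\<exists>l :: 'a \<Rightarrow> nat. (\<forall>x\<in>S. Q (l x) x) \<and> (\<forall>k. finite {x \<in> S. l x < k})"
proof -
  define l where "l x = Max {k. k \<le> to_nat_on S x \<and> Q k x}" for x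
  have fin_l: "finite {k. k \<le> to_nat_on S x \<and> Q k x}" for x
    by simp
  have "Q (l x) x" if "x \<in> S" for x
  proof -
    have "0 \<in> {k. k \<le> to_nat_on S x \<and> Q k x}"
      using Q0[OF that] by simp
    then have "l x \<in> {k. k \<le> to_nat_on S x \<and> Q k x}"
      unfolding l_def using Max_in[OF fin_l] by blast
    then show ?thesis by simp
  qed
  moreover have "finite {x \<in> S. l x < k}" for k
  proof (rule finite_subset)
    show "{x \<in> S. l x < k} \<subseteq> {x \<in> S. to_nat_on S x \<in> {..<k}} \<union> {x \<in> S. \<not> Q k x}"
      using Max_ge[OF fin_l] by (fastforce simp: l_def not_less)
    have "finite (to_nat_on S -` {..<k} \<inter> S)"
      by (intro finite_vimage_IntI inj_on_to_nat_on assms(1)) simp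
    then show "finite ({x \<in> S. to_nat_on S x \<in> {..<k}} \<union> {x \<in> S. \<not> Q k x})"
      using fin by (auto simp: vimage_def Int_def conj_commute)
  qed
  ultimately show ?thesis by blast
qed

text \<open>A matched pair may be justified from either end, with the accuracy of the level of
  \<open>x\<close> or of the level of \<open>y\<close>. The disjunction provides infinitely many
  partners on both sides, and since both levels tend to infinity the errors tend to 0.\<close>

lemma approximating_derangement:
  fixes b d :: "nat \<Rightarrow> 'a \<Rightarrow> real"
  assumes S: "countable S" "infinite S"
    and bound: "\<And>j x. x \<in> S \<Longrightarrow> b j x \<in> {0..1}" "\<And>j x. x \<in> S \<Longrightarrow> d j x \<in> {0..1}"
    and approx: "\<And>k \<epsilon>. \<epsilon> > 0 \<Longrightarrow>
      \<exists>\<pi>. bij_betw \<pi> S S \<and> (\<forall>j<k. finite {x \<in> S. \<not> \<bar>d j (\<pi> x) - b j x\<bar> < \<epsilon>})"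
  shows "\<exists>f. bij_betw f S S \<and> (\<forall>x\<in>S. f x \<noteq> x) \<and>
           (\<forall>j. \<forall>\<epsilon>>0. finite {x \<in> S. \<not> \<bar>d j (f x) - b j x\<bar> < \<epsilon>})"
proof -
  \<comment> \<open>Inverting the permutations exchanges \<open>b\<close> and \<open>d\<close>,
    which makes the hypotheses symmetric.\<close>
  have approx': "\<exists>\<pi>. bij_betw \<pi> S S \<and> (\<forall>j<k. finite {y \<in> S. \<not> \<bar>b j (\<pi> y) - d j y\<bar> < \<epsilon>})"
    if eps: "\<epsilon> > 0" for k \<epsilon>
  proof -
    obtain \<pi> where \<pi>: "bij_betw \<pi> S S" "\<And>j. j < k \<Longrightarrow> finite {x \<in> S. \<not> \<bar>d j (\<pi> x) - b j x\<bar> < \<epsilon>}"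
      using approx[OF eps, of k] by blast
    have inv: "bij_betw (inv_into S \<pi>) S S"
      using \<pi>(1) by (rule bij_betw_inv_into)
    have "finite {y \<in> S. \<not> \<bar>b j (inv_into S \<pi> y) - d j y\<bar> < \<epsilon>}" if "j < k" for j
    proof (rule finite_subset)
      show "{y \<in> S. \<not> \<bar>b j (inv_into S \<pi> y) - d j y\<bar> < \<epsilon>} \<subseteq> \<pi> ` {x \<in> S. \<not> \<bar>d j (\<pi> x) - b j x\<bar> < \<epsilon>}"
      proof
        fix y assume y: "y \<in> {y \<in> S. \<not> \<bar>b j (inv_into S \<pi> y) - d j y\<bar> < \<epsilon>}"
        then have "\<pi> (inv_into S \<pi> y) = y" "inv_into S \<pi> y \<in> S"
          using bij_betw_inv_into_right[OF \<pi>(1)] bij_betwE[OF inv] by auto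
        with y show "y \<in> \<pi> ` {x \<in> S. \<not> \<bar>d j (\<pi> x) - b j x\<bar> < \<epsilon>}"
          by (intro image_eqI[of _ _ "inv_into S \<pi> y"]) (auto simp: abs_minus_commute)
      qed
    qed (use \<pi>(2)[OF that] in simp)
    with inv show ?thesis by blast
  qed
  define T where "T k x = {y \<in> S. \<forall>j<k. \<bar>d j y - b j x\<bar> < 1 / real (Suc k)}" for k x
  define T' where "T' k y = {x \<in> S. \<forall>j<k. \<bar>b j x - d j y\<bar> < 1 / real (Suc k)}" for k y
  have "\<exists>l :: 'a \<Rightarrow> nat. (\<forall>x\<in>S. infinite (T (l x) x)) \<and> (\<forall>k. finite {x \<in> S. l x < k})"
  proof (rule slow_level[OF S(1)])
    show "finite {x \<in> S. \<not> infinite (T k x)}" for k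
      unfolding not_not T_def by (rule finite_many_without_approximants[OF bound(1) approx])
  qed (use S(2) in \<open>simp add: T_def\<close>)
  then obtain l where l: "\<And>x. x \<in> S \<Longrightarrow> infinite (T (l x) x)" "\<And>k. finite {x \<in> S. l x < k}"
    by blast
  have "\<exists>l :: 'a \<Rightarrow> nat. (\<forall>x\<in>S. infinite (T' (l x) x)) \<and> (\<forall>k. finite {x \<in> S. l x < k})"
  proof (rule slow_level[OF S(1)])
    show "finite {x \<in> S. \<not> infinite (T' k x)}" for k
      unfolding not_not T'_def by (rule finite_many_without_approximants[OF bound(2) approx'])
  qed (use S(2) in \<open>simp add: T'_def\<close>)
  then obtain l' where l': "\<And>x. x \<in> S \<Longrightarrow> infinite (T' (l' x) x)" "\<And>k. finite {x \<in> S. l' x < k}"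
    by blast
  \<comment> \<open>Excluding \<open>y = x\<close> costs one of infinitely many partners and yields
    a permutation without fixed points, as small moves require.\<close>
  define R where "R x y \<longleftrightarrow> y \<noteq> x \<and> (y \<in> T (l x) x \<or> x \<in> T' (l' y) y)" for x y
  have "\<exists>f. bij_betw f S S \<and> (\<forall>x\<in>S. R x (f x))"
  proof (rule back_and_forth_bijection[OF S])
    fix x assume x: "x \<in> S"
    have "infinite (T (l x) x - {x})" using l(1)[OF x] by simp
    moreover have "T (l x) x - {x} \<subseteq> {y \<in> S. R x y}" by (auto simp: R_def T_def)
    ultimately show "infinite {y \<in> S. R x y}" using finite_subset by blast
    have "infinite (T' (l' x) x - {x})" using l'(1)[OF x] by simp
    moreover have "T' (l' x) x - {x} \<subseteq> {y \<in> S. R y x}" by (auto simp: R_def T'_def)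
    ultimately show "infinite {y \<in> S. R y x}" using finite_subset by blast
  qed
  then obtain f where f: "bij_betw f S S" "\<And>x. x \<in> S \<Longrightarrow> R x (f x)" by blast
  have "finite {x \<in> S. \<not> \<bar>d j (f x) - b j x\<bar> < \<epsilon>}" if eps: "\<epsilon> > 0" for j \<epsilon>
  proof -
    obtain k0 :: nat where k0: "1 / real (Suc k0) < \<epsilon>"
      using nat_approx_posE[OF eps] by auto
    \<comment> \<open>From level \<open>k\<close> on, the function with index \<open>j\<close> is
      among those controlled, and the accuracy is better than \<epsilon>.\<close>
    define k where "k = max (Suc j) k0"
    have small: "1 / real (Suc i) < \<epsilon>" "j < i" if "k \<le> i" for i
    proof -
      have "1 / real (Suc i) \<le> 1 / real (Suc k0)"
        using that by (intro divide_left_mono) (auto simp: k_def)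
      with k0 show "1 / real (Suc i) < \<epsilon>" by linarith
    qed (use that in \<open>auto simp: k_def\<close>)
    have "{x \<in> S. \<not> \<bar>d j (f x) - b j x\<bar> < \<epsilon>} \<subseteq> {x \<in> S. l x < k} \<union> (f -` {y \<in> S. l' y < k} \<inter> S)"
    proof
      fix x assume "x \<in> {x \<in> S. \<not> \<bar>d j (f x) - b j x\<bar> < \<epsilon>}"
      then have x: "x \<in> S" "\<not> \<bar>d j (f x) - b j x\<bar> < \<epsilon>" by auto
      have "f x \<in> S" using f(1) x(1) by (auto simp: bij_betw_def)
      have "l x < k" if "f x \<in> T (l x) x"
      proof (rule ccontr)
        assume "\<not> l x < k"
        then have "1 / real (Suc (l x)) < \<epsilon>" "j < l x" using small[of "l x"] by auto
        moreover have "\<bar>d j (f x) - b j x\<bar> < 1 / real (Suc (l x))"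
          using that \<open>j < l x\<close> by (simp add: T_def)
        ultimately show False using x(2) by linarith
      qed
      moreover have "l' (f x) < k" if "x \<in> T' (l' (f x)) (f x)"
      proof (rule ccontr)
        assume "\<not> l' (f x) < k"
        then have "1 / real (Suc (l' (f x))) < \<epsilon>" "j < l' (f x)" using small[of "l' (f x)"] by auto
        moreover have "\<bar>b j x - d j (f x)\<bar> < 1 / real (Suc (l' (f x)))"
          using that \<open>j < l' (f x)\<close> by (simp add: T'_def)
        ultimately show False using x(2) by linarith
      qed
      ultimately show "x \<in> {x \<in> S. l x < k} \<union> (f -` {y \<in> S. l' y < k} \<inter> S)"
        using f(2)[OF x(1)] x(1) \<open>f x \<in> S\<close> by (auto simp: R_def)
    qed
    moreover have "finite (f -` {y \<in> S. l' y < k} \<inter> S)"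
      using l'(2) f(1) by (intro finite_vimage_IntI) (auto simp: bij_betw_def)
    ultimately show ?thesis
      using l(2) by (meson finite_Un finite_subset)
  qed
  with f show ?thesis
    by (intro exI[of _ f]) (auto simp: R_def)
qed

section \<open>The symmetric group of a countable discrete space\<close>

lemma compactin_discrete_topology_iff: "compactin (discrete_topology S) K \<longleftrightarrow> K \<subseteq> S \<and> finite K"
  by (auto simp: compactin_discrete_topology)

lemma eq_at_infinity_discrete:
  "eq_at_infinity (discrete_topology S) u v \<longleftrightarrow> (\<forall>\<epsilon>>0. finite {x \<in> S. \<not> \<bar>u x - v x\<bar> < \<epsilon>})"
  (is "?lhs \<longleftrightarrow> ?rhs")
proof
  assume L: ?lhs
  show ?rhs
  proof (intro allI impI)
    fix \<epsilon> :: real assume "\<epsilon> > 0"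
    then obtain K where "finite K" "\<forall>x\<in>S - K. \<bar>u x - v x\<bar> < \<epsilon>"
      using L unfolding eq_at_infinity_def by (auto simp: compactin_discrete_topology_iff)
    then show "finite {x \<in> S. \<not> \<bar>u x - v x\<bar> < \<epsilon>}"
      by (intro finite_subset[OF _ \<open>finite K\<close>]) auto
  qed
next
  assume ?rhs
  then show ?lhs
    unfolding eq_at_infinity_def compactin_discrete_topology_iff
    by (intro allI impI exI[of _ "{x \<in> S. \<not> \<bar>u x - v x\<bar> < _}"]) auto
qed

lemma homeomorphic_maps_discrete_inv_into:
  assumes "bij_betw f S S"
  shows "homeomorphic_maps (discrete_topology S) (discrete_topology S) f (inv_into S f)"
  unfolding homeomorphic_maps_def
  using assms bij_betw_inv_into[OF assms] bij_betw_inv_into_left[OF assms] bij_betw_inv_into_right[OF assms]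
  by (auto simp: bij_betw_def)

lemma homeomorphic_maps_discrete_bij_betw:
  assumes "homeomorphic_maps (discrete_topology S) (discrete_topology S) f g"
  shows "bij_betw f S S"
  using assms unfolding homeomorphic_maps_def by (intro bij_betw_byWitness[of _ g]) auto

lemma saturated_homeo_group_discrete:
  assumes S: "countable S" "infinite S"
  shows "saturated_homeo_group (discrete_topology S)
           {(\<phi>, \<psi>). homeomorphic_maps (discrete_topology S) (discrete_topology S) \<phi> \<psi>}"
    (is "saturated_homeo_group ?X ?H")
proof
  \<comment> \<open>This serves both axioms: \<open>saturated\<close> forgets that \<phi> has no
    fixed points, and \<open>small_moves\<close> is the system of the pairs \<open>(h, h)\<close>,
    which the identity solves.\<close>
  have derange: "\<exists>(\<phi>, \<psi>)\<in>?H. (\<forall>(b, d)\<in>P. eq_at_infinity ?X (\<lambda>x. d (\<phi> x)) b) \<and> (\<forall>x\<in>S. \<phi> x \<noteq> x)"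
    if P: "countable P" "P \<subseteq> unit_funs ?X \<times> unit_funs ?X"
      and fin: "\<And>F. \<lbrakk>finite F; F \<subseteq> P\<rbrakk> \<Longrightarrow> \<exists>(\<phi>, \<psi>)\<in>?H. \<forall>(b, d)\<in>F. eq_at_infinity ?X (\<lambda>x. d (\<phi> x)) b"
    for P
  proof -
    \<comment> \<open>The pair of zero functions makes the system nonempty, so that the naturals
      enumerate it; every permutation solves this extra equation.\<close>
    define z where "z = (\<lambda>x\<in>S. 0::real)"
    have z: "z \<in> unit_funs ?X"
      using restrict_in_unit_funs[of ?X "\<lambda>_. 0"] by (simp add: z_def)
    define Q where "Q = insert (z, z) P"
    have Q: "countable Q" "Q \<noteq> {}" "Q \<subseteq> unit_funs ?X \<times> unit_funs ?X"
      using P z by (auto simp: Q_def)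
    define p where "p = from_nat_into Q"
    have p: "range p = Q"
      unfolding p_def using Q by (intro range_from_nat_into)
    define b where "b j = fst (p j)" for j
    define d where "d j = snd (p j)" for j
    have pbd: "p j = (b j, d j)" for j by (simp add: b_def d_def)
    have bdU: "b j \<in> unit_funs ?X" "d j \<in> unit_funs ?X" for j
      using Q(3) rangeI[of p j] unfolding p pbd by auto
    have "\<exists>f. bij_betw f S S \<and> (\<forall>x\<in>S. f x \<noteq> x) \<and>
           (\<forall>j. \<forall>\<epsilon>>0. finite {x \<in> S. \<not> \<bar>d j (f x) - b j x\<bar> < \<epsilon>})"
    proof (rule approximating_derangement[OF S])
      show "b j x \<in> {0..1}" "d j x \<in> {0..1}" if "x \<in> S" for j x
        using unit_funs_bounds[OF bdU(1), of x j] unit_funs_bounds[OF bdU(2), of x j] that by auto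
      fix k :: nat and \<epsilon> :: real assume "\<epsilon> > 0"
      have "\<exists>(\<phi>, \<psi>)\<in>?H. \<forall>(b, d)\<in>p ` {..<k} - {(z, z)}. eq_at_infinity ?X (\<lambda>x. d (\<phi> x)) b"
        by (rule fin) (use p in \<open>auto simp: Q_def\<close>)
      then obtain \<phi> \<psi> where hom: "homeomorphic_maps ?X ?X \<phi> \<psi>"
        and eq: "\<forall>(b, d)\<in>p ` {..<k} - {(z, z)}. eq_at_infinity ?X (\<lambda>x. d (\<phi> x)) b"
        by blast
      have bij: "bij_betw \<phi> S S"
        using hom by (rule homeomorphic_maps_discrete_bij_betw)
      have "finite {x \<in> S. \<not> \<bar>d j (\<phi> x) - b j x\<bar> < \<epsilon>}" if "j < k" for j
      proof (cases "p j = (z, z)")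
        case True
        then have "d j (\<phi> x) = 0" "b j x = 0" if "x \<in> S" for x
          using that bij_betwE[OF bij] by (auto simp: pbd z_def)
        then have "{x \<in> S. \<not> \<bar>d j (\<phi> x) - b j x\<bar> < \<epsilon>} = {}"
          using \<open>\<epsilon> > 0\<close> by auto
        then show ?thesis by (metis finite.emptyI)
      next
        case False
        then have "(b j, d j) \<in> p ` {..<k} - {(z, z)}"
          using that pbd[of j] by (metis Diff_iff imageI lessThan_iff singletonD)
        with eq have "eq_at_infinity ?X (\<lambda>x. d j (\<phi> x)) (b j)"
          by blast
        then show ?thesis
          using \<open>\<epsilon> > 0\<close> by (simp add: eq_at_infinity_discrete)
      qed
      with bij show "\<exists>\<pi>. bij_betw \<pi> S S \<and> (\<forall>j<k. finite {x \<in> S. \<not> \<bar>d j (\<pi> x) - b j x\<bar> < \<epsilon>})"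
        by blast
    qed
    then obtain f where f: "bij_betw f S S" "\<And>x. x \<in> S \<Longrightarrow> f x \<noteq> x"
      "\<And>j \<epsilon>. \<epsilon> > 0 \<Longrightarrow> finite {x \<in> S. \<not> \<bar>d j (f x) - b j x\<bar> < \<epsilon>}" by blast
    have "eq_at_infinity ?X (\<lambda>x. d' (f x)) b'" if "(b', d') \<in> P" for b' d'
    proof -
      have "(b', d') \<in> range p" using that by (simp add: p Q_def)
      then obtain j where "b' = b j" "d' = d j" by (auto simp: pbd)
      then show ?thesis using f(3) by (simp add: eq_at_infinity_discrete)
    qed
    then show ?thesis
      using homeomorphic_maps_discrete_inv_into[OF f(1)] f(2)
      by (intro bexI[of _ "(f, inv_into S f)"]) auto
  qed
  show "Hausdorff_space ?X" "locally_compact_space ?X"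
    by (simp_all add: locally_compact_space_discrete_topology)
  show "second_countable ?X"
    using S by (simp add: second_countable_discrete_topology)
  show "homeomorphic_maps ?X ?X \<phi> \<psi>" if "(\<phi>, \<psi>) \<in> ?H" for \<phi> \<psi>
    using that by simp
  show "(id, id) \<in> ?H"
    by (simp add: homeomorphic_maps_id)
  show "(\<phi> \<circ> \<rho>, \<sigma> \<circ> \<psi>) \<in> ?H" if "(\<phi>, \<psi>) \<in> ?H" "(\<rho>, \<sigma>) \<in> ?H" for \<phi> \<psi> \<rho> \<sigma>
    using that homeomorphic_maps_compose[of ?X ?X \<rho> \<sigma> ?X \<phi> \<psi>] by simp
  show "\<exists>(\<phi>, \<psi>)\<in>?H. \<forall>(b, d)\<in>P. eq_at_infinity ?X (\<lambda>x. d (\<phi> x)) b"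
    if "countable P" "P \<subseteq> unit_funs ?X \<times> unit_funs ?X"
      "\<And>F. \<lbrakk>finite F; F \<subseteq> P\<rbrakk> \<Longrightarrow> \<exists>(\<phi>, \<psi>)\<in>?H. \<forall>(b, d)\<in>F. eq_at_infinity ?X (\<lambda>x. d (\<phi> x)) b"
    for P
    using derange[OF that] by blast
  show "\<exists>(\<rho>, \<sigma>)\<in>?H. (\<forall>h\<in>D. eq_at_infinity ?X (\<lambda>x. h (\<rho> x)) h) \<and>
          (\<forall>K. compactin ?X K \<longrightarrow> (\<exists>x\<in>topspace ?X - K. \<rho> x \<noteq> x))"
    if D: "countable D" "D \<subseteq> unit_funs ?X" for D
  proof -
    have "\<exists>(\<phi>, \<psi>)\<in>?H. (\<forall>(b, d)\<in>(\<lambda>h. (h, h)) ` D. eq_at_infinity ?X (\<lambda>x. d (\<phi> x)) b) \<and> (\<forall>x\<in>S. \<phi> x \<noteq> x)"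
    proof (rule derange)
      fix F assume "F \<subseteq> (\<lambda>h. (h, h)) ` D"
      then show "\<exists>(\<phi>, \<psi>)\<in>?H. \<forall>(b, d)\<in>F. eq_at_infinity ?X (\<lambda>x. d (\<phi> x)) b"
        by (intro bexI[of _ "(id, id)"]) (auto simp: homeomorphic_maps_id intro!: eq_at_infinity_refl)
    qed (use D in auto)
    then obtain \<phi> \<psi> where "(\<phi>, \<psi>) \<in> ?H" "\<forall>h\<in>D. eq_at_infinity ?X (\<lambda>x. h (\<phi> x)) h" "\<forall>x\<in>S. \<phi> x \<noteq> x"
      by auto
    moreover have "\<exists>x\<in>S - K. \<phi> x \<noteq> x" if "compactin ?X K" for K
    proof -
      have "S - K \<noteq> {}"
        using that S(2) by (metis Diff_eq_empty_iff compactin_discrete_topology_iff finite_subset)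
      with \<open>\<forall>x\<in>S. \<phi> x \<noteq> x\<close> show ?thesis by blast
    qed
    ultimately show ?thesis
      by (intro bexI[of _ "(\<phi>, \<psi>)"]) auto
  qed
qed

text \<open>\<open>Euclidean_space 0\<close> is a single point, so the domain of a chart around
  \<open>x\<close> is \<open>{x}\<close>.\<close>

lemma manifold_dim_0_discrete:
  assumes "topological_manifold 0 X"
  shows "X = discrete_topology (topspace X)"
proof -
  have "openin X {x}" if x: "x \<in> topspace X" for x
  proof -
    obtain U V where UV: "openin X U" "x \<in> U"
      "subtopology X U homeomorphic_space subtopology (Euclidean_space 0) V"
      using assms x unfolding topological_manifold_def by blast
    then obtain f where f: "homeomorphic_map (subtopology X U) (subtopology (Euclidean_space 0) V) f"
      by (auto simp: homeomorphic_space)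
    have U: "topspace (subtopology X U) = U"
      using openin_subset[OF UV(1)] by auto
    have "y = x" if "y \<in> U" for y
    proof -
      have "f y \<in> topspace (Euclidean_space 0)" "f x \<in> topspace (Euclidean_space 0)"
        using homeomorphic_imp_surjective_map[OF f] that UV(2) U by auto
      then have "f y = f x" by (auto simp: topspace_Euclidean_space)
      then show ?thesis
        using homeomorphic_imp_injective_map[OF f] that UV(2) U by (auto simp: inj_on_def)
    qed
    then have "U = {x}" using UV(2) by blast
    with UV(1) show ?thesis by simp
  qed
  then show ?thesis
    using discrete_topology_unique[of "topspace X" X] by simp
qed

section \<open>Small homeomorphisms of manifolds\<close>

text \<open>The maps \<open>t \<mapsto> s t * t\<close> and \<open>t \<mapsto> s' t * t\<close> are mutually inverse piecewise linear
  homeomorphisms of \<open>[0, \<infinity>)\<close>, with slopes 1/2, 2, 1 for the first. The inner \<open>max\<close> only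
  removes the singularity of the quotient at 0.\<close>

lemma radial_rescaling:
  fixes \<delta> :: real
  assumes "\<delta> > 0"
  defines "s \<equiv> \<lambda>t. min 1 (max (1/2) (2 - \<delta> / max t (\<delta>/2)))"
    and "s' \<equiv> \<lambda>u. max 1 (min 2 ((1 + \<delta> / max u (\<delta>/3)) / 2))"
  shows "continuous_on UNIV s" "continuous_on UNIV s'"
    and "\<And>t. t \<ge> \<delta> \<Longrightarrow> s t = 1 \<and> s' t = 1" "s (\<delta>/4) = 1/2"
    and "\<And>t. 0 < s t \<and> 0 < s' t"
    and "\<And>t. t \<ge> 0 \<Longrightarrow> s' (s t * t) * s t = 1" "\<And>t. t \<ge> 0 \<Longrightarrow> s (s' t * t) * s' t = 1"
proof -
  have ne: "max t (\<delta>/2) \<noteq> 0" "max t (\<delta>/3) \<noteq> 0" for t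
    using assms(1) by (auto simp: max_def)
  show "continuous_on UNIV s" "continuous_on UNIV s'"
    unfolding s_def s'_def by (intro continuous_intros; simp add: ne)+
  \<comment> \<open>The breakpoint is where \<open>2 - \<delta>/t\<close> reaches 1/2; the first map
    sends it to \<delta>/3, the breakpoint of the second.\<close>
  have s1: "s t = 1/2" if "t \<le> 2*\<delta>/3" for t
  proof -
    have "max t (\<delta>/2) > 0" "max t (\<delta>/2) \<le> 2*\<delta>/3" using assms(1) that by auto
    then have "\<delta> / max t (\<delta>/2) \<ge> 3/2" by (simp add: field_simps)
    then show ?thesis by (simp add: s_def)
  qed
  have s2: "s t = 2 - \<delta>/t" if "2*\<delta>/3 \<le> t" "t \<le> \<delta>" for t
  proof -
    have "max t (\<delta>/2) = t" "t > 0" using assms(1) that by auto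
    then have "\<delta>/t \<ge> 1" "\<delta>/t \<le> 3/2" using that by (auto simp: field_simps)
    with \<open>max t (\<delta>/2) = t\<close> show ?thesis by (simp add: s_def)
  qed
  have s3: "s t = 1" if "\<delta> \<le> t" for t
  proof -
    have "max t (\<delta>/2) = t" "t > 0" using assms(1) that by auto
    then have "\<delta>/t \<le> 1" using that by (auto simp: field_simps)
    with \<open>max t (\<delta>/2) = t\<close> show ?thesis by (simp add: s_def)
  qed
  have s'1: "s' t = 2" if "t \<le> \<delta>/3" for t
  proof -
    have "max t (\<delta>/3) = \<delta>/3" using that by auto
    then show ?thesis using assms(1) by (simp add: s'_def)
  qed
  have s'2: "s' t = (1 + \<delta>/t) / 2" if "\<delta>/3 \<le> t" "t \<le> \<delta>" for t
  proof -
    have "max t (\<delta>/3) = t" "t > 0" using assms(1) that by auto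
    then have "\<delta>/t \<ge> 1" "\<delta>/t \<le> 3" using that by (auto simp: field_simps)
    with \<open>max t (\<delta>/3) = t\<close> show ?thesis by (simp add: s'_def)
  qed
  have s'3: "s' t = 1" if "\<delta> \<le> t" for t
  proof -
    have "max t (\<delta>/3) = t" "t > 0" using assms(1) that by auto
    then have "\<delta>/t \<le> 1" using that by (auto simp: field_simps)
    with \<open>max t (\<delta>/3) = t\<close> show ?thesis by (simp add: s'_def)
  qed
  show "s t = 1 \<and> s' t = 1" if "t \<ge> \<delta>" for t
    using s3 s'3 that by blast
  show "s (\<delta>/4) = 1/2"
    using assms(1) by (intro s1) simp
  show "0 < s t \<and> 0 < s' t" for t
    by (simp add: s_def s'_def less_max_iff_disj)
  show "s' (s t * t) * s t = 1" if "t \<ge> 0" for t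
  proof -
    consider "t \<le> 2*\<delta>/3" | "2*\<delta>/3 \<le> t" "t \<le> \<delta>" | "\<delta> \<le> t" by linarith
    then show ?thesis
    proof cases
      case 1
      have st: "s t = 1/2" using s1 1 by blast
      have s't: "s' (1/2 * t) = 2" using 1 by (intro s'1) simp
      show ?thesis unfolding st s't by simp
    next
      case 2
      have "t > 0" using 2 assms(1) by linarith
      then have st: "s t * t = 2*t - \<delta>" using s2[OF 2] by (simp add: field_simps)
      have pos: "2*t - \<delta> > 0" using 2 assms(1) by linarith
      have "s' (2*t - \<delta>) = (1 + \<delta>/(2*t - \<delta>)) / 2"
        using 2 by (intro s'2) linarith+
      then have "s' (s t * t) = t / (2*t - \<delta>)" "2*t - \<delta> \<noteq> 0"
        unfolding st using pos by (simp_all add: field_simps)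
      moreover have "s t = (2*t - \<delta>) / t" using s2[OF 2] \<open>t > 0\<close> by (simp add: field_simps)
      ultimately show ?thesis using \<open>t > 0\<close> by simp
    next
      case 3
      then show ?thesis using s3 s'3 by simp
    qed
  qed
  show "s (s' t * t) * s' t = 1" if "t \<ge> 0" for t
  proof -
    consider "t \<le> \<delta>/3" | "\<delta>/3 \<le> t" "t \<le> \<delta>" | "\<delta> \<le> t" by linarith
    then show ?thesis
    proof cases
      case 1
      have s't: "s' t = 2" using s'1 1 by blast
      have st: "s (2 * t) = 1/2" using 1 by (intro s1) simp
      show ?thesis unfolding s't st by simp
    next
      case 2
      have "t > 0" using 2 assms(1) by linarith
      then have s't: "s' t * t = (t + \<delta>)/2" using s'2[OF 2] by (simp add: field_simps)
      have "s ((t + \<delta>)/2) = 2 - \<delta>/((t + \<delta>)/2)"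
        using 2 by (intro s2) (simp_all add: field_simps)
      then have "s (s' t * t) = 2*t / (t + \<delta>)" "t + \<delta> \<noteq> 0"
        unfolding s't using \<open>t > 0\<close> assms(1) by (simp_all add: field_simps)
      moreover have "s' t = (t + \<delta>) / (2*t)" using s'2[OF 2] \<open>t > 0\<close> by (simp add: field_simps)
      ultimately show ?thesis using \<open>t > 0\<close> by simp
    next
      case 3
      then show ?thesis using s3 s'3 by simp
    qed
  qed
qed

section \<open>Local moves in Euclidean space\<close>

text \<open>The space is a subspace of an infinite product of lines whose coordinates from
  \<open>n\<close> on vanish, so a box in the first \<open>n\<close> coordinates suffices. The sum
  of absolute differences dominates each of them and is positively homogeneous about
  \<open>c\<close>, which the radial maps rely on.\<close>

lemma openin_Euclidean_space_contains_l1_ball: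
  assumes "openin (Euclidean_space n) W" "c \<in> W"
  obtains \<delta> where "\<delta> > 0"
    "\<And>x. \<lbrakk>x \<in> topspace (Euclidean_space n); (\<Sum>i<n. \<bar>x i - c i\<bar>) < \<delta>\<rbrakk> \<Longrightarrow> x \<in> W"
proof -
  obtain T where T: "openin (powertop_real UNIV) T" "W = T \<inter> {x. \<forall>i\<ge>n. x i = 0}"
    using assms(1) unfolding Euclidean_space_def openin_subtopology by blast
  have "c \<in> T" using assms(2) T(2) by blast
  obtain U where "\<forall>i\<in>UNIV. openin euclideanreal (U i)" and Uc: "c \<in> Pi\<^sub>E UNIV U" "Pi\<^sub>E UNIV U \<subseteq> T"
    using bspec[OF T(1)[unfolded openin_product_topology_alt] \<open>c \<in> T\<close>]
    by (elim exE conjE) (rule that)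
  then have U: "\<And>i. open (U i)" "c \<in> Pi\<^sub>E UNIV U" "Pi\<^sub>E UNIV U \<subseteq> T"
    by simp_all
  have "\<exists>e>0. ball (c i) e \<subseteq> U i" for i
    using U(1,2) open_contains_ball by (metis PiE_mem UNIV_I)
  then obtain e where e: "\<And>i. e i > 0" "\<And>i. ball (c i) (e i) \<subseteq> U i"
    by metis
  \<comment> \<open>The 1 keeps the minimum defined for \<open>n = 0\<close>.\<close>
  define \<delta> where "\<delta> = Min (insert 1 (e ` {..<n}))"
  have \<delta>: "\<delta> > 0" "\<And>i. i < n \<Longrightarrow> \<delta> \<le> e i"
    using e(1) by (auto simp: \<delta>_def)
  have "x \<in> W" if x: "x \<in> topspace (Euclidean_space n)" "(\<Sum>i<n. \<bar>x i - c i\<bar>) < \<delta>" for x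
  proof -
    have "x i \<in> U i" for i
    proof (cases "i < n")
      case True
      then have "\<bar>x i - c i\<bar> \<le> (\<Sum>i<n. \<bar>x i - c i\<bar>)"
        by (intro member_le_sum) auto
      with x(2) \<delta>(2)[OF True] have "x i \<in> ball (c i) (e i)"
        by (simp add: dist_real_def abs_minus_commute)
      then show ?thesis using e(2) by blast
    next
      case False
      then have "x i = c i"
        using x(1) assms(2) T(2) by (auto simp: topspace_Euclidean_space)
      then show ?thesis using U(2) by auto
    qed
    then show ?thesis
      using U(3) x(1) T(2) by (auto simp: topspace_Euclidean_space)
  qed
  with \<delta>(1) that show ?thesis by blast
qed

text \<open>Points are rescaled about a centre \<open>c\<close> by a factor depending only on their
  distance \<open>N x\<close>. By homogeneity of \<open>N\<close>, two such maps are mutually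
  inverse as soon as the radial functions are.\<close>

lemma Euclidean_space_local_move:
  assumes "n > 0" and W: "openin (Euclidean_space n) W" "W \<noteq> {}"
  shows "\<exists>\<rho> \<sigma>. homeomorphic_maps (Euclidean_space n) (Euclidean_space n) \<rho> \<sigma> \<and>
           (\<forall>x\<in>topspace (Euclidean_space n) - W. \<rho> x = x \<and> \<sigma> x = x) \<and> (\<exists>x\<in>W. \<rho> x \<noteq> x)"
proof -
  obtain c where c: "c \<in> W" using W by blast
  obtain \<delta> where \<delta>: "\<delta> > 0"
    "\<And>x. \<lbrakk>x \<in> topspace (Euclidean_space n); (\<Sum>i<n. \<bar>x i - c i\<bar>) < \<delta>\<rbrakk> \<Longrightarrow> x \<in> W"
    by (rule openin_Euclidean_space_contains_l1_ball[OF W(1) c]) (rule that)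
  have c0: "c i = 0" if "i \<ge> n" for i
    using openin_subset[OF W(1)] c that by (auto simp: topspace_Euclidean_space)
  define N where "N x = (\<Sum>i<n. \<bar>x i - c i\<bar>)" for x :: "nat \<Rightarrow> real"
  define scale where "scale r x = (\<lambda>i. c i + r (N x) * (x i - c i))" for r :: "real \<Rightarrow> real" and x
  define s where "s t = min 1 (max (1/2) (2 - \<delta> / max t (\<delta>/2)))" for t
  define s' where "s' u = max 1 (min 2 ((1 + \<delta> / max u (\<delta>/3)) / 2))" for u
  note s = radial_rescaling[OF \<delta>(1), folded s_def s'_def]
  have coord: "continuous_map (Euclidean_space n) euclideanreal (\<lambda>x. x i)" for i
    unfolding Euclidean_space_def
    by (intro continuous_map_from_subtopology continuous_map_product_projection) simp
  have contN: "continuous_map (Euclidean_space n) euclideanreal N"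
    unfolding N_def by (intro continuous_intros coord) auto
  have scale_top: "scale r x \<in> topspace (Euclidean_space n)"
    if "x \<in> topspace (Euclidean_space n)" for r x
    using that c0 by (auto simp: scale_def topspace_Euclidean_space)
  have cont: "continuous_map (Euclidean_space n) (Euclidean_space n) (scale r)"
    if "continuous_on UNIV r" for r
  proof -
    have "continuous_map (Euclidean_space n) euclideanreal (r \<circ> N)"
      by (rule continuous_map_compose[OF contN]) (use that in simp)
    then have "continuous_map (Euclidean_space n) euclideanreal (\<lambda>x. scale r x i)" for i
      unfolding scale_def by (intro continuous_intros coord) (simp_all add: o_def)
    then have "continuous_map (Euclidean_space n) (powertop_real UNIV) (scale r)"
      by (simp add: continuous_map_componentwise_UNIV)
    then show ?thesis
      using scale_top[of _ r] unfolding topspace_Euclidean_space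
      by (auto simp: Euclidean_space_def continuous_map_in_subtopology)
  qed
  have N_nonneg: "N x \<ge> 0" for x
    unfolding N_def by (intro sum_nonneg) simp
  have N_scale: "N (scale r x) = r (N x) * N x" if "r (N x) > 0" for r x
    using that by (simp add: N_def scale_def abs_mult sum_distrib_left)
  have inverse: "scale r' (scale r x) = x"
    if "r (N x) > 0" "r' (r (N x) * N x) * r (N x) = 1" for r r' x
  proof
    fix i
    have "scale r' (scale r x) i = c i + (r' (r (N x) * N x) * r (N x)) * (x i - c i)"
      using N_scale[of r x, OF that(1)] by (simp add: scale_def)
    then show "scale r' (scale r x) i = x i"
      by (simp add: that(2))
  qed
  have "scale s' (scale s x) = x" "scale s (scale s' x) = x" for x
    using s(5) s(6,7)[OF N_nonneg] by (blast intro: inverse)+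
  then have "homeomorphic_maps (Euclidean_space n) (Euclidean_space n) (scale s) (scale s')"
    unfolding homeomorphic_maps_def using cont[OF s(1)] cont[OF s(2)] by blast
  moreover have "scale s x = x \<and> scale s' x = x" if "x \<in> topspace (Euclidean_space n) - W" for x
  proof -
    have "N x \<ge> \<delta>"
      using \<delta>(2)[of x] that by (force simp: N_def)
    from s(3)[OF this] show ?thesis by (simp add: scale_def)
  qed
  moreover have "\<exists>x\<in>W. scale s x \<noteq> x"
  proof
    \<comment> \<open>A point at distance \<delta>/4 from the centre, where the factor is 1/2;
      coordinate 0 is available because \<open>n > 0\<close>.\<close>
    define x where "x = c(0 := c 0 + \<delta>/4)"
    have "N x = (\<Sum>i<n. if i = 0 then \<delta>/4 else 0)"
      unfolding N_def using \<delta>(1) by (intro sum.cong) (auto simp: x_def)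
    then have Nx: "N x = \<delta>/4" using assms(1) by simp
    then show "x \<in> W"
      using \<delta>(1) c0 assms(1) by (intro \<delta>(2)) (auto simp: topspace_Euclidean_space x_def N_def)
    have "scale s x 0 \<noteq> x 0"
      unfolding scale_def Nx s(4) using \<delta>(1) by (simp add: x_def)
    then show "scale s x \<noteq> x" by metis
  qed
  ultimately show ?thesis by blast
qed

section \<open>Transport of local moves through charts\<close>

text \<open>If a point of \<open>W\<close> left \<open>W\<close>, its image would be fixed by
  \<rho>, and injectivity would make the point equal to its image.\<close>

lemma supported_map_preserves:
  assumes hom: "homeomorphic_maps X X \<rho> \<sigma>" and "W \<subseteq> topspace X"
    and supp: "\<And>x. x \<in> topspace X - W \<Longrightarrow> \<rho> x = x"
    and x: "x \<in> W"
  shows "\<rho> x \<in> W"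
proof (rule ccontr)
  assume "\<rho> x \<notin> W"
  moreover have "x \<in> topspace X" using assms(2) x by blast
  then have "\<rho> x \<in> topspace X" "\<sigma> (\<rho> x) = x"
    using hom by (auto simp: homeomorphic_maps_def continuous_map_def)
  ultimately have "\<rho> (\<rho> x) = \<rho> x" using supp by blast
  then have "\<rho> x = x"
    using hom \<open>\<rho> x \<in> topspace X\<close> \<open>\<sigma> (\<rho> x) = x\<close> by (metis homeomorphic_maps_def)
  with x \<open>\<rho> x \<notin> W\<close> show False by simp
qed

text \<open>\<open>U\<close> and the complement of \<open>C\<close> form an open cover, and on their
  overlap both formulas give the identity. The closed set \<open>C\<close> inside \<open>U\<close>
  keeps the motion away from the boundary of the chart domain.\<close>

lemma transplanted_map_continuous:
  assumes U: "openin X U" and fg: "homeomorphic_maps (subtopology X U) (subtopology E V) f g"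
    and C: "closedin X C" "C \<subseteq> U"
    and \<rho>: "continuous_map E E \<rho>" "\<rho> ` V \<subseteq> V" and V: "V \<subseteq> topspace E"
    and supp: "\<And>x. x \<in> U - C \<Longrightarrow> \<rho> (f x) = f x"
  shows "continuous_map X X (\<lambda>x. if x \<in> U then g (\<rho> (f x)) else x)"
proof (rule pasting_lemma[where I = UNIV and T = "\<lambda>b. if b then U else topspace X - C"
      and f = "\<lambda>b x. if b then g (\<rho> (f x)) else x"])
  have UX: "U \<subseteq> topspace X" using openin_subset[OF U] .
  have f: "continuous_map (subtopology X U) (subtopology E V) f"
    and g: "continuous_map (subtopology E V) (subtopology X U) g"
    and gf: "\<And>x. x \<in> U \<Longrightarrow> g (f x) = x"
    using fg UX by (auto simp: homeomorphic_maps_def)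
  show "openin X (if b then U else topspace X - C)" for b
    using U C by auto
  show "continuous_map (subtopology X (if b then U else topspace X - C)) X
          (\<lambda>x. if b then g (\<rho> (f x)) else x)" for b
  proof (cases b)
    case True
    have "continuous_map (subtopology E V) (subtopology E V) \<rho>"
      using \<rho> by (auto simp: continuous_map_in_subtopology intro: continuous_map_from_subtopology)
    from continuous_map_compose[OF continuous_map_compose[OF f this] g]
    have "continuous_map (subtopology X U) X (g \<circ> (\<rho> \<circ> f))"
      by (rule continuous_map_into_fulltopology)
    with True show ?thesis by (simp add: o_def)
  qed simp
  show "(if b then g (\<rho> (f x)) else x) = (if b' then g (\<rho> (f x)) else x)"
    if "x \<in> topspace X \<inter> (if b then U else topspace X - C) \<inter> (if b' then U else topspace X - C)"
    for b b' x
    using that supp[of x] gf[of x] by (auto split: if_splits)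
  show "\<exists>b. b \<in> UNIV \<and> x \<in> (if b then U else topspace X - C) \<and>
          (if x \<in> U then g (\<rho> (f x)) else x) = (if b then g (\<rho> (f x)) else x)"
    if "x \<in> topspace X" for x
    using that C by (intro exI[of _ "x \<in> U"]) auto
qed

lemma manifold_local_move:
  assumes X: "topological_manifold n X" "regular_space X" and "n > 0"
    and V: "openin X V" "V \<noteq> {}"
  shows "\<exists>\<rho> \<sigma>. homeomorphic_maps X X \<rho> \<sigma> \<and>
           (\<forall>x\<in>topspace X - V. \<rho> x = x \<and> \<sigma> x = x) \<and> (\<exists>x\<in>V. \<rho> x \<noteq> x)"
proof -
  define E where "E = Euclidean_space n"
  obtain x0 where x0: "x0 \<in> V" using V by blast
  then have "x0 \<in> topspace X" using openin_subset[OF V(1)] by blast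
  then obtain U T where U: "openin X U" "x0 \<in> U" and T: "openin E T"
    and "subtopology X U homeomorphic_space subtopology E T"
    using X(1) unfolding topological_manifold_def E_def by blast
  then obtain f g where fg: "homeomorphic_maps (subtopology X U) (subtopology E T) f g"
    by (auto simp: homeomorphic_space_def)
  have UX: "U \<subseteq> topspace X" and TE: "T \<subseteq> topspace E"
    using openin_subset U(1) T by blast+
  have fT: "f x \<in> T" "g (f x) = x" if "x \<in> U" for x
    using fg that UX by (auto simp: homeomorphic_maps_def continuous_map_def)
  have gU: "g y \<in> U" "f (g y) = y" if "y \<in> T" for y
    using fg that TE by (auto simp: homeomorphic_maps_def continuous_map_def)
  have "neighbourhood_base_of (closedin X) X"
    using X(2) by (simp add: neighbourhood_base_of_closedin)
  moreover have "openin X (U \<inter> V)" "x0 \<in> U \<inter> V"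
    using U V x0 by auto
  \<comment> \<open>Regularity supplies the closed \<open>C\<close> needed for transplanting; the
    Euclidean move will be supported in the image of \<open>W\<close>.\<close>
  ultimately obtain W C where WC: "openin X W" "closedin X C" "x0 \<in> W" "W \<subseteq> C" "C \<subseteq> U \<inter> V"
    unfolding neighbourhood_base_of by meson
  have "openin (subtopology X U) W"
    using WC by (auto simp: openin_open_subtopology[OF U(1)])
  then have "openin (subtopology E T) (f ` W)"
    using homeomorphic_imp_open_map[OF homeomorphic_maps_imp_map[OF fg]] by (auto simp: open_map_def)
  then have fW: "openin E (f ` W)" "f ` W \<subseteq> T"
    by (auto simp: openin_open_subtopology[OF T])
  obtain \<rho> \<sigma> where hom: "homeomorphic_maps E E \<rho> \<sigma>"
    and supp: "\<And>y. y \<in> topspace E - f ` W \<Longrightarrow> \<rho> y = y" "\<And>y. y \<in> topspace E - f ` W \<Longrightarrow> \<sigma> y = y"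
    and moved: "\<exists>y\<in>f ` W. \<rho> y \<noteq> y"
    using Euclidean_space_local_move[OF \<open>n > 0\<close> fW(1)[unfolded E_def]] WC(3) unfolding E_def by blast
  have hom': "homeomorphic_maps E E \<sigma> \<rho>"
    using hom by (rule iffD1[OF homeomorphic_maps_sym])
  have fWE: "f ` W \<subseteq> topspace E" using openin_subset[OF fW(1)] .
  have \<rho>T: "\<rho> y \<in> T" "\<sigma> y \<in> T" "\<sigma> (\<rho> y) = y" "\<rho> (\<sigma> y) = y" if "y \<in> T" for y
  proof -
    have "y \<in> topspace E" using that TE by blast
    then show "\<sigma> (\<rho> y) = y" "\<rho> (\<sigma> y) = y" using hom by (auto simp: homeomorphic_maps_def)
    show "\<rho> y \<in> T"
      using supported_map_preserves[OF hom fWE supp(1)] supp(1)[of y] that fW(2) TE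
      by (cases "y \<in> f ` W") auto
    show "\<sigma> y \<in> T"
      using supported_map_preserves[OF hom' fWE supp(2)] supp(2)[of y] that fW(2) TE
      by (cases "y \<in> f ` W") auto
  qed
  have fnW: "f x \<in> topspace E - f ` W" if "x \<in> U - W" for x
  proof -
    have "f x \<notin> f ` W"
    proof
      assume "f x \<in> f ` W"
      then obtain w where "w \<in> W" "f x = f w" by blast
      then have "x = w" using fT(2)[of x] fT(2)[of w] that WC by (metis DiffD1 IntD1 subsetD)
      with that \<open>w \<in> W\<close> show False by blast
    qed
    then show ?thesis using fT(1)[of x] that TE by blast
  qed
  define \<rho>' where "\<rho>' x = (if x \<in> U then g (\<rho> (f x)) else x)" for x
  define \<sigma>' where "\<sigma>' x = (if x \<in> U then g (\<sigma> (f x)) else x)" for x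
  have CU: "C \<subseteq> U" using WC by blast
  have "continuous_map X X \<rho>'"
    unfolding \<rho>'_def
  proof (rule transplanted_map_continuous[OF U(1) fg WC(2) CU _ _ TE])
    show "\<rho> (f x) = f x" if "x \<in> U - C" for x
      using that WC(4) by (intro supp(1) fnW) blast
  qed (use hom \<rho>T(1) in \<open>auto simp: homeomorphic_maps_def\<close>)
  moreover have "continuous_map X X \<sigma>'"
    unfolding \<sigma>'_def
  proof (rule transplanted_map_continuous[OF U(1) fg WC(2) CU _ _ TE])
    show "\<sigma> (f x) = f x" if "x \<in> U - C" for x
      using that WC(4) by (intro supp(2) fnW) blast
  qed (use hom \<rho>T(2) in \<open>auto simp: homeomorphic_maps_def\<close>)
  ultimately have "homeomorphic_maps X X \<rho>' \<sigma>'"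
    using fT gU \<rho>T by (auto simp: homeomorphic_maps_def \<rho>'_def \<sigma>'_def)
  moreover have "\<rho>' x = x \<and> \<sigma>' x = x" if "x \<in> topspace X - V" for x
  proof (cases "x \<in> U")
    case True
    then have "f x \<in> topspace E - f ` W" using fnW[of x] that WC by blast
    then show ?thesis using supp[of "f x"] fT[OF True] by (simp add: \<rho>'_def \<sigma>'_def)
  qed (simp add: \<rho>'_def \<sigma>'_def)
  moreover have "\<exists>x\<in>V. \<rho>' x \<noteq> x"
  proof -
    obtain w where w: "w \<in> W" "\<rho> (f w) \<noteq> f w" using moved by blast
    then have "w \<in> U" "w \<in> V" using WC by auto
    moreover have "\<rho>' w \<noteq> w"
      using w(2) \<open>w \<in> U\<close> gU(2)[OF \<rho>T(1)[OF fT(1)[OF \<open>w \<in> U\<close>]]] by (auto simp: \<rho>'_def)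
    ultimately show ?thesis by blast
  qed
  ultimately show ?thesis by blast
qed

section \<open>Homeomorphisms preserving a sequence of blocks\<close>

context lcsc_Hausdorff_space
begin

lemma open_block_outside_compact:
  assumes "\<not> compact_space X" and D: "compactin X D"
  obtains V where "openin X V" "V \<noteq> {}" "compactin X (X closure_of V)" "D \<inter> X closure_of V = {}"
proof -
  have "closedin X D"
    using Hausdorff D by (rule compactin_imp_closedin)
  moreover have "D \<noteq> topspace X"
    using assms unfolding compact_space_def by blast
  ultimately have op: "openin X (topspace X - D)" and "topspace X - D \<noteq> {}"
    using compactin_subset_topspace[OF D] by auto
  then obtain x where x: "x \<in> topspace X - D" by blast
  have "neighbourhood_base_of (\<lambda>C. compactin X C \<and> closedin X C) X"
    using locally_compact Hausdorff locally_compact_space_neighbourhood_base_closedin[of X] by blast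
  then obtain V C where V: "openin X V" "compactin X C" "closedin X C" "x \<in> V" "V \<subseteq> C" "C \<subseteq> topspace X - D"
    using op x unfolding neighbourhood_base_of by meson
  have cl: "X closure_of V \<subseteq> C"
    using V by (intro closure_of_minimal)
  show ?thesis
  proof (rule that[of V])
    show "compactin X (X closure_of V)"
      using V(2) cl closedin_closure_of by (rule closed_compactin)
  qed (use V cl in auto)
qed

text \<open>The closures are disjoint, not only the blocks, so that a point has a neighbourhood
  meeting at most one block. They are compact so that finitely many blocks can be absorbed into an
  exceptional compact set.\<close>

definition locally_finite_blocks :: "(nat \<Rightarrow> 'a set) \<Rightarrow> bool" where
  "locally_finite_blocks V \<longleftrightarrow>
     (\<forall>i. openin X (V i) \<and> V i \<noteq> {} \<and> compactin X (X closure_of V i)) \<and>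
     (\<forall>i j. i \<noteq> j \<longrightarrow> X closure_of V i \<inter> X closure_of V j = {}) \<and>
     (\<forall>K. compactin X K \<longrightarrow> finite {i. K \<inter> V i \<noteq> {}})"

lemma locally_finite_blocks_exist:
  assumes nc: "\<not> compact_space X"
  shows "\<exists>V. locally_finite_blocks V"
proof -
  obtain C where C: "\<And>k :: nat. compactin X (C k)" "\<And>k l. k \<le> l \<Longrightarrow> C k \<subseteq> C l"
    "\<And>K. compactin X K \<Longrightarrow> \<exists>k. K \<subseteq> C k"
    by (rule compactin_exhaustion) (rule that)
  \<comment> \<open>\<open>E\<close> collects the closures of the blocks chosen so far. Each new
    block avoids the previous \<open>E\<close>, which gives disjointness, and also
    \<open>C n\<close>, which gives local finiteness.\<close>
  define P where "P n p \<longleftrightarrow> (case p of (V, E) \<Rightarrow> openin X V \<and> V \<noteq> {} \<and> compactin X (X closure_of V) \<and>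
    compactin X E \<and> X closure_of V \<subseteq> E \<and> C n \<inter> X closure_of V = {})" for n p
  define Q where "Q p p' \<longleftrightarrow> snd p \<inter> X closure_of (fst p') = {} \<and> snd p \<subseteq> snd p'" for p p' :: "'a set \<times> 'a set"
  have "\<exists>f. \<forall>n. P n (f n) \<and> Q (f n) (f (Suc n))"
  proof (rule dependent_nat_choice)
    obtain V where "openin X V" "V \<noteq> {}" "compactin X (X closure_of V)" "C 0 \<inter> X closure_of V = {}"
      by (rule open_block_outside_compact[OF nc C(1)[of 0]]) (rule that)
    then show "\<exists>p. P 0 p"
      by (intro exI[of _ "(V, X closure_of V)"]) (auto simp: P_def)
  next
    fix p n assume "P n p"
    then have E: "compactin X (snd p \<union> C (Suc n))"
      using C(1) by (auto simp: P_def intro: compactin_Un)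
    obtain V where "openin X V" "V \<noteq> {}" "compactin X (X closure_of V)"
      "(snd p \<union> C (Suc n)) \<inter> X closure_of V = {}"
      by (rule open_block_outside_compact[OF nc E]) (rule that)
    then show "\<exists>p'. P (Suc n) p' \<and> Q p p'"
      using \<open>P n p\<close>
      by (intro exI[of _ "(V, snd p \<union> X closure_of V)"]) (auto simp: P_def Q_def intro: compactin_Un)
  qed
  then obtain f where f: "\<And>n. P n (f n)" "\<And>n. Q (f n) (f (Suc n))" by blast
  define V where "V n = fst (f n)" for n
  define E where "E n = snd (f n)" for n
  have V: "openin X (V n)" "V n \<noteq> {}" "compactin X (X closure_of V n)" "X closure_of V n \<subseteq> E n"
    "C n \<inter> X closure_of V n = {}" for n
    using f(1)[of n] by (auto simp: P_def V_def E_def split: prod.splits)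
  have E: "E n \<inter> X closure_of V (Suc n) = {}" "E n \<subseteq> E (Suc n)" for n
    using f(2)[of n] by (auto simp: Q_def V_def E_def)
  have monoE: "E m \<subseteq> E n" if "m \<le> n" for m n
    using E(2) that by (rule lift_Suc_mono_le)
  have disj: "X closure_of V m \<inter> X closure_of V n = {}" if mn: "m < n" for m n
  proof -
    obtain k where k: "n = Suc k" "m \<le> k" using mn by (cases n) auto
    then show ?thesis using V(4)[of m] monoE[of m k] E(1)[of k] by auto
  qed
  have "finite {i. K \<inter> V i \<noteq> {}}" if K: "compactin X K" for K
  proof -
    obtain k where k: "K \<subseteq> C k" using C(3)[OF K] by blast
    have "i < k" if "K \<inter> V i \<noteq> {}" for i
    proof (rule ccontr)
      assume "\<not> i < k"
      then have "K \<subseteq> C i" using k C(2)[of k i] by auto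
      moreover have "V i \<subseteq> X closure_of V i"
        using V(1) by (simp add: closure_of_subset openin_subset)
      ultimately show False using V(5)[of i] that by blast
    qed
    then have "{i. K \<inter> V i \<noteq> {}} \<subseteq> {..<k}" by blast
    then show ?thesis by (rule finite_subset) simp
  qed
  moreover have "X closure_of V i \<inter> X closure_of V j = {}" if "i \<noteq> j" for i j
    using that disj[of i j] disj[of j i] by (cases "i < j") auto
  ultimately have "locally_finite_blocks V"
    unfolding locally_finite_blocks_def using V(1-3) by simp
  then show ?thesis by blast
qed

section \<open>Gluing homeomorphisms blockwise\<close>

definition block_homeos :: "(nat \<Rightarrow> 'a set) \<Rightarrow> (('a \<Rightarrow> 'a) \<times> ('a \<Rightarrow> 'a)) set" where
  "block_homeos V = {(\<phi>, \<psi>). homeomorphic_maps X X \<phi> \<psi> \<and>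
     (\<forall>i. \<forall>x\<in>V i. \<phi> x \<in> V i \<and> \<psi> x \<in> V i) \<and>
     (\<forall>x\<in>topspace X - (\<Union>i. V i). \<phi> x = x \<and> \<psi> x = x)}"

definition block_glue :: "(nat \<Rightarrow> 'a set) \<Rightarrow> (nat \<Rightarrow> 'a \<Rightarrow> 'a) \<Rightarrow> 'a \<Rightarrow> 'a" where
  "block_glue V f x = (if x \<in> (\<Union>i. V i) then f (THE i. x \<in> V i) x else x)"

context
  fixes V :: "nat \<Rightarrow> 'a set"
  assumes V: "locally_finite_blocks V"
begin

lemma block_open: "openin X (V i)" and block_nonempty: "V i \<noteq> {}"
  and block_compact: "compactin X (X closure_of V i)"
  and block_closure_disjoint: "i \<noteq> j \<Longrightarrow> X closure_of V i \<inter> X closure_of V j = {}"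
  and block_finite: "compactin X K \<Longrightarrow> finite {i. K \<inter> V i \<noteq> {}}"
  using V by (auto simp: locally_finite_blocks_def)

lemma block_subset: "V i \<subseteq> topspace X" "V i \<subseteq> X closure_of V i"
  using openin_subset[OF block_open] by (auto simp: closure_of_subset)

lemma block_unique: "\<lbrakk>x \<in> V i; x \<in> V j\<rbrakk> \<Longrightarrow> i = j"
  using block_closure_disjoint[of i j] block_subset(2)[of i] block_subset(2)[of j] by blast

lemma block_glue_in: "x \<in> V i \<Longrightarrow> block_glue V f x = f i x"
proof -
  assume x: "x \<in> V i"
  then have "(THE i. x \<in> V i) = i"
    using block_unique by blast
  with x show ?thesis by (auto simp: block_glue_def)
qed

lemma block_glue_notin: "x \<notin> (\<Union>i. V i) \<Longrightarrow> block_glue V f x = x"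
  by (simp add: block_glue_def)

lemma neighbourhood_meets_one_block:
  assumes x: "x \<in> topspace X"
  shows "\<exists>W i. openin X W \<and> x \<in> W \<and> (\<forall>j. j \<noteq> i \<longrightarrow> W \<inter> V j = {})"
proof -
  obtain U K where U: "openin X U" "compactin X K" "x \<in> U" "U \<subseteq> K"
    by (rule compact_neighbourhood[OF x])
  \<comment> \<open>Only finitely many blocks meet \<open>K\<close>, and the closures of those
    staying away from \<open>x\<close> can be cut out. At most one block remains, since
    \<open>x\<close> lies in at most one closure.\<close>
  define J where "J = {j. K \<inter> V j \<noteq> {} \<and> x \<notin> X closure_of V j}"
  have "finite J"
    unfolding J_def by (rule finite_subset[OF _ block_finite[OF U(2)]]) blast
  define W where "W = U - (\<Union>j\<in>J. X closure_of V j)"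
  have "closedin X (\<Union>j\<in>J. X closure_of V j)"
    using \<open>finite J\<close> by (intro closedin_Union) auto
  then have "openin X W"
    unfolding W_def by (rule openin_diff[OF U(1)])
  moreover have "x \<in> W" using U(3) by (auto simp: W_def J_def)
  moreover have "\<exists>i. \<forall>j. j \<noteq> i \<longrightarrow> W \<inter> V j = {}"
  proof -
    have meets: "x \<in> X closure_of V j" if "W \<inter> V j \<noteq> {}" for j
    proof (rule ccontr)
      assume "x \<notin> X closure_of V j"
      moreover have "K \<inter> V j \<noteq> {}" using that U(4) by (auto simp: W_def)
      ultimately have "j \<in> J" by (simp add: J_def)
      then have "W \<inter> X closure_of V j = {}" by (auto simp: W_def)
      with that block_subset(2)[of j] show False by blast
    qed
    show ?thesis
    proof (cases "\<exists>i. x \<in> X closure_of V i")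
      case True
      then obtain i where "x \<in> X closure_of V i" by blast
      then have "W \<inter> V j = {}" if "j \<noteq> i" for j
        using meets[of j] block_closure_disjoint[OF that] by blast
      then show ?thesis by blast
    qed (use meets in blast)
  qed
  ultimately show ?thesis by blast
qed

text \<open>Off the blocks all \<open>f i\<close> are the identity, so on an open set meeting at
  most block \<open>i\<close> the glued map coincides with \<open>f i\<close>.\<close>

lemma block_glue_continuous:
  assumes cont: "\<And>i. continuous_map X X (f i)"
    and off: "\<And>i x. x \<in> topspace X - (\<Union>i. V i) \<Longrightarrow> f i x = x"
  shows "continuous_map X X (block_glue V f)"
proof -
  obtain W ix where W: "\<And>x. x \<in> topspace X \<Longrightarrow> openin X (W x)" "\<And>x. x \<in> topspace X \<Longrightarrow> x \<in> W x"
    "\<And>x j. \<lbrakk>x \<in> topspace X; j \<noteq> ix x\<rbrakk> \<Longrightarrow> W x \<inter> V j = {}"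
    using neighbourhood_meets_one_block by metis
  have eq: "f (ix x) y = block_glue V f y" if x: "x \<in> topspace X" and y: "y \<in> W x" for x y
  proof (cases "\<exists>j. y \<in> V j")
    case True
    then obtain j where j: "y \<in> V j" by blast
    then have "j = ix x" using W(3)[OF x, of j] y by blast
    with j show ?thesis by (simp add: block_glue_in)
  next
    case False
    have "y \<in> topspace X" using W(1)[OF x] y openin_subset by blast
    with False show ?thesis by (simp add: block_glue_notin off)
  qed
  show ?thesis
  proof (rule pasting_lemma[where I = "topspace X" and T = W and f = "\<lambda>x. f (ix x)"])
    show "continuous_map (subtopology X (W x)) X (f (ix x))" for x
      using cont by (rule continuous_map_from_subtopology)
    show "f (ix x) y = f (ix x') y"
      if "x \<in> topspace X" "x' \<in> topspace X" "y \<in> topspace X \<inter> W x \<inter> W x'" for x x' y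
      using eq[OF that(1), of y] eq[OF that(2), of y] that(3) by simp
    show "\<exists>j. j \<in> topspace X \<and> x \<in> W j \<and> block_glue V f x = f (ix j) x" if "x \<in> topspace X" for x
      using W(2)[OF that] eq[OF that] that by (intro exI[of _ x]) simp
  qed (rule W(1))
qed

lemma block_glue_mem:
  assumes "\<And>i. (\<phi> i, \<psi> i) \<in> block_homeos V"
  shows "(block_glue V \<phi>, block_glue V \<psi>) \<in> block_homeos V"
proof -
  have hom: "homeomorphic_maps X X (\<phi> i) (\<psi> i)" for i
    using assms by (auto simp: block_homeos_def)
  have inV: "\<phi> i x \<in> V j" "\<psi> i x \<in> V j" if "x \<in> V j" for i j x
    using assms[of i] that by (auto simp: block_homeos_def)
  have off: "\<phi> i x = x" "\<psi> i x = x" if "x \<in> topspace X - (\<Union>i. V i)" for i x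
    using assms[of i] that by (auto simp: block_homeos_def)
  have glue_in: "block_glue V \<phi> x \<in> V i" "block_glue V \<psi> x \<in> V i" if "x \<in> V i" for x i
    using inV[OF that] that by (simp_all add: block_glue_in)
  have inv: "\<psi> i (\<phi> i x) = x" "\<phi> i (\<psi> i x) = x" if "x \<in> topspace X" for x i
    using hom[of i] that by (auto simp: homeomorphic_maps_def)
  have "block_glue V \<psi> (block_glue V \<phi> x) = x \<and> block_glue V \<phi> (block_glue V \<psi> x) = x"
    if x: "x \<in> topspace X" for x
  proof (cases "x \<in> (\<Union>i. V i)")
    case True
    then obtain i where i: "x \<in> V i" by blast
    then show ?thesis
      using inv[OF x] by (simp add: block_glue_in[OF i] block_glue_in[OF inV(1)[OF i]]
          block_glue_in[OF inV(2)[OF i]])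
  qed (simp add: block_glue_notin)
  moreover have "continuous_map X X (block_glue V \<phi>)" "continuous_map X X (block_glue V \<psi>)"
    using hom off by (auto intro!: block_glue_continuous simp: homeomorphic_maps_def)
  ultimately have "homeomorphic_maps X X (block_glue V \<phi>) (block_glue V \<psi>)"
    unfolding homeomorphic_maps_def by blast
  then show ?thesis
    using glue_in by (auto simp: block_homeos_def block_glue_notin)
qed

lemma block_homeos_id: "(id, id) \<in> block_homeos V"
  by (simp add: block_homeos_def homeomorphic_maps_id)

lemma block_homeos_compose:
  assumes "(\<phi>, \<psi>) \<in> block_homeos V" "(\<rho>, \<sigma>) \<in> block_homeos V"
  shows "(\<phi> \<circ> \<rho>, \<sigma> \<circ> \<psi>) \<in> block_homeos V"
proof -
  have "homeomorphic_maps X X (\<phi> \<circ> \<rho>) (\<sigma> \<circ> \<psi>)"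
    using assms homeomorphic_maps_compose[of X X \<rho> \<sigma> X \<phi> \<psi>] by (simp add: block_homeos_def)
  with assms show ?thesis
    by (simp add: block_homeos_def)
qed

section \<open>Saturation and small moves of the block group\<close>

text \<open>\<open>\<phi> n\<close> solves the equations with indices up to \<open>n\<close>. Block
  \<open>i\<close> receives the solution of a level \<open>l i\<close> at which the errors on this
  block are below \<open>1 / real (l i)\<close>; since few blocks have a low level, the glued map
  solves all equations.\<close>

lemma block_homeos_saturated:
  assumes P: "countable P"
    and fin: "\<And>F. \<lbrakk>finite F; F \<subseteq> P\<rbrakk> \<Longrightarrow>
      \<exists>(\<phi>, \<psi>)\<in>block_homeos V. \<forall>(b, d)\<in>F. eq_at_infinity X (\<lambda>x. d (\<phi> x)) b"
  shows "\<exists>(\<phi>, \<psi>)\<in>block_homeos V. \<forall>(b, d)\<in>P. eq_at_infinity X (\<lambda>x. d (\<phi> x)) b"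
proof (cases "P = {}")
  case True
  then show ?thesis using block_homeos_id by blast
next
  case False
  define p where "p = from_nat_into P"
  have p: "range p = P"
    unfolding p_def using False P by (rule range_from_nat_into)
  define b where "b j = fst (p j)" for j
  define d where "d j = snd (p j)" for j
  have pbd: "p j = (b j, d j)" for j by (simp add: b_def d_def)
  have "\<exists>\<phi> \<psi>. (\<phi>, \<psi>) \<in> block_homeos V \<and> (\<forall>j\<le>n. eq_at_infinity X (\<lambda>x. d j (\<phi> x)) (b j))" for n
  proof -
    have "\<exists>(\<phi>, \<psi>)\<in>block_homeos V. \<forall>(b, d)\<in>p ` {..n}. eq_at_infinity X (\<lambda>x. d (\<phi> x)) b"
      by (rule fin) (use p in auto)
    then show ?thesis by (auto simp: pbd)
  qed
  then obtain \<phi> \<psi> where H: "\<And>n. (\<phi> n, \<psi> n) \<in> block_homeos V"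
    and eq: "\<And>n j. j \<le> n \<Longrightarrow> eq_at_infinity X (\<lambda>x. d j (\<phi> n x)) (b j)"
    by metis
  \<comment> \<open>Level \<open>k\<close> concerns the equations with indices below
    \<open>k\<close>, the last of which is \<open>k - 1\<close>; level 0 is vacuous, as
    \<open>slow_level\<close> requires.\<close>
  define good where "good k i \<longleftrightarrow>
    (\<forall>j<k. \<forall>x\<in>V i. \<bar>d j (\<phi> (k - 1) x) - b j x\<bar> < 1 / real k)" for k i
  have "finite {i \<in> UNIV. \<not> good k i}" for k
  proof -
    have "finite {i. \<exists>x\<in>V i. \<not> \<bar>d j (\<phi> (k - 1) x) - b j x\<bar> < 1 / real k}" if "j < k" for j
    proof -
      have "eq_at_infinity X (\<lambda>x. d j (\<phi> (k - 1) x)) (b j)"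
        using that by (intro eq) simp
      moreover have "1 / real k > 0" using that by simp
      ultimately obtain K where K: "compactin X K"
        "\<And>x. x \<in> topspace X - K \<Longrightarrow> \<bar>d j (\<phi> (k - 1) x) - b j x\<bar> < 1 / real k"
        unfolding eq_at_infinity_def by blast
      have "{i. \<exists>x\<in>V i. \<not> \<bar>d j (\<phi> (k - 1) x) - b j x\<bar> < 1 / real k} \<subseteq> {i. K \<inter> V i \<noteq> {}}"
        using K(2) block_subset(1) by blast
      then show ?thesis using block_finite[OF K(1)] by (rule finite_subset)
    qed
    then have "finite (\<Union>j<k. {i. \<exists>x\<in>V i. \<not> \<bar>d j (\<phi> (k - 1) x) - b j x\<bar> < 1 / real k})"
      by blast
    then show ?thesis
      by (rule rev_finite_subset) (auto simp: good_def)
  qed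
  then have "\<exists>l :: nat \<Rightarrow> nat. (\<forall>i\<in>UNIV. good (l i) i) \<and> (\<forall>k. finite {i \<in> UNIV. l i < k})"
    by (intro slow_level) (auto simp: good_def)
  then obtain l where l: "\<And>i. good (l i) i" "\<And>k. finite {i. l i < k}" by auto
  define \<phi>' where "\<phi>' = block_glue V (\<lambda>i. \<phi> (l i - 1))"
  define \<psi>' where "\<psi>' = block_glue V (\<lambda>i. \<psi> (l i - 1))"
  have H': "(\<phi>', \<psi>') \<in> block_homeos V"
    unfolding \<phi>'_def \<psi>'_def by (rule block_glue_mem) (rule H)
  have "eq_at_infinity X (\<lambda>x. d j (\<phi>' x)) (b j)" for j
    unfolding eq_at_infinity_def
  proof (intro allI impI)
    fix \<epsilon> :: real assume "\<epsilon> > 0"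
    then obtain k0 where k0: "1 / real (Suc k0) < \<epsilon>"
      using nat_approx_posE[of \<epsilon>] by auto
    define k where "k = max (Suc j) (Suc k0)"
    obtain K where K: "compactin X K" "\<And>x. x \<in> topspace X - K \<Longrightarrow> \<bar>d j (\<phi> j x) - b j x\<bar> < \<epsilon>"
      using eq[of j j] \<open>\<epsilon> > 0\<close> unfolding eq_at_infinity_def by blast
    \<comment> \<open>\<open>K\<close> serves the points off the blocks, where \<phi>' and
      \<open>\<phi> j\<close> are both the identity; the closures absorb the finitely many blocks
      whose level is too low.\<close>
    define L where "L = K \<union> (\<Union>i\<in>{i. l i < k}. X closure_of V i)"
    have "compactin X L"
      unfolding L_def using K(1) l(2) block_compact by (intro compactin_Un compactin_Union) auto
    moreover have "\<bar>d j (\<phi>' x) - b j x\<bar> < \<epsilon>" if x: "x \<in> topspace X - L" for x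
    proof (cases "x \<in> (\<Union>i. V i)")
      case True
      then obtain i where i: "x \<in> V i" by blast
      then have "\<not> l i < k"
        using x block_subset(2)[of i] by (auto simp: L_def)
      then have "j < l i" "Suc k0 \<le> l i" by (auto simp: k_def)
      then have "\<bar>d j (\<phi> (l i - 1) x) - b j x\<bar> < 1 / real (l i)"
        using l(1)[of i] i by (simp add: good_def)
      also have "1 / real (l i) \<le> 1 / real (Suc k0)"
        using \<open>Suc k0 \<le> l i\<close> by (intro divide_left_mono) auto
      finally show ?thesis
        using k0 i by (simp add: \<phi>'_def block_glue_in)
    next
      case False
      then have "\<phi> j x = x"
        using H[of j] x by (auto simp: block_homeos_def)
      moreover have "\<phi>' x = x"
        using False by (simp add: \<phi>'_def block_glue_notin)
      ultimately show ?thesis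
        using K(2)[of x] x by (simp add: L_def)
    qed
    ultimately show "\<exists>K. compactin X K \<and> (\<forall>x\<in>topspace X - K. \<bar>d j (\<phi>' x) - b j x\<bar> < \<epsilon>)"
      by blast
  qed
  then have "\<forall>(b', d')\<in>P. eq_at_infinity X (\<lambda>x. d' (\<phi>' x)) b'"
    unfolding p[symmetric] by (auto simp: pbd)
  with H' show ?thesis by blast
qed

text \<open>A homeomorphism supported in \<open>W\<close> maps \<open>W\<close> to itself and
  therefore changes each member of \<open>D\<close> by less than \<epsilon>.\<close>

lemma small_oscillation_subblock:
  assumes "finite D" "D \<subseteq> unit_funs X" "\<epsilon> > 0"
  shows "\<exists>W. openin X W \<and> W \<noteq> {} \<and> W \<subseteq> V i \<and> (\<forall>h\<in>D. \<forall>x\<in>W. \<forall>y\<in>W. \<bar>h x - h y\<bar> < \<epsilon>)"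
proof -
  obtain x0 where x0: "x0 \<in> V i" using block_nonempty by blast
  define W where "W = V i \<inter> (\<Inter>h\<in>D. {x \<in> topspace X. h x \<in> ball (h x0) (\<epsilon>/2)}) "
  have "openin X {x \<in> topspace X. h x \<in> ball (h x0) (\<epsilon>/2)}" if "h \<in> D" for h
    using that assms(2) by (intro openin_continuous_map_preimage[OF unit_funs_continuous]) auto
  then have "openin X W"
    unfolding W_def using assms(1) block_open[of i]
    by (cases "D = {}") (auto intro!: openin_Int openin_Inter)
  moreover have "x0 \<in> W"
    using x0 block_subset(1)[of i] assms(3) by (auto simp: W_def)
  moreover have "\<bar>h x - h y\<bar> < \<epsilon>" if "h \<in> D" "x \<in> W" "y \<in> W" for h x y
  proof -
    have "\<bar>h x0 - h x\<bar> < \<epsilon>/2" "\<bar>h x0 - h y\<bar> < \<epsilon>/2"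
      using that by (auto simp: W_def dist_real_def)
    then show ?thesis by linarith
  qed
  ultimately show ?thesis by (intro exI[of _ W]) (auto simp: W_def)
qed

text \<open>In block \<open>i\<close> the move is confined to a set on which the functions
  enumerated up to \<open>i\<close> oscillate by less than \<open>1 / real (Suc i)\<close>. Each
  function in \<open>D\<close> is thus changed by amounts tending to 0, although every block
  contains a moved point.\<close>

lemma block_homeos_small_moves:
  assumes D: "countable D" "D \<subseteq> unit_funs X"
    and local_move: "\<And>W. \<lbrakk>openin X W; W \<noteq> {}\<rbrakk> \<Longrightarrow>
      \<exists>\<rho> \<sigma>. homeomorphic_maps X X \<rho> \<sigma> \<and> (\<forall>x\<in>topspace X - W. \<rho> x = x \<and> \<sigma> x = x) \<and> (\<exists>x\<in>W. \<rho> x \<noteq> x)"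
  shows "\<exists>(\<rho>, \<sigma>)\<in>block_homeos V. (\<forall>h\<in>D. eq_at_infinity X (\<lambda>x. h (\<rho> x)) h) \<and>
           (\<forall>K. compactin X K \<longrightarrow> (\<exists>x\<in>topspace X - K. \<rho> x \<noteq> x))"
proof -
  define e where "e = from_nat_into D"
  have e: "D \<subseteq> range e"
    unfolding e_def using D(1) by (rule subset_range_from_nat_into)
  \<comment> \<open>The intersection with \<open>D\<close> matters when \<open>D\<close> is empty:
    \<open>from_nat_into\<close> then returns a default that need not be continuous.\<close>
  have "\<exists>W. openin X W \<and> W \<noteq> {} \<and> W \<subseteq> V i \<and>
      (\<forall>h\<in>D \<inter> e ` {..i}. \<forall>x\<in>W. \<forall>y\<in>W. \<bar>h x - h y\<bar> < 1 / real (Suc i))" for i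
    using D(2) by (intro small_oscillation_subblock) auto
  then obtain W where W: "\<And>i. openin X (W i)" "\<And>i. W i \<noteq> {}" "\<And>i. W i \<subseteq> V i"
    and osc: "\<And>i h x y. \<lbrakk>h \<in> D \<inter> e ` {..i}; x \<in> W i; y \<in> W i\<rbrakk> \<Longrightarrow> \<bar>h x - h y\<bar> < 1 / real (Suc i)"
    by metis
  have WX: "W i \<subseteq> topspace X" for i using openin_subset[OF W(1)] .
  obtain \<rho> \<sigma> where hom: "\<And>i. homeomorphic_maps X X (\<rho> i) (\<sigma> i)"
    and off: "\<And>i x. x \<in> topspace X - W i \<Longrightarrow> \<rho> i x = x" "\<And>i x. x \<in> topspace X - W i \<Longrightarrow> \<sigma> i x = x"
    and moved: "\<And>i. \<exists>x\<in>W i. \<rho> i x \<noteq> x"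
    using local_move[OF W(1) W(2)] by metis
  have hom': "homeomorphic_maps X X (\<sigma> i) (\<rho> i)" for i
    using hom by (rule iffD1[OF homeomorphic_maps_sym])
  have inW: "\<rho> i x \<in> W i" "\<sigma> i x \<in> W i" if "x \<in> W i" for i x
    using supported_map_preserves[OF hom WX off(1) that] supported_map_preserves[OF hom' WX off(2) that]
    by blast+
  have H: "(\<rho> i, \<sigma> i) \<in> block_homeos V" for i
  proof -
    have "\<rho> i x \<in> V j \<and> \<sigma> i x \<in> V j" if "x \<in> V j" for j x
    proof (cases "x \<in> W i")
      case True
      then have "j = i" using W(3) that block_unique by blast
      then show ?thesis using inW[OF True] W(3) by blast
    next
      case False
      then show ?thesis using off[of x i] that block_subset(1)[of j] by auto
    qed
    moreover have "\<rho> i x = x \<and> \<sigma> i x = x" if "x \<in> topspace X - (\<Union>i. V i)" for x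
      using off[of x i] that W(3) by blast
    ultimately show ?thesis using hom by (auto simp: block_homeos_def)
  qed
  define \<rho>' where "\<rho>' = block_glue V \<rho>"
  have H': "(\<rho>', block_glue V \<sigma>) \<in> block_homeos V"
    unfolding \<rho>'_def by (rule block_glue_mem) (rule H)
  have "eq_at_infinity X (\<lambda>x. h (\<rho>' x)) h" if h: "h \<in> D" for h
    unfolding eq_at_infinity_def
  proof (intro allI impI)
    fix \<epsilon> :: real assume "\<epsilon> > 0"
    then obtain k0 where k0: "1 / real (Suc k0) < \<epsilon>"
      using nat_approx_posE[of \<epsilon>] by auto
    obtain j where j: "h = e j" using e h by blast
    define L where "L = (\<Union>i<max j k0. X closure_of V i)"
    have "compactin X L"
      unfolding L_def using block_compact by (intro compactin_Union) auto
    moreover have "\<bar>h (\<rho>' x) - h x\<bar> < \<epsilon>" if x: "x \<in> topspace X - L" for x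
    proof (cases "\<exists>i. x \<in> W i")
      case True
      then obtain i where i: "x \<in> W i" by blast
      then have "x \<in> V i" using W(3) by blast
      then have "\<not> i < max j k0"
        using x block_subset(2)[of i] by (auto simp: L_def)
      then have "\<bar>h (\<rho> i x) - h x\<bar> < 1 / real (Suc i)"
        using h j by (intro osc inW i) auto
      also have "1 / real (Suc i) \<le> 1 / real (Suc k0)"
        using \<open>\<not> i < max j k0\<close> by (intro divide_left_mono) auto
      finally show ?thesis
        using k0 \<open>x \<in> V i\<close> by (simp add: \<rho>'_def block_glue_in)
    next
      case False
      have "\<rho>' x = x"
      proof (cases "x \<in> (\<Union>i. V i)")
        case True
        then obtain i where "x \<in> V i" by blast
        then show ?thesis using off(1)[of x i] False x by (simp add: \<rho>'_def block_glue_in)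
      qed (simp add: \<rho>'_def block_glue_notin)
      then show ?thesis using \<open>\<epsilon> > 0\<close> by simp
    qed
    ultimately show "\<exists>K. compactin X K \<and> (\<forall>x\<in>topspace X - K. \<bar>h (\<rho>' x) - h x\<bar> < \<epsilon>)"
      by blast
  qed
  moreover have "\<exists>x\<in>topspace X - K. \<rho>' x \<noteq> x" if K: "compactin X K" for K
  proof -
    obtain i where i: "K \<inter> V i = {}"
      using ex_new_if_finite[OF infinite_UNIV_nat block_finite[OF K]] by blast
    obtain x where x: "x \<in> W i" "\<rho> i x \<noteq> x" using moved by blast
    then have "x \<in> V i" using W(3) by blast
    then show ?thesis
      using i x(2) block_subset(1)[of i] by (intro bexI[of _ x]) (auto simp: \<rho>'_def block_glue_in)
  qed
  ultimately show ?thesis using H' by blast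
qed

lemma saturated_homeo_group_block_homeos:
  assumes local_move: "\<And>W. \<lbrakk>openin X W; W \<noteq> {}\<rbrakk> \<Longrightarrow>
      \<exists>\<rho> \<sigma>. homeomorphic_maps X X \<rho> \<sigma> \<and> (\<forall>x\<in>topspace X - W. \<rho> x = x \<and> \<sigma> x = x) \<and> (\<exists>x\<in>W. \<rho> x \<noteq> x)"
  shows "saturated_homeo_group X (block_homeos V)"
proof
  show "homeomorphic_maps X X \<phi> \<psi>" if "(\<phi>, \<psi>) \<in> block_homeos V" for \<phi> \<psi>
    using that by (simp add: block_homeos_def)
  show "(id, id) \<in> block_homeos V"
    by (rule block_homeos_id)
  show "(\<phi> \<circ> \<rho>, \<sigma> \<circ> \<psi>) \<in> block_homeos V"
    if "(\<phi>, \<psi>) \<in> block_homeos V" "(\<rho>, \<sigma>) \<in> block_homeos V" for \<phi> \<psi> \<rho> \<sigma>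
    using that by (rule block_homeos_compose)
  show "\<exists>(\<phi>, \<psi>)\<in>block_homeos V. \<forall>(b, d)\<in>P. eq_at_infinity X (\<lambda>x. d (\<phi> x)) b"
    if "countable P" "P \<subseteq> unit_funs X \<times> unit_funs X"
      "\<And>F. \<lbrakk>finite F; F \<subseteq> P\<rbrakk> \<Longrightarrow>
        \<exists>(\<phi>, \<psi>)\<in>block_homeos V. \<forall>(b, d)\<in>F. eq_at_infinity X (\<lambda>x. d (\<phi> x)) b"
    for P
    using that(1,3) by (rule block_homeos_saturated)
  show "\<exists>(\<rho>, \<sigma>)\<in>block_homeos V. (\<forall>h\<in>D. eq_at_infinity X (\<lambda>x. h (\<rho> x)) h) \<and>
           (\<forall>K. compactin X K \<longrightarrow> (\<exists>x\<in>topspace X - K. \<rho> x \<noteq> x))"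
    if "countable D" "D \<subseteq> unit_funs X" for D
    using that local_move by (rule block_homeos_small_moves)
qed

end

end

theorem mainTheorem1:
  fixes X :: "'a topology" and n :: nat
  assumes "topological_manifold n X"
    and "locally_compact_space X"
    and "\<not> compact_space X"
    and "continuum_hypothesis"
  shows "\<exists>\<phi>. homeomorphic_map (cs_remainder X) (cs_remainder X) \<phi> \<and>
             \<not> trivial_remainder_homeo X \<phi>"
proof (cases "n = 0")
  case True
  \<comment> \<open>Points are open in dimension 0, and a singleton admits no local move, so the
    block group gives way to the group of all permutations.\<close>
  define S where "S = topspace X"
  have X: "X = discrete_topology S"
    using manifold_dim_0_discrete assms(1) unfolding True S_def by blast
  have "second_countable (discrete_topology S)"
    using assms(1) X unfolding topological_manifold_def by simp
  then have "countable S"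
    by (simp add: second_countable_discrete_topology)
  moreover have "infinite S"
    using assms(3) X by (metis compact_space_discrete_topology)
  ultimately interpret saturated_homeo_group "discrete_topology S"
    "{(\<phi>, \<psi>). homeomorphic_maps (discrete_topology S) (discrete_topology S) \<phi> \<psi>}"
    by (rule saturated_homeo_group_discrete)
  show ?thesis
    using nontrivial_homeomorphism_exists assms(3,4) unfolding X[symmetric] by blast
next
  case False
  interpret lcsc_Hausdorff_space X
    using assms(1,2) by unfold_locales (simp_all add: topological_manifold_def)
  obtain V where V: "locally_finite_blocks V"
    using locally_finite_blocks_exist[OF assms(3)] by blast
  interpret saturated_homeo_group X "block_homeos V"
    using saturated_homeo_group_block_homeos[OF V] manifold_local_move[OF assms(1) regular] False
    by blast
  show ?thesis
    using assms(4,3) by (rule nontrivial_homeomorphism_exists)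
qed

end
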